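(* Let $n\ge 1$, $R>0$ and let $\omega$ be a nontrivial ultrafilter on $\mathbf N$. The functions $\tau\mapsto\underline{\tilde\chi}_R(\tau)$ and $\tau\mapsto\tilde\chi_R^{\omega}(\tau)$ are concave and upper semi-continuous on $\mathcal S_R^n$. Furthermore, for every $\tau\in\mathcal S^n_R$, $$\underline{\tilde\chi}_R(\tau)\ge\underline{\chi}_R(\tau),\qquad \tilde\chi_R(\tau)\ge\chi_R(\tau),\qquad \tilde\chi_R^{\omega}(\tau)\ge\chi_R^{\omega}(\tau).$$ Finally, $\tilde\chi_R$ and $\tilde\chi_R^\omega$ are subadditive: if $1\le m<n$, $\tau\in\mathcal S_R^n$, and $\tau_1\in\mathcal S_R^m$, $\tau_2\in\mathcal S_R^{n-m}$ are the marginal states (restrictions of $\tau$) giving the noncommutative distributions of $X_1,\dots,X_m$ and of $X_{m+1},\dots,X_n$ respectively, then $$\tilde\chi_R(\tau)\le\tilde\chi_R(\tau_1)+\tilde\chi_R(\tau_2),\qquad \tilde\chi^\omega_R(\tau)\le\tilde\chi^\omega_R(\tau_1)+\tilde\chi^\omega_R(\tau_2).$$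
   Context: Trace states. $\mathbf C\langle X_1,\dots,X_n\rangle$ is the unital $*$-algebra of noncommutative polynomials in self-adjoint indeterminates. $\mathcal S_c^n$ is the set of positive, tracial, $*$-linear maps $\tau:\mathbf C\langle X_1,\dots,X_n\rangle\to\mathbf C$ with $\tau(1)=1$ such that for every $P$ there is a constant $R_P$ with $\tau((P^*P)^k)\le R_P^{2k}$ for all $k\ge0$. $\mathcal S_R^n$ is the set of those $\tau$ with $\tau(X_i^{2k})\le R^{2k}$ for all $i$ and all $k\ge 0$; it is a compact convex set for the topology of pointwise convergence on polynomials (the weak$^*$ topology, identifying $\mathcal S_R^n$ with the trace states of the free product $C^*$-algebra $*_{i=1}^nC([-R,R])$). For $\tau\in\mathcal S_R^n$, $\epsilon,K>0$, $V_{\epsilon,K}(\tau)$ is the set of $\sigma\in\mathcal S_R^n$ such that $|\tau(m)-\sigma(m)|<\epsilon$ for all monomials $m=X_{i_1}\cdots X_{i_k}$ of degree less than $K$. Matrices. $H_N^R$ is the set of Hermitian $N\times N$ matrices of operator norm at most $R$, with Lebesgue measure (for the Euclidean structure $\langle A,B\rangle=\mathrm{Tr}(AB)$). For $(M_1,\dots,M_n)\in(H_N^R)^n$, $\tau_{M_1,\dots,M_n}(P)=\frac1N\mathrm{Tr}(P(M_1,\dots,M_n))$. For a Borel probability measure $\mu$ on $(H_N^R)^n$, its barycenter is $\tau_\mu(P)=\int\frac1N\mathrm{Tr}(P(M_1,\dots,M_n))\,d\mu$, an element of $\mathcal S^n_R$. $\Gamma_R(\tau,\epsilon,K,N)$ is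 the set of $(M_1,\dots,M_n)\in(H_N^R)^n$ with $\tau_{M_1,\dots,M_n}\in V_{\epsilon,K}(\tau)$. Entropy. $\mathrm{Ent}(\mu)=-\int f\log f\,dx$ if $\mu=f\,dx$ with respect to Lebesgue measure and $\log f\in L^1(\mu)$, and $-\infty$ otherwise. Suprema over empty sets and $\log 0$ are $-\infty$. Free entropies. For $\tau\in\mathcal S_R^n$, $$\chi_R(\tau)=\lim_{K\to\infty,\epsilon\to0}\limsup_{N\to\infty}\Big(\tfrac1{N^2}\log\mathrm{Leb}(\Gamma_R(\tau,\epsilon,K,N))+\tfrac n2\log N\Big),$$ $$\tilde\chi_R(\tau)=\lim_{K\to\infty,\epsilon\to0}\limsup_{N\to\infty}\Big(\tfrac1{N^2}\sup_{\mu:\ \tau_\mu\in V_{\epsilon,K}(\tau)}\mathrm{Ent}(\mu)+\tfrac n2\log N\Big),$$ where the supremum is over Borel probability measures $\mu$ on $(H_N^R)^n$; the limits in $K,\epsilon$ are infima. $\underline\chi_R,\underline{\tilde\chi}_R$ are defined by the same formulas with $\liminf_{N\to\infty}$ in place of $\limsup_{N\to\infty}$, and $\chi^\omega_R,\tilde\chi^\omega_R$ with $\lim_{N\to\omega}$. All these take values in $[-\infty,\infty)$. *)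

theory Defs
  imports
    "HOL-Probability.Probability"
    "HOL-Library.Poly_Mapping"
    "Jordan_Normal_Form.Schur_Decomposition"
begin

section \<open>Noncommutative polynomials\<close>

text \<open>
  The algebra \<open>\<complex>\<langle>X\<^sub>0, X\<^sub>1, \<dots>\<rangle>\<close> is the monoid algebra of the free monoid on the letters
  \<open>0, 1, \<dots>\<close>; \<open>word \<Rightarrow>\<^sub>0 complex\<close> carries the convolution product of
  \<^theory>\<open>HOL-Library.Poly_Mapping\<close>, which needs concatenation of words to be written additively.
  Indeterminates are numbered from 0.
\<close>

datatype word = Word (letters: "nat list")

instantiation word :: monoid_add
begin

definition zero_word :: word where "0 = Word []"

definition plus_word :: "word \<Rightarrow> word \<Rightarrow> word" where
  "v + w = Word (letters v @ letters w)"

instance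
  by standard (simp_all add: zero_word_def plus_word_def)

end

type_synonym ncpoly = "word \<Rightarrow>\<^sub>0 complex"

definition words :: "nat \<Rightarrow> word set" where
  "words n = {w. set (letters w) \<subseteq> {..<n}}"

definition ncpolys :: "nat \<Rightarrow> ncpoly set" where
  "ncpolys n = {P. Poly_Mapping.keys P \<subseteq> words n}"

abbreviation monomial :: "word \<Rightarrow> ncpoly" where
  "monomial w \<equiv> Poly_Mapping.single w 1"

abbreviation indet :: "nat \<Rightarrow> ncpoly" where
  "indet i \<equiv> monomial (Word [i])"

abbreviation const :: "complex \<Rightarrow> ncpoly" where
  "const c \<equiv> Poly_Mapping.single 0 c"

definition star :: "ncpoly \<Rightarrow> ncpoly" where
  "star P = (\<Sum>w\<in>Poly_Mapping.keys P.
     Poly_Mapping.single (Word (rev (letters w))) (cnj (Poly_Mapping.lookup P w)))"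

definition shift :: "nat \<Rightarrow> ncpoly \<Rightarrow> ncpoly" where
  "shift k P = (\<Sum>w\<in>Poly_Mapping.keys P.
     Poly_Mapping.single (Word (map (\<lambda>i. i + k) (letters w))) (Poly_Mapping.lookup P w))"


section \<open>Trace states\<close>

text \<open>
  A functional on \<open>ncpolys n\<close> is an extensional function (\<open>undefined\<close> outside \<open>ncpolys n\<close>), so
  that functionals are equal iff they agree on \<open>ncpolys n\<close>.
\<close>

definition trace_states :: "nat \<Rightarrow> (ncpoly \<Rightarrow> complex) set" where
  "trace_states n = {\<tau> \<in> extensional (ncpolys n).
     (\<forall>P\<in>ncpolys n. \<forall>Q\<in>ncpolys n. \<tau> (P + Q) = \<tau> P + \<tau> Q) \<and>
     (\<forall>c. \<forall>P\<in>ncpolys n. \<tau> (const c * P) = c * \<tau> P) \<and>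
     (\<forall>P\<in>ncpolys n. \<tau> (star P) = cnj (\<tau> P)) \<and>
     (\<forall>P\<in>ncpolys n. \<tau> (star P * P) \<in> \<real>\<^sub>\<ge>\<^sub>0) \<and>
     (\<forall>P\<in>ncpolys n. \<forall>Q\<in>ncpolys n. \<tau> (P * Q) = \<tau> (Q * P)) \<and>
     \<tau> 1 = 1 \<and>
     (\<forall>P\<in>ncpolys n. \<exists>r::real. \<forall>k. Re (\<tau> ((star P * P) ^ k)) \<le> r ^ (2 * k))}"

definition states :: "nat \<Rightarrow> real \<Rightarrow> (ncpoly \<Rightarrow> complex) set" where
  "states n R = {\<tau> \<in> trace_states n.
     \<forall>i<n. \<forall>k. Re (\<tau> (indet i ^ (2 * k))) \<le> R ^ (2 * k)}"

definition state_topology :: "nat \<Rightarrow> real \<Rightarrow> (ncpoly \<Rightarrow> complex) topology" where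
  "state_topology n R =
     subtopology (product_topology (\<lambda>_. euclidean) (ncpolys n)) (states n R)"

definition nbhd ::
    "nat \<Rightarrow> real \<Rightarrow> (ncpoly \<Rightarrow> complex) \<Rightarrow> real \<Rightarrow> real \<Rightarrow> (ncpoly \<Rightarrow> complex) set" where
  "nbhd n R \<tau> \<epsilon> K = {\<sigma> \<in> states n R.
     \<forall>w\<in>words n. real (length (letters w)) < K \<longrightarrow>
       cmod (\<tau> (monomial w) - \<sigma> (monomial w)) < \<epsilon>}"

text \<open>
  The distribution of the first \<open>m\<close> indeterminates under \<open>\<tau>\<close> is \<open>marginal 0 m \<tau>\<close>; that of the
  last \<open>n - m\<close> ones, renumbered from 0, is \<open>marginal m (n - m) \<tau>\<close>.
\<close>

definition marginal :: "nat \<Rightarrow> nat \<Rightarrow> (ncpoly \<Rightarrow> complex) \<Rightarrow> ncpoly \<Rightarrow> complex" where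
  "marginal k m \<tau> = (\<lambda>P\<in>ncpolys m. \<tau> (shift k P))"


section \<open>Hermitian matrices and Lebesgue measure\<close>

definition herm :: "nat \<Rightarrow> complex mat set" where
  "herm N = {A \<in> carrier_mat N N. mat_adjoint A = A}"

definition vnorm :: "complex Matrix.vec \<Rightarrow> real" where
  "vnorm v = sqrt (Re (v \<bullet>c v))"

definition opnorm :: "complex mat \<Rightarrow> real" where
  "opnorm A = Sup {vnorm (A *\<^sub>v v) | v. v \<in> carrier_vec (dim_col A) \<and> vnorm v \<le> 1}"

definition herm_ball :: "nat \<Rightarrow> real \<Rightarrow> complex mat set" where
  "herm_ball N R = {A \<in> herm N. opnorm A \<le> R}"

definition tr :: "complex mat \<Rightarrow> complex" where
  "tr A = (\<Sum>i<dim_row A. A $$ (i, i))"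

text \<open>The Borel sets of \<open>herm N\<close> are induced by the embedding into \<open>\<complex>\<^bsup>N\<times>N\<^esup>\<close>.\<close>

definition herm_borel :: "nat \<Rightarrow> complex mat measure" where
  "herm_borel N = vimage_algebra (herm N)
     (\<lambda>A. \<lambda>ij\<in>{..<N} \<times> {..<N}. A $$ ij) (Pi\<^sub>M ({..<N} \<times> {..<N}) (\<lambda>_. borel))"

text \<open>
  Coordinates in an orthonormal basis of \<open>herm N\<close> for \<open>\<langle>A, B\<rangle> = Tr (A B)\<close>: the matrix units
  \<open>E\<^sub>a\<^sub>a\<close>, and \<open>(E\<^sub>a\<^sub>b + E\<^sub>b\<^sub>a) / \<surd>2\<close>, \<open>\<i> (E\<^sub>a\<^sub>b - E\<^sub>b\<^sub>a) / \<surd>2\<close> for \<open>a < b\<close>.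
  The coordinates with respect to the latter two are stored at \<open>(a, b)\<close> and \<open>(b, a)\<close>.
\<close>

definition herm_of_coords :: "nat \<Rightarrow> (nat \<times> nat \<Rightarrow> real) \<Rightarrow> complex mat" where
  "herm_of_coords N x = Matrix.mat N N (\<lambda>(a, b).
     if a = b then complex_of_real (x (a, a))
     else if a < b then Complex (x (a, b)) (x (b, a)) / complex_of_real (sqrt 2)
     else Complex (x (b, a)) (- x (a, b)) / complex_of_real (sqrt 2))"

definition herm_leb :: "nat \<Rightarrow> complex mat measure" where
  "herm_leb N =
     distr (Pi\<^sub>M ({..<N} \<times> {..<N}) (\<lambda>_. lborel)) (herm_borel N) (herm_of_coords N)"

definition leb_ball :: "nat \<Rightarrow> nat \<Rightarrow> real \<Rightarrow> (nat \<Rightarrow> complex mat) measure" where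
  "leb_ball n N R =
     restrict_space (Pi\<^sub>M {..<n} (\<lambda>_. herm_leb N)) (PiE {..<n} (\<lambda>_. herm_ball N R))"


section \<open>Matricial states\<close>

definition word_eval :: "nat \<Rightarrow> (nat \<Rightarrow> complex mat) \<Rightarrow> word \<Rightarrow> complex mat" where
  "word_eval N M w = foldr (\<lambda>i A. M i * A) (letters w) (1\<^sub>m N)"

definition poly_eval :: "nat \<Rightarrow> (nat \<Rightarrow> complex mat) \<Rightarrow> ncpoly \<Rightarrow> complex mat" where
  "poly_eval N M P = Matrix.mat N N (\<lambda>ij.
     \<Sum>w\<in>Poly_Mapping.keys P. Poly_Mapping.lookup P w * word_eval N M w $$ ij)"

definition matrix_state :: "nat \<Rightarrow> nat \<Rightarrow> (nat \<Rightarrow> complex mat) \<Rightarrow> ncpoly \<Rightarrow> complex" where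
  "matrix_state n N M = (\<lambda>P\<in>ncpolys n. tr (poly_eval N M P) / of_nat N)"

definition barycenter ::
    "nat \<Rightarrow> nat \<Rightarrow> (nat \<Rightarrow> complex mat) measure \<Rightarrow> ncpoly \<Rightarrow> complex" where
  "barycenter n N \<mu> = (\<lambda>P\<in>ncpolys n. \<integral>M. matrix_state n N M P \<partial>\<mu>)"

definition microstates ::
    "nat \<Rightarrow> real \<Rightarrow> (ncpoly \<Rightarrow> complex) \<Rightarrow> real \<Rightarrow> real \<Rightarrow> nat \<Rightarrow> (nat \<Rightarrow> complex mat) set" where
  "microstates n R \<tau> \<epsilon> K N =
     {M \<in> PiE {..<n} (\<lambda>_. herm_ball N R). matrix_state n N M \<in> nbhd n R \<tau> \<epsilon> K}"

definition borel_probs :: "nat \<Rightarrow> nat \<Rightarrow> real \<Rightarrow> (nat \<Rightarrow> complex mat) measure set" where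
  "borel_probs n N R = {\<mu>. prob_space \<mu> \<and> sets \<mu> = sets (leb_ball n N R)}"


section \<open>Entropy and free entropies\<close>

definition ln_ennreal :: "ennreal \<Rightarrow> ereal" where
  "ln_ennreal x = (if x = 0 then -\<infinity> else if x = \<infinity> then \<infinity> else ereal (ln (enn2real x)))"

text \<open>
  If \<open>\<mu>\<close> has any density with respect to \<open>L\<close>, then \<^const>\<open>RN_deriv\<close> is one.
\<close>

definition Ent :: "'a measure \<Rightarrow> 'a measure \<Rightarrow> ereal" where
  "Ent L \<mu> = (let f = (\<lambda>x. enn2real (RN_deriv L \<mu> x)) in
     if \<mu> = density L (\<lambda>x. ennreal (f x)) \<and> integrable \<mu> (\<lambda>x. ln (f x))
     then ereal (- (\<integral>x. f x * ln (f x) \<partial>L))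
     else -\<infinity>)"

text \<open>
  In the two definitions below, \<open>lm\<close> is the operation applied to the sequence indexed by \<open>N\<close>
  (\<^const>\<open>limsup\<close>, \<^const>\<open>liminf\<close>, or the limit along an ultrafilter).  Recall that
  \<open>Sup {} = -\<infinity>\<close> in \<^typ>\<open>ereal\<close>.
\<close>

definition chi_gen ::
    "((nat \<Rightarrow> ereal) \<Rightarrow> ereal) \<Rightarrow> nat \<Rightarrow> real \<Rightarrow> (ncpoly \<Rightarrow> complex) \<Rightarrow> ereal" where
  "chi_gen lm n R \<tau> = (INF (\<epsilon>, K)\<in>{0<..} \<times> {0<..}.
     lm (\<lambda>N. ereal (1 / real N ^ 2) *
               ln_ennreal (emeasure (leb_ball n N R) (microstates n R \<tau> \<epsilon> K N))
             + ereal (real n / 2 * ln (real N))))"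

definition tilde_chi_gen ::
    "((nat \<Rightarrow> ereal) \<Rightarrow> ereal) \<Rightarrow> nat \<Rightarrow> real \<Rightarrow> (ncpoly \<Rightarrow> complex) \<Rightarrow> ereal" where
  "tilde_chi_gen lm n R \<tau> = (INF (\<epsilon>, K)\<in>{0<..} \<times> {0<..}.
     lm (\<lambda>N. ereal (1 / real N ^ 2) *
               (SUP \<mu>\<in>{\<mu> \<in> borel_probs n N R. barycenter n N \<mu> \<in> nbhd n R \<tau> \<epsilon> K}.
                  Ent (leb_ball n N R) \<mu>)
             + ereal (real n / 2 * ln (real N))))"

abbreviation "chi \<equiv> chi_gen limsup"
abbreviation "lower_chi \<equiv> chi_gen liminf"
abbreviation "ultra_chi \<omega> \<equiv> chi_gen (Lim \<omega>)"

abbreviation "tilde_chi \<equiv> tilde_chi_gen limsup"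
abbreviation "lower_tilde_chi \<equiv> tilde_chi_gen liminf"
abbreviation "ultra_tilde_chi \<omega> \<equiv> tilde_chi_gen (Lim \<omega>)"

definition nontrivial_ultrafilter :: "nat filter \<Rightarrow> bool" where
  "nontrivial_ultrafilter \<omega> \<longleftrightarrow> \<omega> \<noteq> bot \<and>
     (\<forall>P. eventually P \<omega> \<or> eventually (\<lambda>k. \<not> P k) \<omega>) \<and>
     (\<forall>k. \<omega> \<noteq> principal {k})"


section \<open>Concavity and upper semicontinuity\<close>

definition concave_on_states ::
    "nat \<Rightarrow> real \<Rightarrow> ((ncpoly \<Rightarrow> complex) \<Rightarrow> ereal) \<Rightarrow> bool" where
  "concave_on_states n R F \<longleftrightarrow>
     (\<forall>\<sigma>\<in>states n R. \<forall>\<tau>\<in>states n R. \<forall>t\<in>{0..1}.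
        ereal t * F \<sigma> + ereal (1 - t) * F \<tau>
          \<le> F (\<lambda>P\<in>ncpolys n. of_real t * \<sigma> P + of_real (1 - t) * \<tau> P))"

definition usc_on_states ::
    "nat \<Rightarrow> real \<Rightarrow> ((ncpoly \<Rightarrow> complex) \<Rightarrow> ereal) \<Rightarrow> bool" where
  "usc_on_states n R F \<longleftrightarrow>
     (\<forall>a. openin (state_topology n R) {\<tau> \<in> states n R. F \<tau> < a})"

end

theory Submission
  imports Defs
begin

text \<open>
  Everything about the differential entropy follows from \<open>ln (g / f) \<le> g / f - 1\<close> integrated against a
  probability density \<open>f\<close>: with \<open>g\<close> constant it bounds entropies by the logarithm of the total volume,
  with \<open>g\<close> a convex combination of densities it gives concavity, and with \<open>g\<close> the product of the
  marginal densities it gives subadditivity.  A Gaussian estimate of the volume of the operator norm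
  ball bounds the rescaled entropies uniformly in \<open>N\<close>, so that no \<open>\<infinity> - \<infinity>\<close> occurs in the limits.
  Taking barycenters is affine and compatible with marginals, hence these properties pass to the
  suprema for each \<open>N\<close>; the superadditivity of \<open>liminf\<close> and the subadditivity of \<open>limsup\<close> carry
  them to the limit, and a limit along an ultrafilter is both.  The uniform measure on a set of
  microstates has the logarithm of its volume as entropy and its barycenter in the same
  neighbourhood, which compares the two free entropies.  Upper semicontinuity only uses that the
  neighbourhoods of a nearby state are contained in those of the given one.
\<close>

section \<open>Limits in the extended reals\<close>

text \<open>In \<open>ereal\<close> one has
  \<open>\<infinity> + (-\<infinity>) = \<infinity>\<close>, while \<open>-\<infinity>\<close> is an
  ordinary value here: measures without density have it, and so do suprema over empty sets.
  Inequalities between sums therefore carry finiteness conditions from above, and the volume bound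
  is what discharges them. That bound has the right order for a simple reason: a matrix in the ball
  has \<open>N^2\<close> real coordinates whose squares add up to at most \<open>N R^2\<close>, so a
  typical coordinate has size about \<open>R / sqrt N\<close>; taking logarithms and dividing by
  \<open>N^2\<close> gives \<open>- ln N / 2\<close> for each matrix. In the subadditivity argument
  the marginal densities exist by Radon-Nikodym, but nothing is known in advance about the
  integrability of their logarithms. Finiteness of the reference measure provides it through
  \<open>1 - 1 / x \<le> ln x\<close>. Size \<open>N = 0\<close> is degenerate, because division and
  logarithm take default values there. The limit arguments are therefore carried out along a filter
  on which \<open>N \<ge> 1\<close> holds eventually, which covers \<open>sequentially\<close> and
  the ultrafilter at once.\<close>

lemma ereal_add_MInfty_le:
  fixes x y z :: ereal
  assumes "x = -\<infinity> \<or> y = -\<infinity>" "x \<noteq> \<infinity>" "y \<noteq> \<infinity>"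
  shows "x + y \<le> z"
  using assms by (cases x; cases y) auto

text \<open>A strict bound on a sum leaves a gap that can be divided between the summands. Real
  \<open>a\<close> and \<open>b\<close> make later additions safe; the next lemmas on limits and
  infima of sums rest on this splitting.\<close>

lemma ereal_add_less_split:
  fixes x y z :: ereal
  assumes "x \<noteq> \<infinity>" "y \<noteq> \<infinity>" "x + y < z"
  obtains a b :: real where "x < ereal a" "y < ereal b" "ereal (a + b) \<le> z"
proof -
  \<comment> \<open>A real \<open>z'\<close> in between also covers
    \<open>z = \<infinity>\<close>.\<close>
  obtain z' where z': "x + y < ereal z'" "ereal z' \<le> z"
    using ereal_dense2[OF assms(3)] by (blast intro: less_imp_le)
  show thesis
  proof (cases "x = -\<infinity>")
    case True
    then show thesis
    proof (cases y)
      case (real b)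
      then show thesis using True z' that[of "z' - b - 1" "b + 1"] by auto
    qed (use True z' assms that[of "z'" 0] in auto)
  next
    case False
    then obtain a where a: "x = ereal a" using assms(1) by (cases x) auto
    show thesis
    proof (cases y)
      case (real b)
      then have "a + b < z'" using z' a by simp
      \<comment> \<open>Each summand receives half of the gap \<open>z' - a - b\<close>.\<close>
      moreover have "a + (z' - a - b) / 2 + (b + (z' - a - b) / 2) = z'" by (simp add: field_simps)
      ultimately show thesis
        using a real z'(2)
        by (intro that[of "a + (z' - a - b) / 2" "b + (z' - a - b) / 2"]) simp_all
    qed (use a z' assms that[of "a + 1" "z' - a - 1"] in auto)
  qed
qed

text \<open>If one of the upper limits is \<open>\<infinity>\<close>, the right side is
  \<open>\<infinity>\<close> whatever the other one is, by the convention for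
  \<open>\<infinity> + (-\<infinity>)\<close>. Otherwise a strict bound on the right is split into
  two eventual bounds.\<close>

lemma Limsup_add_le:
  fixes u v :: "'a \<Rightarrow> ereal"
  shows "Limsup F (\<lambda>x. u x + v x) \<le> Limsup F u + Limsup F v"
proof (cases "Limsup F u = \<infinity> \<or> Limsup F v = \<infinity>")
  case False
  show ?thesis
    unfolding Limsup_le_iff
  proof (intro allI impI)
    fix y assume "Limsup F u + Limsup F v < y"
    then obtain a b :: real where ab: "Limsup F u < ereal a" "Limsup F v < ereal b" "ereal (a + b) \<le> y"
      using False by (elim ereal_add_less_split[rotated 2]) auto
    have "eventually (\<lambda>x. u x < ereal a) F" "eventually (\<lambda>x. v x < ereal b) F"
      using ab(1,2) by (auto dest: Limsup_lessD)
    then show "eventually (\<lambda>x. u x + v x < y) F"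
    proof eventually_elim
      case (elim x)
      then have "u x + v x < ereal a + ereal b" by (rule ereal_add_strict_mono2)
      then show ?case using ab(3) by simp
    qed
  qed
qed auto

text \<open>Negation turns a strict lower bound into the strict upper bound that
  \<open>ereal_add_less_split\<close> divides. Here the convention
  \<open>\<infinity> + (-\<infinity>) = \<infinity>\<close> works against the claim, and the
  hypotheses exclude it.\<close>

lemma Liminf_add_ge:
  fixes u v :: "'a \<Rightarrow> ereal"
  assumes "Liminf F u \<noteq> \<infinity>" "Liminf F v \<noteq> \<infinity>"
  shows "Liminf F u + Liminf F v \<le> Liminf F (\<lambda>x. u x + v x)"
proof (cases "Liminf F u = -\<infinity> \<or> Liminf F v = -\<infinity>")
  case False
  show ?thesis
    unfolding le_Liminf_iff
  proof (intro allI impI)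
    fix y assume "y < Liminf F u + Liminf F v"
    then have "- Liminf F u + - Liminf F v < - y"
      using False assms by (cases "Liminf F u"; cases "Liminf F v"; cases y) auto
    then obtain a b :: real where ab: "- Liminf F u < ereal a" "- Liminf F v < ereal b"
        "ereal (a + b) \<le> - y"
      using False by (elim ereal_add_less_split[rotated 2]) (auto simp: ereal_uminus_eq_reorder)
    have "ereal (- a) < Liminf F u" "ereal (- b) < Liminf F v"
      using ab(1,2) by (simp_all add: ereal_uminus_less_reorder)
    then have "eventually (\<lambda>x. ereal (- a) < u x) F" "eventually (\<lambda>x. ereal (- b) < v x) F"
      by (auto dest: less_LiminfD)
    then show "eventually (\<lambda>x. y < u x + v x) F"
    proof eventually_elim
      case (elim x)
      then have "ereal (- a) + ereal (- b) < u x + v x" by (rule ereal_add_strict_mono2)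
      moreover have "y \<le> ereal (- a) + ereal (- b)"
        using ab(3) by (cases y) auto
      ultimately show ?case by (rule le_less_trans[rotated])
    qed
  qed
next
  case True
  then show ?thesis using assms by (intro ereal_add_MInfty_le) auto
qed

lemma Liminf_le_bound:
  fixes u :: "'a \<Rightarrow> ereal"
  assumes "F \<noteq> bot" "eventually (\<lambda>x. u x \<le> ereal B) F"
  shows "Liminf F u \<noteq> \<infinity>" "Limsup F u \<noteq> \<infinity>"
proof -
  have "Limsup F u \<le> ereal B" using assms(2) by (rule Limsup_bounded)
  moreover have "Liminf F u \<le> Limsup F u" using assms(1) by (rule Liminf_le_Limsup)
  ultimately show "Liminf F u \<noteq> \<infinity>" "Limsup F u \<noteq> \<infinity>" by auto
qed

text \<open>An ultrafilter decides whether \<open>u k < a\<close> holds. A value \<open>a\<close>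
  strictly between the lower and the upper limit is contradicted by either answer, so the two limits
  agree, \<open>u\<close> converges, and the description hidden in \<open>Lim\<close> returns their
  common value.\<close>

lemma ultrafilter_Lim_ereal:
  fixes u :: "nat \<Rightarrow> ereal"
  assumes "nontrivial_ultrafilter \<omega>"
  shows "Lim \<omega> u = Liminf \<omega> u" "Lim \<omega> u = Limsup \<omega> u"
proof -
  have bot: "\<omega> \<noteq> bot" and ultra: "\<And>P. eventually P \<omega> \<or> eventually (\<lambda>k. \<not> P k) \<omega>"
    using assms by (auto simp: nontrivial_ultrafilter_def)
  have "Limsup \<omega> u \<le> Liminf \<omega> u"
  proof (rule ccontr)
    assume "\<not> ?thesis"
    then obtain a where a: "Liminf \<omega> u < a" "a < Limsup \<omega> u"
      using dense[of "Liminf \<omega> u" "Limsup \<omega> u"] by (auto simp: not_le)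
    from ultra[of "\<lambda>k. u k < a"] show False
    proof
      assume "eventually (\<lambda>k. u k < a) \<omega>"
      then have "Limsup \<omega> u \<le> a" by (intro Limsup_bounded) (auto elim: eventually_mono)
      with a show False by simp
    next
      assume "eventually (\<lambda>k. \<not> u k < a) \<omega>"
      then have "a \<le> Liminf \<omega> u" by (intro Liminf_bounded) (auto elim!: eventually_mono)
      with a show False by simp
    qed
  qed
  then have eq: "Liminf \<omega> u = Limsup \<omega> u"
    using Liminf_le_Limsup[OF bot, of u] by auto
  then have "(u \<longlongrightarrow> Liminf \<omega> u) \<omega>"
    by (intro Liminf_eq_Limsup[OF bot]) simp_all
  then show "Lim \<omega> u = Liminf \<omega> u" by (rule tendsto_Lim[OF bot])
  then show "Lim \<omega> u = Limsup \<omega> u" using eq by simp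
qed

text \<open>Otherwise \<open>N = 0\<close> would hold eventually, which makes the ultrafilter
  principal at 0.\<close>

lemma nontrivial_ultrafilter_eventually_ge_1:
  assumes "nontrivial_ultrafilter \<omega>"
  shows "eventually (\<lambda>N. N \<ge> 1) \<omega>"
proof (rule ccontr)
  assume "\<not> ?thesis"
  moreover have "eventually (\<lambda>N. N \<ge> 1) \<omega> \<or> eventually (\<lambda>N. \<not> N \<ge> 1) \<omega>"
    using assms unfolding nontrivial_ultrafilter_def by blast
  ultimately have "eventually (\<lambda>N. \<not> N \<ge> 1) \<omega>" by blast
  then have ev: "eventually (\<lambda>N. N = 0) \<omega>" by eventually_elim simp
  have "eventually P \<omega> \<longleftrightarrow> P 0" for P
  proof
    assume "eventually P \<omega>"
    with ev have "eventually (\<lambda>_. P 0) \<omega>" by eventually_elim auto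
    with assms show "P 0" by (auto simp: nontrivial_ultrafilter_def)
  next
    assume "P 0"
    with ev show "eventually P \<omega>" by (auto elim: eventually_mono)
  qed
  then have "\<omega> = principal {0}" by (simp add: filter_eq_iff eventually_principal)
  with assms show False by (auto simp: nontrivial_ultrafilter_def)
qed

text \<open>The suprema are evaluated one variable at a time, which needs nonempty index sets. Empty
  ones give \<open>-\<infinity>\<close>, and \<open>fin\<close> then makes the whole left side
  \<open>-\<infinity>\<close>.\<close>

lemma SUP_add_le_ereal:
  fixes f :: "'a \<Rightarrow> ereal" and g :: "'b \<Rightarrow> ereal"
  assumes le: "\<And>a b. a \<in> A \<Longrightarrow> b \<in> B \<Longrightarrow> f a + g b \<le> S"
    and fin: "(SUP a\<in>A. f a) \<noteq> \<infinity>" "(SUP b\<in>B. g b) \<noteq> \<infinity>"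
  shows "(SUP a\<in>A. f a) + (SUP b\<in>B. g b) \<le> S"
proof (cases "(SUP a\<in>A. f a) = -\<infinity> \<or> (SUP b\<in>B. g b) = -\<infinity>")
  case False
  then have ne: "A \<noteq> {}" "B \<noteq> {}" by (auto simp: bot_ereal_def)
  have *: "f a + (SUP b\<in>B. g b) \<le> S" if "a \<in> A" for a
  proof (cases "f a = -\<infinity>")
    case True
    then show ?thesis using fin by (intro ereal_add_MInfty_le) auto
  next
    case False
    then show ?thesis using ne le[OF that] by (subst SUP_ereal_add_right[symmetric]) (auto intro: SUP_least)
  qed
  show ?thesis using False ne * by (subst SUP_ereal_add_left[symmetric]) (auto intro: SUP_least)
next
  case True
  then show ?thesis using assms by (intro ereal_add_MInfty_le) auto
qed

text \<open>If the claim failed, indices \<open>i\<close> and \<open>j\<close> could be chosen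
  independently of each other, close enough to the two infima to violate \<open>le\<close>.\<close>

lemma INF_add_ge_ereal:
  fixes f :: "'a \<Rightarrow> ereal" and g :: "'b \<Rightarrow> ereal"
  assumes le: "\<And>a b. a \<in> A \<Longrightarrow> b \<in> B \<Longrightarrow> S \<le> f a + g b"
    and fin: "\<And>a. a \<in> A \<Longrightarrow> f a \<noteq> \<infinity>" "\<And>b. b \<in> B \<Longrightarrow> g b \<noteq> \<infinity>" and ne: "A \<noteq> {}" "B \<noteq> {}"
  shows "S \<le> (INF a\<in>A. f a) + (INF b\<in>B. g b)"
proof (rule ccontr)
  have lt: "(INF a\<in>A. f a) \<noteq> \<infinity>" "(INF b\<in>B. g b) \<noteq> \<infinity>"
    using fin ne by (auto simp: Inf_eq_PInfty)
  assume "\<not> ?thesis"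
  then obtain a b :: real where ab: "(INF a\<in>A. f a) < ereal a" "(INF b\<in>B. g b) < ereal b"
      "ereal (a + b) \<le> S"
    using lt unfolding not_le by (elim ereal_add_less_split[rotated 2]) auto
  then obtain i j where ij: "i \<in> A" "f i < ereal a" "j \<in> B" "g j < ereal b"
    by (auto simp: INF_less_iff)
  then have "f i + g j < ereal a + ereal b" by (intro ereal_add_strict_mono2) auto
  with le[OF ij(1,3)] ab(3) show False by simp
qed

section \<open>Differential entropy\<close>

text \<open>A density vanishes only on a null set of the measure it defines, so the default value of
  \<open>ln\<close> at 0 never matters.\<close>

lemma AE_density_pos:
  fixes f :: "'a \<Rightarrow> real"
  assumes "f \<in> borel_measurable L"
  shows "AE x in density L (\<lambda>x. ennreal (f x)). 0 < f x"
  using assms by (subst AE_density) auto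

text \<open>\<open>Ent\<close> evaluates a Radon-Nikodym derivative; uniqueness up to null sets lets
  any real density replace it. The entropy is written as an expectation under the measure itself,
  the form suited to comparing densities and to push-forwards.\<close>

lemma Ent_density:
  fixes f :: "'a \<Rightarrow> real"
  defines "\<mu> \<equiv> \<lambda>L. density L (\<lambda>x. ennreal (f x))"
  assumes "sigma_finite_measure L" and [measurable]: "f \<in> borel_measurable L" and nn: "\<And>x. 0 \<le> f x"
    and int: "integrable (\<mu> L) (\<lambda>x. ln (f x))"
  shows "Ent L (\<mu> L) = ereal (- (\<integral>x. ln (f x) \<partial>\<mu> L))"
proof -
  interpret sigma_finite_measure L by fact
  define g where "g x = enn2real (RN_deriv L (\<mu> L) x)" for x
  have [measurable]: "g \<in> borel_measurable L" unfolding g_def by measurable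
  have "AE x in L. ennreal (f x) = RN_deriv L (\<mu> L) x"
    by (rule RN_deriv_unique) (auto simp: \<mu>_def)
  then have fg: "AE x in L. g x = f x"
    unfolding g_def by eventually_elim (metis enn2real_ennreal nn)
  then have \<mu>g: "\<mu> L = density L (\<lambda>x. ennreal (g x))"
    unfolding \<mu>_def by (intro density_cong) auto
  have fg': "AE x in \<mu> L. g x = f x"
    using fg unfolding \<mu>_def by (subst AE_density) auto
  have [measurable_cong]: "sets (\<mu> L) = sets L" by (simp add: \<mu>_def)
  have "integrable (\<mu> L) (\<lambda>x. ln (g x))"
    using int by (rule integrable_cong_AE_imp) (use fg' in auto)
  moreover have "(\<integral>x. g x * ln (g x) \<partial>L) = (\<integral>x. f x * ln (f x) \<partial>L)"
    using fg by (intro integral_cong_AE) auto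
  moreover have "(\<integral>x. ln (f x) \<partial>\<mu> L) = (\<integral>x. f x * ln (f x) \<partial>L)"
    unfolding \<mu>_def using nn by (subst integral_density) auto
  ultimately show ?thesis
    using \<mu>g unfolding Ent_def Let_def g_def[symmetric] by simp
qed

lemma Ent_cases:
  obtains "Ent L \<mu> = -\<infinity>"
  | f :: "'a \<Rightarrow> real" where "f \<in> borel_measurable L" "\<And>x. 0 \<le> f x"
      "\<mu> = density L (\<lambda>x. ennreal (f x))" "integrable \<mu> (\<lambda>x. ln (f x))"
      "Ent L \<mu> = ereal (- (\<integral>x. ln (f x) \<partial>\<mu>))"
proof (cases "Ent L \<mu> = -\<infinity>")
  case False
  define f where "f x = enn2real (RN_deriv L \<mu> x)" for x
  have meas [measurable]: "f \<in> borel_measurable L" unfolding f_def by measurable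
  have nn: "0 \<le> f x" for x by (simp add: f_def)
  have *: "\<mu> = density L (\<lambda>x. ennreal (f x))" "integrable \<mu> (\<lambda>x. ln (f x))"
      "Ent L \<mu> = ereal (- (\<integral>x. f x * ln (f x) \<partial>L))"
    using False unfolding Ent_def Let_def f_def[symmetric] by (auto split: if_splits)
  have "(\<integral>x. ln (f x) \<partial>\<mu>) = (\<integral>x. f x * ln (f x) \<partial>L)"
    by (subst *(1), subst integral_density) (auto simp: nn)
  with *(3) have "Ent L \<mu> = ereal (- (\<integral>x. ln (f x) \<partial>\<mu>))" by (simp only:)
  then show thesis by (rule that(2)[OF meas nn *(1,2)])
next
  case True
  then show thesis by (rule that(1))
qed

text \<open>Nonnegativity of relative entropy, with the integrability of \<open>ln g\<close> among
  the conclusions: \<open>ln g\<close> is bounded above by \<open>ln f + (g / f - 1)\<close> and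
  below by the integrable minorant \<open>h\<close>, which each application has to supply.\<close>

lemma Gibbs_inequality:
  fixes f g h :: "'a \<Rightarrow> real"
  assumes [measurable]: "f \<in> borel_measurable L" "g \<in> borel_measurable L"
    and nn: "\<And>x. 0 \<le> f x" "\<And>x. 0 \<le> g x"
    and \<mu>: "\<mu> = density L (\<lambda>x. ennreal (f x))" "prob_space \<mu>"
    and lnf: "integrable \<mu> (\<lambda>x. ln (f x))"
    and g1: "(\<integral>\<^sup>+x. ennreal (g x) \<partial>L) \<le> 1"
    and gpos: "AE x in \<mu>. 0 < g x"
    and h: "integrable \<mu> h" "AE x in \<mu>. h x \<le> ln (g x)"
  shows "integrable \<mu> (\<lambda>x. ln (g x))" and "(\<integral>x. ln (g x) \<partial>\<mu>) \<le> (\<integral>x. ln (f x) \<partial>\<mu>)"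
proof -
  interpret prob_space \<mu> by fact
  have [measurable_cong]: "sets \<mu> = sets L" by (simp add: \<mu>)
  have fpos: "AE x in \<mu>. 0 < f x" unfolding \<mu> by (rule AE_density_pos) measurable
  have "(\<integral>\<^sup>+x. ennreal (g x / f x) \<partial>\<mu>) = (\<integral>\<^sup>+x. ennreal (f x) * ennreal (g x / f x) \<partial>L)"
    unfolding \<mu> by (rule nn_integral_density) measurable
  \<comment> \<open>Only an inequality: where \<open>f\<close> vanishes the quotient is 0 by
    default, whereas \<open>g\<close> may have mass there.\<close>
  also have "\<dots> \<le> (\<integral>\<^sup>+x. ennreal (g x) \<partial>L)"
    by (intro nn_integral_mono) (simp add: ennreal_mult[symmetric] nn ennreal_leI)
  finally have q1: "(\<integral>\<^sup>+x. ennreal (g x / f x) \<partial>\<mu>) \<le> 1" using g1 by (rule order_trans)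
  have q: "integrable \<mu> (\<lambda>x. g x / f x)"
    using q1 nn by (intro integrableI_bounded) (auto simp: less_top[symmetric] top_unique)
  have "ennreal (\<integral>x. g x / f x \<partial>\<mu>) \<le> 1"
    using q1 nn by (subst nn_integral_eq_integral[symmetric]) (auto simp: q)
  then have q2: "(\<integral>x. g x / f x \<partial>\<mu>) \<le> 1" by simp
  have le: "AE x in \<mu>. ln (g x) \<le> ln (f x) + (g x / f x - 1)"
    using fpos gpos
  proof eventually_elim
    case (elim x)
    then show ?case using ln_le_minus_one[of "g x / f x"] by (simp add: ln_div)
  qed
  show i: "integrable \<mu> (\<lambda>x. ln (g x))"
  proof (rule Bochner_Integration.integrable_bound)
    show "integrable \<mu> (\<lambda>x. \<bar>h x\<bar> + \<bar>ln (f x) + (g x / f x - 1)\<bar>)"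
      using h lnf q by (intro Bochner_Integration.integrable_add integrable_abs) auto
    show "AE x in \<mu>. norm (ln (g x)) \<le> norm (\<bar>h x\<bar> + \<bar>ln (f x) + (g x / f x - 1)\<bar>)"
      using le h(2) by eventually_elim auto
  qed measurable
  have "(\<integral>x. ln (g x) \<partial>\<mu>) \<le> (\<integral>x. ln (f x) + (g x / f x - 1) \<partial>\<mu>)"
    using le i lnf q by (intro integral_mono_AE) auto
  also have "\<dots> = (\<integral>x. ln (f x) \<partial>\<mu>) + ((\<integral>x. g x / f x \<partial>\<mu>) - 1)"
    using lnf q by (simp add: prob_space)
  finally show "(\<integral>x. ln (g x) \<partial>\<mu>) \<le> (\<integral>x. ln (f x) \<partial>\<mu>)" using q2 by simp
qed

lemma ln_ge_one_minus_inverse: "1 - 1 / x \<le> ln x" if "0 < x" for x :: real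
  using ln_le_minus_one[of "1 / x"] that by (simp add: ln_div)

text \<open>The \<open>\<mu>\<close>-integral of \<open>1 / f\<close> is at most the total mass of
  \<open>L\<close>. Together with \<open>1 - 1 / f \<le> ln f\<close> this gives \<open>ln f\<close>
  an integrable minorant even if the entropy of \<open>\<mu>\<close> is not known to be
  finite.\<close>

lemma integrable_one_minus_inverse_density:
  fixes f :: "'a \<Rightarrow> real"
  assumes "finite_measure L" and [measurable]: "f \<in> borel_measurable L" and nn: "\<And>x. 0 \<le> f x"
    and \<mu>: "\<mu> = density L (\<lambda>x. ennreal (f x))" "prob_space \<mu>"
  shows "integrable \<mu> (\<lambda>x. 1 - 1 / f x)"
proof -
  interpret L: finite_measure L by fact
  interpret prob_space \<mu> by fact
  have [measurable_cong]: "sets \<mu> = sets L" by (simp add: \<mu>)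
  have "(\<integral>\<^sup>+x. ennreal (1 / f x) \<partial>\<mu>) = (\<integral>\<^sup>+x. ennreal (f x) * ennreal (1 / f x) \<partial>L)"
    unfolding \<mu> by (rule nn_integral_density) measurable
  also have "\<dots> \<le> (\<integral>\<^sup>+x. 1 \<partial>L)"
    by (intro nn_integral_mono) (simp add: ennreal_mult[symmetric] nn)
  also have "\<dots> < \<infinity>" by (simp add: less_top[symmetric])
  finally have "integrable \<mu> (\<lambda>x. 1 / f x)"
    using nn by (intro integrableI_bounded) auto
  then show ?thesis by auto
qed

lemma Ent_le_ln:
  assumes "finite_measure L" "prob_space \<mu>" "0 < c" "emeasure L (space L) \<le> ennreal c"
  shows "Ent L \<mu> \<le> ereal (ln c)"
proof (cases rule: Ent_cases[of L \<mu>])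
  case (2 f)
  interpret prob_space \<mu> by fact
  have "(\<integral>\<^sup>+x. ennreal (1 / c) \<partial>L) = ennreal (1 / c) * emeasure L (space L)" by simp
  also have "\<dots> \<le> ennreal (1 / c) * ennreal c" using assms by (intro mult_left_mono) auto
  also have "\<dots> = 1" using assms by (simp add: ennreal_mult[symmetric])
  finally have "(\<integral>x. ln (1 / c) \<partial>\<mu>) \<le> (\<integral>x. ln (f x) \<partial>\<mu>)"
    using \<open>0 < c\<close>
    by (intro Gibbs_inequality(2)[OF 2(1) _ 2(2) _ 2(3) assms(2) 2(4), of _ "\<lambda>_. ln (1 / c)"])
      simp_all
  then have "- ln c \<le> (\<integral>x. ln (f x) \<partial>\<mu>)" using \<open>0 < c\<close> by (simp add: prob_space ln_div)
  then show ?thesis by (simp add: 2(5))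
qed simp

lemma Ent_uniform_measure:
  assumes "finite_measure L" and A [measurable]: "A \<in> sets L" and pos: "emeasure L A \<noteq> 0"
  shows "Ent L (uniform_measure L A) = ln_ennreal (emeasure L A)"
proof -
  interpret finite_measure L by fact
  define f where "f x = indicator A x / measure L A" for x :: 'a
  have "measure L A \<noteq> 0" using pos emeasure_eq_measure[of A] by auto
  then have pos': "0 < measure L A" by (simp add: zero_less_measure_iff)
  have unif: "uniform_measure L A = density L (\<lambda>x. ennreal (f x))"
    unfolding uniform_measure_def f_def emeasure_eq_measure
    using pos' by (intro density_cong) (auto simp: divide_ennreal[symmetric] indicator_def)
  interpret \<mu>: prob_space "uniform_measure L A"
    by (rule prob_space_uniform_measure[OF pos]) (simp add: emeasure_eq_measure)
  \<comment> \<open>Outside \<open>A\<close> the logarithm takes its default value at 0, but the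
    uniform measure does not charge that set.\<close>
  have ae: "AE x in uniform_measure L A. ln (f x) = - ln (measure L A)"
    using pos' by (intro AE_uniform_measureI) (auto simp: f_def ln_div)
  have [measurable]: "f \<in> borel_measurable L" unfolding f_def by measurable
  have int: "integrable (uniform_measure L A) (\<lambda>x. ln (f x))"
    by (rule integrable_cong_AE_imp[where g = "\<lambda>_. - ln (measure L A)"]) (use ae in auto)
  have "(\<integral>x. ln (f x) \<partial>uniform_measure L A) = (\<integral>x. - ln (measure L A) \<partial>uniform_measure L A)"
    using ae by (intro integral_cong_AE) auto
  also have "\<dots> = - ln (measure L A)" using \<mu>.prob_space by simp
  finally have "Ent L (uniform_measure L A) = ereal (ln (measure L A))"
    using Ent_density[of L f] int sigma_finite_measure_axioms by (simp add: unif f_def)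
  then show ?thesis using pos by (simp add: ln_ennreal_def emeasure_eq_measure)
qed

text \<open>The mixture \<open>h\<close> is compared with \<open>f\<close> under
  \<open>\<mu>\<close> and with \<open>g\<close> under \<open>\<nu>\<close>, and the two
  inequalities are averaged. The mixed measure is delivered with its integrals of complex functions
  because its barycenter has to be computed.\<close>

lemma Ent_concave:
  assumes "finite_measure L" and "prob_space \<mu>" "prob_space \<nu>"
    and t: "0 < t" "t < 1" and fin: "Ent L \<mu> \<noteq> -\<infinity>" "Ent L \<nu> \<noteq> -\<infinity>"
  obtains \<rho> where "prob_space \<rho>" "sets \<rho> = sets L"
    "\<And>\<phi> :: 'a \<Rightarrow> complex. integrable \<mu> \<phi> \<Longrightarrow> integrable \<nu> \<phi> \<Longrightarrow>
       (\<integral>x. \<phi> x \<partial>\<rho>) = of_real t * (\<integral>x. \<phi> x \<partial>\<mu>) + of_real (1 - t) * (\<integral>x. \<phi> x \<partial>\<nu>)"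
    "ereal t * Ent L \<mu> + ereal (1 - t) * Ent L \<nu> \<le> Ent L \<rho>"
proof -
  interpret L: finite_measure L by fact
  interpret \<mu>: prob_space \<mu> by fact
  interpret \<nu>: prob_space \<nu> by fact
  obtain f :: "'a \<Rightarrow> real" where f [measurable]: "f \<in> borel_measurable L" and f0: "\<And>x. 0 \<le> f x"
    and \<mu>: "\<mu> = density L (\<lambda>x. ennreal (f x))" and fi: "integrable \<mu> (\<lambda>x. ln (f x))"
    and Ef: "Ent L \<mu> = ereal (- (\<integral>x. ln (f x) \<partial>\<mu>))"
    using fin by (cases rule: Ent_cases[of L \<mu>]) auto
  obtain g :: "'a \<Rightarrow> real" where g [measurable]: "g \<in> borel_measurable L" and g0: "\<And>x. 0 \<le> g x"
    and \<nu>: "\<nu> = density L (\<lambda>x. ennreal (g x))" and gi: "integrable \<nu> (\<lambda>x. ln (g x))"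
    and Eg: "Ent L \<nu> = ereal (- (\<integral>x. ln (g x) \<partial>\<nu>))"
    using fin by (cases rule: Ent_cases[of L \<nu>]) auto
  define h where "h x = t * f x + (1 - t) * g x" for x
  define \<rho> where "\<rho> = density L (\<lambda>x. ennreal (h x))"
  have [measurable]: "h \<in> borel_measurable L" unfolding h_def by measurable
  have h0: "0 \<le> h x" for x using f0 g0 t by (simp add: h_def)
  have hsum: "ennreal (h x) = ennreal t * ennreal (f x) + ennreal (1 - t) * ennreal (g x)" for x
    unfolding h_def using t f0 g0 by (simp add: ennreal_plus ennreal_mult)
  have [measurable_cong]: "sets \<mu> = sets L" "sets \<nu> = sets L" "sets \<rho> = sets L"
    by (simp_all add: \<mu> \<nu> \<rho>_def)
  have f1: "(\<integral>\<^sup>+x. ennreal (f x) \<partial>L) = 1" and g1: "(\<integral>\<^sup>+x. ennreal (g x) \<partial>L) = 1"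
    using \<mu>.emeasure_space_1 \<nu>.emeasure_space_1 by (simp_all add: \<mu> \<nu> emeasure_density cong: nn_integral_cong)
  have h1: "(\<integral>\<^sup>+x. ennreal (h x) \<partial>L) = 1"
    unfolding hsum using t f1 g1
    by (simp add: nn_integral_add nn_integral_cmult ennreal_plus[symmetric] del: ennreal_plus)
  have \<rho>1: "prob_space \<rho>"
    unfolding \<rho>_def by (rule prob_spaceI) (simp add: emeasure_density h1 cong: nn_integral_cong)
  \<comment> \<open>General Banach space values, since this is used both for the real function
    \<open>ln (h x)\<close> and for complex \<open>\<phi>\<close>.\<close>
  have mix: "(integrable \<mu> \<phi> \<longrightarrow> integrable \<nu> \<phi> \<longrightarrow> integrable \<rho> \<phi> \<and>
       (\<integral>x. \<phi> x \<partial>\<rho>) = t *\<^sub>R (\<integral>x. \<phi> x \<partial>\<mu>) + (1 - t) *\<^sub>R (\<integral>x. \<phi> x \<partial>\<nu>))"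
      for \<phi> :: "'a \<Rightarrow> 'b :: {banach, second_countable_topology}"
  proof (intro impI)
    assume i: "integrable \<mu> \<phi>" "integrable \<nu> \<phi>"
    then have [measurable]: "\<phi> \<in> borel_measurable L" by (auto dest: borel_measurable_integrable)
    have i': "integrable L (\<lambda>x. f x *\<^sub>R \<phi> x)" "integrable L (\<lambda>x. g x *\<^sub>R \<phi> x)"
      using i f0 g0 unfolding \<mu> \<nu> by (simp_all add: integrable_density)
    have hphi: "(\<lambda>x. h x *\<^sub>R \<phi> x) = (\<lambda>x. t *\<^sub>R (f x *\<^sub>R \<phi> x) + (1 - t) *\<^sub>R (g x *\<^sub>R \<phi> x))"
      by (auto simp: h_def algebra_simps)
    have "integrable L (\<lambda>x. h x *\<^sub>R \<phi> x)"
      unfolding hphi using i' by (intro Bochner_Integration.integrable_add integrable_scaleR_right)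
    moreover have "(\<integral>x. h x *\<^sub>R \<phi> x \<partial>L)
        = t *\<^sub>R (\<integral>x. f x *\<^sub>R \<phi> x \<partial>L) + (1 - t) *\<^sub>R (\<integral>x. g x *\<^sub>R \<phi> x \<partial>L)"
      unfolding hphi using i'
      by (simp only: Bochner_Integration.integral_add integrable_scaleR_right integral_scaleR_right)
    ultimately show "integrable \<rho> \<phi> \<and>
       (\<integral>x. \<phi> x \<partial>\<rho>) = t *\<^sub>R (\<integral>x. \<phi> x \<partial>\<mu>) + (1 - t) *\<^sub>R (\<integral>x. \<phi> x \<partial>\<nu>)"
      unfolding \<mu> \<nu> \<rho>_def using f0 g0 h0 by (simp add: integrable_density integral_density)
  qed
  have fpos: "AE x in \<mu>. 0 < f x" unfolding \<mu> by (rule AE_density_pos) measurable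
  have gpos: "AE x in \<nu>. 0 < g x" unfolding \<nu> by (rule AE_density_pos) measurable
  have G\<mu>: "integrable \<mu> (\<lambda>x. ln (h x))" "(\<integral>x. ln (h x) \<partial>\<mu>) \<le> (\<integral>x. ln (f x) \<partial>\<mu>)"
  proof -
    have hp: "AE x in \<mu>. 0 < h x"
      using fpos by eventually_elim (use t g0 in \<open>auto simp: h_def add_pos_nonneg\<close>)
    \<comment> \<open>From \<open>h \<ge> t f\<close>, the function \<open>ln t + ln f\<close> is an
      integrable minorant of \<open>ln h\<close> under \<open>\<mu>\<close>; this needs
      \<open>t > 0\<close>, and the analogue for \<open>\<nu>\<close> needs
      \<open>t < 1\<close>.\<close>
    have hl: "AE x in \<mu>. ln t + ln (f x) \<le> ln (h x)"
      using fpos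
    proof eventually_elim
      case (elim x)
      then have "ln (t * f x) \<le> ln (h x)"
        using t g0[of x] by (intro ln_mono) (auto simp: h_def add_pos_nonneg)
      then show ?case using elim t by (simp add: ln_mult)
    qed
    show "integrable \<mu> (\<lambda>x. ln (h x))" "(\<integral>x. ln (h x) \<partial>\<mu>) \<le> (\<integral>x. ln (f x) \<partial>\<mu>)"
      using fi by (auto intro!: Gibbs_inequality[OF f \<open>h \<in> borel_measurable L\<close> f0 h0 \<mu>
            \<mu>.prob_space_axioms fi _ hp _ hl] simp: h1)
  qed
  have G\<nu>: "integrable \<nu> (\<lambda>x. ln (h x))" "(\<integral>x. ln (h x) \<partial>\<nu>) \<le> (\<integral>x. ln (g x) \<partial>\<nu>)"
  proof -
    have hp: "AE x in \<nu>. 0 < h x"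
      using gpos by eventually_elim (use t f0 in \<open>auto simp: h_def add_nonneg_pos\<close>)
    have hl: "AE x in \<nu>. ln (1 - t) + ln (g x) \<le> ln (h x)"
      using gpos
    proof eventually_elim
      case (elim x)
      then have "ln ((1 - t) * g x) \<le> ln (h x)"
        using t f0[of x] by (intro ln_mono) (auto simp: h_def add_nonneg_pos)
      then show ?case using elim t by (simp add: ln_mult)
    qed
    show "integrable \<nu> (\<lambda>x. ln (h x))" "(\<integral>x. ln (h x) \<partial>\<nu>) \<le> (\<integral>x. ln (g x) \<partial>\<nu>)"
      using gi by (auto intro!: Gibbs_inequality[OF g \<open>h \<in> borel_measurable L\<close> g0 h0 \<nu>
            \<nu>.prob_space_axioms gi _ hp _ hl] simp: h1)
  qed
  have i\<rho>: "integrable \<rho> (\<lambda>x. ln (h x))" and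
    e\<rho>: "(\<integral>x. ln (h x) \<partial>\<rho>) = t * (\<integral>x. ln (h x) \<partial>\<mu>) + (1 - t) * (\<integral>x. ln (h x) \<partial>\<nu>)"
    using mix[of "\<lambda>x. ln (h x)"] G\<mu>(1) G\<nu>(1) by auto
  have E\<rho>: "Ent L \<rho> = ereal (- (\<integral>x. ln (h x) \<partial>\<rho>))"
    using Ent_density[of L h] h0 i\<rho> L.sigma_finite_measure_axioms unfolding \<rho>_def by simp
  have "t * (\<integral>x. ln (h x) \<partial>\<mu>) \<le> t * (\<integral>x. ln (f x) \<partial>\<mu>)"
    "(1 - t) * (\<integral>x. ln (h x) \<partial>\<nu>) \<le> (1 - t) * (\<integral>x. ln (g x) \<partial>\<nu>)"
    using G\<mu>(2) G\<nu>(2) t by (auto intro!: mult_left_mono)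
  then have le: "ereal t * Ent L \<mu> + ereal (1 - t) * Ent L \<nu> \<le> Ent L \<rho>"
    unfolding E\<rho> Ef Eg e\<rho> by simp
  show thesis
  proof (rule that[OF \<rho>1 _ _ le])
    show "sets \<rho> = sets L" by (simp add: \<rho>_def)
    fix \<phi> :: "'a \<Rightarrow> complex" assume "integrable \<mu> \<phi>" "integrable \<nu> \<phi>"
    then show "(\<integral>x. \<phi> x \<partial>\<rho>) = of_real t * (\<integral>x. \<phi> x \<partial>\<mu>) + of_real (1 - t) * (\<integral>x. \<phi> x \<partial>\<nu>)"
      using mix[of \<phi>] by (simp add: scaleR_conv_of_real)
  qed
qed

text \<open>In substance, mutual information is nonnegative. \<open>L\<close> is a product only up
  to the map \<open>\<Phi>\<close>, with \<open>p1\<close> and \<open>p2\<close> recovering the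
  coordinates: tuples indexed by \<open>{..<m + l}\<close> are not literally pairs of
  tuples.\<close>

lemma Ent_subadditive:
  assumes "finite_measure L1" "finite_measure L2" "finite_measure L" "prob_space \<mu>" "sets \<mu> = sets L"
    and \<Phi> [measurable]: "\<Phi> \<in> L1 \<Otimes>\<^sub>M L2 \<rightarrow>\<^sub>M L" and L: "L = distr (L1 \<Otimes>\<^sub>M L2) L \<Phi>"
    and p1 [measurable]: "p1 \<in> L \<rightarrow>\<^sub>M L1" and p2 [measurable]: "p2 \<in> L \<rightarrow>\<^sub>M L2"
    and p\<Phi>: "\<And>x y. x \<in> space L1 \<Longrightarrow> y \<in> space L2 \<Longrightarrow> p1 (\<Phi> (x, y)) = x"
       "\<And>x y. x \<in> space L1 \<Longrightarrow> y \<in> space L2 \<Longrightarrow> p2 (\<Phi> (x, y)) = y"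
  shows "Ent L \<mu> \<le> Ent L1 (distr \<mu> L1 p1) + Ent L2 (distr \<mu> L2 p2)"
proof (cases rule: Ent_cases[of L \<mu>])
  case (2 f)
  note [measurable] = 2(1)
  interpret L1: finite_measure L1 by fact
  interpret L2: finite_measure L2 by fact
  interpret L: finite_measure L by fact
  interpret \<mu>: prob_space \<mu> by fact
  note [measurable_cong] = assms(5)
  define \<mu>1 \<mu>2 where "\<mu>1 = distr \<mu> L1 p1" and "\<mu>2 = distr \<mu> L2 p2"
  interpret \<mu>1: prob_space \<mu>1 unfolding \<mu>1_def by (rule \<mu>.prob_space_distr) measurable
  interpret \<mu>2: prob_space \<mu>2 unfolding \<mu>2_def by (rule \<mu>.prob_space_distr) measurable
  have sp: "space \<mu> = space L" using assms(5) by (rule sets_eq_imp_space_eq)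
  have \<mu>null: "emeasure \<mu> A = 0" if "A \<in> sets L" "emeasure L A = 0" for A
  proof -
    have "A \<in> null_sets (density L (\<lambda>x. ennreal (f x)))"
      using that AE_not_in[of A L] by (subst null_sets_density_iff) (auto simp: null_sets_def)
    then show ?thesis using 2(3) by auto
  qed
  have ac1: "absolutely_continuous L1 \<mu>1"
    unfolding absolutely_continuous_def
  proof
    fix A assume A: "A \<in> null_sets L1"
    then have [measurable]: "A \<in> sets L1" by auto
    have "\<Phi> -` (p1 -` A \<inter> space L) \<inter> space (L1 \<Otimes>\<^sub>M L2) = A \<times> space L2"
      using p\<Phi> measurable_space[OF \<Phi>] sets.sets_into_space[of A L1]
      by (auto simp: space_pair_measure)
    \<comment> \<open>The cylinder over a null set is null for the product, hence for
      \<open>L\<close> and for \<open>\<mu>\<close>.\<close>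
    then have "emeasure L (p1 -` A \<inter> space L) = 0"
      using A by (subst L, subst emeasure_distr) (auto simp: L2.emeasure_pair_measure_Times)
    then have "emeasure \<mu> (p1 -` A \<inter> space L) = 0"
      by (intro \<mu>null) auto
    then show "A \<in> null_sets \<mu>1"
      by (auto simp: null_sets_def \<mu>1_def emeasure_distr sp)
  qed
  have ac2: "absolutely_continuous L2 \<mu>2"
    unfolding absolutely_continuous_def
  proof
    fix A assume A: "A \<in> null_sets L2"
    then have [measurable]: "A \<in> sets L2" by auto
    have "\<Phi> -` (p2 -` A \<inter> space L) \<inter> space (L1 \<Otimes>\<^sub>M L2) = space L1 \<times> A"
      using p\<Phi> measurable_space[OF \<Phi>] sets.sets_into_space[of A L2]
      by (auto simp: space_pair_measure)
    then have "emeasure L (p2 -` A \<inter> space L) = 0"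
      using A by (subst L, subst emeasure_distr) (auto simp: L2.emeasure_pair_measure_Times)
    then have "emeasure \<mu> (p2 -` A \<inter> space L) = 0"
      by (intro \<mu>null) auto
    then show "A \<in> null_sets \<mu>2"
      by (auto simp: null_sets_def \<mu>2_def emeasure_distr sp)
  qed
  \<comment> \<open>A finite marginal has an almost everywhere finite derivative, so a real,
    pointwise nonnegative version can be chosen.\<close>
  obtain f1 where f1 [measurable]: "f1 \<in> borel_measurable L1" and f10: "\<And>x. 0 \<le> f1 x"
    and \<mu>1: "\<mu>1 = density L1 (\<lambda>x. ennreal (f1 x))"
  proof -
    obtain D where D: "D \<in> borel_measurable L1" "AE x in L1. RN_deriv L1 \<mu>1 x = ennreal (D x)"
        "\<And>x. 0 \<le> D x"
      using L1.real_RN_deriv[of \<mu>1] ac1 \<mu>1.finite_measure_axioms by (auto simp: \<mu>1_def)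
    have "density L1 (RN_deriv L1 \<mu>1) = \<mu>1"
      using ac1 by (intro L1.density_RN_deriv) (auto simp: \<mu>1_def)
    moreover have "density L1 (RN_deriv L1 \<mu>1) = density L1 (\<lambda>x. ennreal (D x))"
      using D by (intro density_cong) auto
    ultimately show thesis using D that by metis
  qed
  obtain f2 where f2 [measurable]: "f2 \<in> borel_measurable L2" and f20: "\<And>x. 0 \<le> f2 x"
    and \<mu>2: "\<mu>2 = density L2 (\<lambda>x. ennreal (f2 x))"
  proof -
    obtain D where D: "D \<in> borel_measurable L2" "AE x in L2. RN_deriv L2 \<mu>2 x = ennreal (D x)"
        "\<And>x. 0 \<le> D x"
      using L2.real_RN_deriv[of \<mu>2] ac2 \<mu>2.finite_measure_axioms by (auto simp: \<mu>2_def)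
    have "density L2 (RN_deriv L2 \<mu>2) = \<mu>2"
      using ac2 by (intro L2.density_RN_deriv) (auto simp: \<mu>2_def)
    moreover have "density L2 (RN_deriv L2 \<mu>2) = density L2 (\<lambda>x. ennreal (D x))"
      using D by (intro density_cong) auto
    ultimately show thesis using D that by metis
  qed
  have f1_1: "(\<integral>\<^sup>+x. ennreal (f1 x) \<partial>L1) = 1" and f2_1: "(\<integral>\<^sup>+x. ennreal (f2 x) \<partial>L2) = 1"
    using \<mu>1.emeasure_space_1 \<mu>2.emeasure_space_1
    by (simp_all add: \<mu>1 \<mu>2 emeasure_density cong: nn_integral_cong)
  have "AE x in \<mu>1. 0 < f1 x" unfolding \<mu>1 by (rule AE_density_pos) measurable
  then have pos1: "AE x in \<mu>. 0 < f1 (p1 x)"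
    unfolding \<mu>1_def by (subst (asm) AE_distr_iff) auto
  have "AE x in \<mu>2. 0 < f2 x" unfolding \<mu>2 by (rule AE_density_pos) measurable
  then have pos2: "AE x in \<mu>. 0 < f2 (p2 x)"
    unfolding \<mu>2_def by (subst (asm) AE_distr_iff) auto
  have inv1: "integrable \<mu> (\<lambda>x. 1 - 1 / f1 (p1 x))"
    using integrable_one_minus_inverse_density[OF L1.finite_measure_axioms f1 f10 \<mu>1 \<mu>1.prob_space_axioms]
    unfolding \<mu>1_def by (subst (asm) integrable_distr_eq) auto
  have inv2: "integrable \<mu> (\<lambda>x. 1 - 1 / f2 (p2 x))"
    using integrable_one_minus_inverse_density[OF L2.finite_measure_axioms f2 f20 \<mu>2 \<mu>2.prob_space_axioms]
    unfolding \<mu>2_def by (subst (asm) integrable_distr_eq) auto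
  define g where "g x = f1 (p1 x) * f2 (p2 x)" for x
  have [measurable]: "g \<in> borel_measurable L" unfolding g_def by measurable
  have "(\<integral>\<^sup>+x. ennreal (g x) \<partial>L) = (\<integral>\<^sup>+z. ennreal (g (\<Phi> z)) \<partial>(L1 \<Otimes>\<^sub>M L2))"
    by (subst L, subst nn_integral_distr) auto
  also have "\<dots> = (\<integral>\<^sup>+z. ennreal (f1 (fst z)) * ennreal (f2 (snd z)) \<partial>(L1 \<Otimes>\<^sub>M L2))"
    by (intro nn_integral_cong) (auto simp: space_pair_measure g_def p\<Phi> ennreal_mult f10 f20)
  also have "\<dots> = (\<integral>\<^sup>+x. \<integral>\<^sup>+y. ennreal (f1 x) * ennreal (f2 y) \<partial>L2 \<partial>L1)"
    by (subst L2.nn_integral_fst[symmetric]) auto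
  also have "\<dots> = 1" by (simp add: nn_integral_cmult f2_1 f1_1)
  finally have g1: "(\<integral>\<^sup>+x. ennreal (g x) \<partial>L) \<le> 1" by simp
  have lng: "AE x in \<mu>. ln (g x) = ln (f1 (p1 x)) + ln (f2 (p2 x))"
    using pos1 pos2 by eventually_elim (simp add: g_def ln_mult)
  have low: "AE x in \<mu>. 1 - 1 / f1 (p1 x) \<le> ln (f1 (p1 x))" "AE x in \<mu>. 1 - 1 / f2 (p2 x) \<le> ln (f2 (p2 x))"
    by (rule eventually_mono[OF pos1] eventually_mono[OF pos2], erule ln_ge_one_minus_inverse)+
  have gpos: "AE x in \<mu>. 0 < g x" using pos1 pos2 by eventually_elim (simp add: g_def)
  have glow: "AE x in \<mu>. (1 - 1 / f1 (p1 x)) + (1 - 1 / f2 (p2 x)) \<le> ln (g x)"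
    using lng low by eventually_elim simp
  have G: "integrable \<mu> (\<lambda>x. ln (g x))" "(\<integral>x. ln (g x) \<partial>\<mu>) \<le> (\<integral>x. ln (f x) \<partial>\<mu>)"
    using Gibbs_inequality[OF 2(1) _ 2(2) _ 2(3) \<mu>.prob_space_axioms 2(4) g1 gpos
        Bochner_Integration.integrable_add[OF inv1 inv2] glow] f10 f20
    by (auto simp: g_def)
  \<comment> \<open>The first logarithm is \<open>ln g\<close> minus the second one, hence at most
    \<open>ln g - (1 - 1 / f2)\<close>, and it is at least \<open>1 - 1 / f1\<close>. Both bounds
    are integrable, so finite joint entropy forces finite marginal entropies.\<close>
  have i1: "integrable \<mu> (\<lambda>x. ln (f1 (p1 x)))"
  proof (rule Bochner_Integration.integrable_bound)
    show "integrable \<mu> (\<lambda>x. \<bar>1 - 1 / f1 (p1 x)\<bar> + \<bar>ln (g x) - (1 - 1 / f2 (p2 x))\<bar>)"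
      by (intro Bochner_Integration.integrable_add integrable_abs
          Bochner_Integration.integrable_diff[OF G(1) inv2] inv1)
    show "AE x in \<mu>. norm (ln (f1 (p1 x))) \<le> norm (\<bar>1 - 1 / f1 (p1 x)\<bar> + \<bar>ln (g x) - (1 - 1 / f2 (p2 x))\<bar>)"
      using lng low by eventually_elim auto
  qed measurable
  have i2: "integrable \<mu> (\<lambda>x. ln (f2 (p2 x)))"
  proof (rule integrable_cong_AE_imp)
    show "integrable \<mu> (\<lambda>x. ln (g x) - ln (f1 (p1 x)))" using i1 G by auto
    show "AE x in \<mu>. ln (g x) - ln (f1 (p1 x)) = ln (f2 (p2 x))" using lng by eventually_elim simp
  qed measurable
  have "(\<integral>x. ln (g x) \<partial>\<mu>) = (\<integral>x. ln (f1 (p1 x)) + ln (f2 (p2 x)) \<partial>\<mu>)"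
    using lng by (intro integral_cong_AE) auto
  also have "\<dots> = (\<integral>x. ln (f1 (p1 x)) \<partial>\<mu>) + (\<integral>x. ln (f2 (p2 x)) \<partial>\<mu>)"
    using i1 i2 by simp
  finally have sum: "(\<integral>x. ln (g x) \<partial>\<mu>) = (\<integral>x. ln (f1 (p1 x)) \<partial>\<mu>) + (\<integral>x. ln (f2 (p2 x)) \<partial>\<mu>)" .
  have "Ent L1 \<mu>1 = ereal (- (\<integral>x. ln (f1 x) \<partial>\<mu>1))"
  proof -
    have "integrable \<mu>1 (\<lambda>x. ln (f1 x))"
      using i1 unfolding \<mu>1_def by (subst integrable_distr_eq) auto
    then show ?thesis using Ent_density[OF L1.sigma_finite_measure_axioms f1 f10] \<mu>1 by simp
  qed
  moreover have "(\<integral>x. ln (f1 x) \<partial>\<mu>1) = (\<integral>x. ln (f1 (p1 x)) \<partial>\<mu>)"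
    unfolding \<mu>1_def by (subst integral_distr) auto
  moreover have "Ent L2 \<mu>2 = ereal (- (\<integral>x. ln (f2 x) \<partial>\<mu>2))"
  proof -
    have "integrable \<mu>2 (\<lambda>x. ln (f2 x))"
      using i2 unfolding \<mu>2_def by (subst integrable_distr_eq) auto
    then show ?thesis using Ent_density[OF L2.sigma_finite_measure_axioms f2 f20] \<mu>2 by simp
  qed
  moreover have "(\<integral>x. ln (f2 x) \<partial>\<mu>2) = (\<integral>x. ln (f2 (p2 x)) \<partial>\<mu>)"
    unfolding \<mu>2_def by (subst integral_distr) auto
  ultimately show ?thesis
    using 2(5) G(2) sum unfolding \<mu>1_def \<mu>2_def by simp
qed simp

section \<open>Noncommutative polynomials and trace states\<close>

lemma poly_mapping_sum_single: "P = (\<Sum>w\<in>Poly_Mapping.keys P. Poly_Mapping.single w (Poly_Mapping.lookup P w))"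
  by (rule poly_mapping_eqI) (auto simp: lookup_sum lookup_single when_def in_keys_iff)

text \<open>The common shape of \<open>shift\<close>, \<open>star\<close>, the coefficient norm
  \<open>ncpoly_norm\<close> and the matricial states, so that additivity is proved once.\<close>

definition lift_ncpoly :: "(word \<Rightarrow> complex \<Rightarrow> 'b :: comm_monoid_add) \<Rightarrow> ncpoly \<Rightarrow> 'b" where
  "lift_ncpoly \<phi> P = (\<Sum>w\<in>Poly_Mapping.keys P. \<phi> w (Poly_Mapping.lookup P w))"

text \<open>Cancellation can shrink the keys of a sum. Summing over a fixed finite superset removes
  this dependence, provided that zero coefficients contribute nothing.\<close>

lemma lift_ncpoly_superset:
  assumes "finite S" "Poly_Mapping.keys P \<subseteq> S" "\<And>w. \<phi> w 0 = 0"
  shows "lift_ncpoly \<phi> P = (\<Sum>w\<in>S. \<phi> w (Poly_Mapping.lookup P w))"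
  unfolding lift_ncpoly_def
  using assms by (intro sum.mono_neutral_left) (auto simp: in_keys_iff)

lemma lift_ncpoly_single: "(\<And>w. \<phi> w 0 = 0) \<Longrightarrow> lift_ncpoly \<phi> (Poly_Mapping.single w c) = \<phi> w c"
  by (auto simp: lift_ncpoly_def)

lemma lift_ncpoly_add:
  assumes "\<And>w. \<phi> w 0 = 0" "\<And>w a b. \<phi> w (a + b) = \<phi> w a + \<phi> w b"
  shows "lift_ncpoly \<phi> (P + Q) = lift_ncpoly \<phi> P + lift_ncpoly \<phi> Q"
proof -
  let ?S = "Poly_Mapping.keys P \<union> Poly_Mapping.keys Q"
  have "Poly_Mapping.keys (P + Q) \<subseteq> ?S" by (rule keys_add)
  then show ?thesis
    using assms by (simp add: lift_ncpoly_superset[of ?S] lookup_add sum.distrib)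
qed

lemma lift_ncpoly_sum:
  assumes "\<And>w. \<phi> w 0 = 0" "\<And>w a b. \<phi> w (a + b) = \<phi> w a + \<phi> w b"
  shows "lift_ncpoly \<phi> (\<Sum>i\<in>I. P i) = (\<Sum>i\<in>I. lift_ncpoly \<phi> (P i))"
  by (induction I rule: infinite_finite_induct)
    (simp_all add: lift_ncpoly_add assms, simp_all add: lift_ncpoly_def)

lemma ncpoly_mult_expand:
  fixes P Q :: ncpoly
  shows "P * Q = (\<Sum>v\<in>Poly_Mapping.keys P. \<Sum>w\<in>Poly_Mapping.keys Q.
    Poly_Mapping.single (v + w) (Poly_Mapping.lookup P v * Poly_Mapping.lookup Q w))"
  by (subst poly_mapping_sum_single[of P], subst poly_mapping_sum_single[of Q])
    (simp add: sum_product mult_single)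

abbreviation shift_word :: "nat \<Rightarrow> word \<Rightarrow> word" where
  "shift_word k w \<equiv> Word (map (\<lambda>i. i + k) (letters w))"

lemma shift_lift: "shift k = lift_ncpoly (\<lambda>w. Poly_Mapping.single (shift_word k w))"
  by (auto simp: shift_def lift_ncpoly_def)

lemma star_lift: "star = lift_ncpoly (\<lambda>w c. Poly_Mapping.single (Word (rev (letters w))) (cnj c))"
  by (auto simp: star_def lift_ncpoly_def)

lemma shift_single: "shift k (Poly_Mapping.single w c) = Poly_Mapping.single (shift_word k w) c"
  by (simp add: shift_lift lift_ncpoly_single)

lemma shift_add: "shift k (P + Q) = shift k P + shift k Q"
  by (simp add: shift_lift lift_ncpoly_add single_add)

lemma shift_sum: "shift k (\<Sum>i\<in>I. P i) = (\<Sum>i\<in>I. shift k (P i))"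
  by (simp add: shift_lift lift_ncpoly_sum single_add)

lemma star_single: "star (Poly_Mapping.single w c) = Poly_Mapping.single (Word (rev (letters w))) (cnj c)"
  by (simp add: star_lift lift_ncpoly_single)

lemma star_sum: "star (\<Sum>i\<in>I. P i) = (\<Sum>i\<in>I. star (P i))"
  by (simp add: star_lift lift_ncpoly_sum single_add)

lemma shift_expand: "shift k P = (\<Sum>w\<in>Poly_Mapping.keys P. Poly_Mapping.single (shift_word k w) (Poly_Mapping.lookup P w))"
  by (simp add: shift_def)

text \<open>Relabelling letters commutes with concatenation, and below also with reversal. So
  \<open>shift k\<close> is a unital star-homomorphism, which is why marginals of states are
  states.\<close>

lemma shift_mult: "shift k (P * Q) = shift k P * shift k Q"
proof -
  have "shift k (P * Q) = (\<Sum>v\<in>Poly_Mapping.keys P. \<Sum>w\<in>Poly_Mapping.keys Q.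
    Poly_Mapping.single (shift_word k (v + w)) (Poly_Mapping.lookup P v * Poly_Mapping.lookup Q w))"
    by (subst ncpoly_mult_expand) (simp add: shift_sum shift_single)
  also have "\<dots> = shift k P * shift k Q"
    unfolding shift_expand by (simp add: sum_product mult_single plus_word_def)
  finally show ?thesis .
qed

lemma shift_star: "shift k (star P) = star (shift k P)"
  by (simp add: star_def[of P] shift_expand[of k P] shift_sum star_sum shift_single star_single rev_map)

lemma shift_const: "shift k (const c) = const c"
  by (simp add: shift_single zero_word_def)

lemma shift_one: "shift k 1 = 1"
  using shift_const[of k 1] by simp

lemma shift_power: "shift k (P ^ j) = shift k P ^ j"
  by (induction j) (simp_all add: shift_one shift_mult)

lemma words_add: "v \<in> words n \<Longrightarrow> w \<in> words n \<Longrightarrow> v + w \<in> words n"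
  by (auto simp: words_def plus_word_def)

lemma ncpolys_single [simp]: "w \<in> words n \<Longrightarrow> Poly_Mapping.single w c \<in> ncpolys n"
  by (auto simp: ncpolys_def)

lemma ncpolys_const [simp]: "const c \<in> ncpolys n"
  by (rule ncpolys_single) (simp add: words_def zero_word_def)

lemma ncpolys_zero [simp]: "0 \<in> ncpolys n"
  by (simp add: ncpolys_def)

lemma ncpolys_one [simp]: "1 \<in> ncpolys n"
  using ncpolys_const[of 1] by simp

lemma ncpolys_add [simp]: "P \<in> ncpolys n \<Longrightarrow> Q \<in> ncpolys n \<Longrightarrow> P + Q \<in> ncpolys n"
  using keys_add[of P Q] by (auto simp: ncpolys_def)

lemma ncpolys_mult [simp]: "P \<in> ncpolys n \<Longrightarrow> Q \<in> ncpolys n \<Longrightarrow> P * Q \<in> ncpolys n"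
  using keys_mult[of P Q] unfolding ncpolys_def by (fastforce intro: words_add)

lemma ncpolys_power [simp]: "P \<in> ncpolys n \<Longrightarrow> P ^ k \<in> ncpolys n"
  by (induction k) auto

lemma ncpolys_sum: "(\<And>i. i \<in> I \<Longrightarrow> P i \<in> ncpolys n) \<Longrightarrow> (\<Sum>i\<in>I. P i) \<in> ncpolys n"
  by (induction I rule: infinite_finite_induct) auto

lemma ncpolys_star [simp]: "P \<in> ncpolys n \<Longrightarrow> star P \<in> ncpolys n"
  unfolding star_def by (intro ncpolys_sum ncpolys_single) (auto simp: ncpolys_def words_def)

lemma ncpolys_shift: "P \<in> ncpolys m \<Longrightarrow> k + m \<le> n \<Longrightarrow> shift k P \<in> ncpolys n"
  unfolding shift_def by (intro ncpolys_sum ncpolys_single) (force simp: ncpolys_def words_def)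

lemma ncpolys_indet [simp]: "i < n \<Longrightarrow> indet i \<in> ncpolys n"
  by (rule ncpolys_single) (simp add: words_def)

section \<open>Convexity, marginals and neighbourhoods of states\<close>

lemma statesD:
  assumes "\<tau> \<in> states n R"
  shows "\<tau> \<in> extensional (ncpolys n)"
    and "P \<in> ncpolys n \<Longrightarrow> Q \<in> ncpolys n \<Longrightarrow> \<tau> (P + Q) = \<tau> P + \<tau> Q"
    and "P \<in> ncpolys n \<Longrightarrow> \<tau> (const c * P) = c * \<tau> P"
    and "P \<in> ncpolys n \<Longrightarrow> \<tau> (star P) = cnj (\<tau> P)"
    and "P \<in> ncpolys n \<Longrightarrow> \<tau> (star P * P) \<in> \<real>\<^sub>\<ge>\<^sub>0"
    and "P \<in> ncpolys n \<Longrightarrow> Q \<in> ncpolys n \<Longrightarrow> \<tau> (P * Q) = \<tau> (Q * P)"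
    and "\<tau> 1 = 1"
    and "P \<in> ncpolys n \<Longrightarrow> \<exists>r. \<forall>k. Re (\<tau> ((star P * P) ^ k)) \<le> r ^ (2 * k)"
    and "i < n \<Longrightarrow> Re (\<tau> (indet i ^ (2 * k))) \<le> R ^ (2 * k)"
  using assms by (auto simp: states_def trace_states_def)

lemma statesI:
  assumes "\<tau> \<in> extensional (ncpolys n)"
    and "\<And>P Q. P \<in> ncpolys n \<Longrightarrow> Q \<in> ncpolys n \<Longrightarrow> \<tau> (P + Q) = \<tau> P + \<tau> Q"
    and "\<And>P c. P \<in> ncpolys n \<Longrightarrow> \<tau> (const c * P) = c * \<tau> P"
    and "\<And>P. P \<in> ncpolys n \<Longrightarrow> \<tau> (star P) = cnj (\<tau> P)"
    and "\<And>P. P \<in> ncpolys n \<Longrightarrow> \<tau> (star P * P) \<in> \<real>\<^sub>\<ge>\<^sub>0"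
    and "\<And>P Q. P \<in> ncpolys n \<Longrightarrow> Q \<in> ncpolys n \<Longrightarrow> \<tau> (P * Q) = \<tau> (Q * P)"
    and "\<tau> 1 = 1"
    and "\<And>P. P \<in> ncpolys n \<Longrightarrow> \<exists>r. \<forall>k. Re (\<tau> ((star P * P) ^ k)) \<le> r ^ (2 * k)"
    and "\<And>i k. i < n \<Longrightarrow> Re (\<tau> (indet i ^ (2 * k))) \<le> R ^ (2 * k)"
  shows "\<tau> \<in> states n R"
  using assms unfolding states_def trace_states_def by blast

lemma power_even_mono_abs:
  fixes r s :: real
  assumes "\<bar>r\<bar> \<le> \<bar>s\<bar>"
  shows "r ^ (2 * k) \<le> s ^ (2 * k)"
proof -
  have "r\<^sup>2 \<le> s\<^sup>2" using assms by (simp add: abs_le_square_iff)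
  then show ?thesis by (simp add: power_mult power_mono)
qed

lemma convex_comb_le:
  fixes a b c t :: real
  assumes "a \<le> c" "b \<le> c" "0 \<le> t" "t \<le> 1"
  shows "t * a + (1 - t) * b \<le> c"
  using convex_bound_le[of a c b t "1 - t"] assms by simp

lemma states_convex:
  assumes \<sigma>: "\<sigma> \<in> states n R" and \<tau>: "\<tau> \<in> states n R" and t: "t \<in> {0..1}"
  shows "(\<lambda>P\<in>ncpolys n. of_real t * \<sigma> P + of_real (1 - t) * \<tau> P) \<in> states n R" (is "?\<rho> \<in> _")
proof (rule statesI)
  note s = statesD[OF \<sigma>] and u = statesD[OF \<tau>]
  show "?\<rho> (P + Q) = ?\<rho> P + ?\<rho> Q" if "P \<in> ncpolys n" "Q \<in> ncpolys n" for P Q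
    using that by (simp add: s(2) u(2) algebra_simps)
  show "?\<rho> (const c * P) = c * ?\<rho> P" if "P \<in> ncpolys n" for P c
    using that by (simp add: s(3) u(3) algebra_simps)
  show "?\<rho> (star P) = cnj (?\<rho> P)" if "P \<in> ncpolys n" for P
    using that by (simp add: s(4) u(4))
  show "?\<rho> (star P * P) \<in> \<real>\<^sub>\<ge>\<^sub>0" if "P \<in> ncpolys n" for P
    using that s(5)[OF that] u(5)[OF that] t
    by (auto simp: complex_nonneg_Reals_iff intro!: add_nonneg_nonneg mult_nonneg_nonneg)
  show "?\<rho> (P * Q) = ?\<rho> (Q * P)" if "P \<in> ncpolys n" "Q \<in> ncpolys n" for P Q
    using that s(6)[OF that] u(6)[OF that] by simp
  show "?\<rho> 1 = 1" using s(7) u(7) by simp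
  show "\<exists>r. \<forall>k. Re (?\<rho> ((star P * P) ^ k)) \<le> r ^ (2 * k)" if P: "P \<in> ncpolys n" for P
  proof -
    obtain r1 r2 where r: "\<And>k. Re (\<sigma> ((star P * P) ^ k)) \<le> r1 ^ (2 * k)" "\<And>k. Re (\<tau> ((star P * P) ^ k)) \<le> r2 ^ (2 * k)"
      using s(8)[OF P] u(8)[OF P] by blast
    \<comment> \<open>The growth constants may be negative; only even powers occur, so absolute
      values can be used.\<close>
    define r where "r = max \<bar>r1\<bar> \<bar>r2\<bar>"
    have "r1 ^ (2 * k) \<le> r ^ (2 * k)" "r2 ^ (2 * k) \<le> r ^ (2 * k)" for k
      by (intro power_even_mono_abs; simp add: r_def)+
    then have "t * Re (\<sigma> ((star P * P) ^ k)) + (1 - t) * Re (\<tau> ((star P * P) ^ k)) \<le> r ^ (2 * k)" for k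
      using t by (intro convex_comb_le order_trans[OF r(1)] order_trans[OF r(2)]) auto
    then show ?thesis using P by (intro exI[of _ r]) simp
  qed
  show "Re (?\<rho> (indet i ^ (2 * k))) \<le> R ^ (2 * k)" if "i < n" for i k
    using that t convex_comb_le[OF s(9)[OF that, of k] u(9)[OF that, of k], of t] by simp
qed simp

lemma marginal_states:
  assumes \<tau>: "\<tau> \<in> states n R" and le: "k + m \<le> n"
  shows "marginal k m \<tau> \<in> states m R"
proof (rule statesI)
  note s = statesD[OF \<tau>]
  have sh: "shift k P \<in> ncpolys n" if "P \<in> ncpolys m" for P using ncpolys_shift[OF that le] .
  show "marginal k m \<tau> \<in> extensional (ncpolys m)" by (simp add: marginal_def)
  show "marginal k m \<tau> (P + Q) = marginal k m \<tau> P + marginal k m \<tau> Q"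
    if "P \<in> ncpolys m" "Q \<in> ncpolys m" for P Q
    using that by (simp add: marginal_def shift_add s(2) sh)
  show "marginal k m \<tau> (const c * P) = c * marginal k m \<tau> P" if "P \<in> ncpolys m" for P c
    using that by (simp add: marginal_def shift_mult shift_const s(3) sh)
  show "marginal k m \<tau> (star P) = cnj (marginal k m \<tau> P)" if "P \<in> ncpolys m" for P
    using that by (simp add: marginal_def shift_star s(4) sh)
  show "marginal k m \<tau> (star P * P) \<in> \<real>\<^sub>\<ge>\<^sub>0" if "P \<in> ncpolys m" for P
    using that by (simp add: marginal_def shift_mult shift_star s(5) sh)
  show "marginal k m \<tau> (P * Q) = marginal k m \<tau> (Q * P)"
    if "P \<in> ncpolys m" "Q \<in> ncpolys m" for P Q
    using that s(6)[OF sh[OF that(1)] sh[OF that(2)]] by (simp add: marginal_def shift_mult)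
  show "marginal k m \<tau> 1 = 1" by (simp add: marginal_def shift_one s(7))
  show "\<exists>r. \<forall>j. Re (marginal k m \<tau> ((star P * P) ^ j)) \<le> r ^ (2 * j)" if "P \<in> ncpolys m" for P
    using that s(8)[OF sh[OF that]] by (simp add: marginal_def shift_power shift_mult shift_star)
  show "Re (marginal k m \<tau> (indet i ^ (2 * j))) \<le> R ^ (2 * j)" if "i < m" for i j
    using that le s(9)[of "i + k" j] by (simp add: marginal_def shift_power shift_single)
qed

lemma marginal_monomial:
  assumes "w \<in> words m"
  shows "marginal k m \<tau> (monomial w) = \<tau> (monomial (shift_word k w))"
  using assms by (simp add: marginal_def shift_single)

text \<open>Relabelling keeps the length of a word, so each constraint on the marginal is one of the
  constraints on the joint state, with the same \<open>\<epsilon>\<close> and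
  \<open>K\<close>.\<close>

lemma marginal_nbhd:
  assumes "\<sigma> \<in> nbhd n R \<tau> \<epsilon> K" and le: "k + m \<le> n"
  shows "marginal k m \<sigma> \<in> nbhd m R (marginal k m \<tau>) \<epsilon> K"
proof -
  have \<sigma>: "\<sigma> \<in> states n R"
    and c: "\<And>w. w \<in> words n \<Longrightarrow> real (length (letters w)) < K \<Longrightarrow> cmod (\<tau> (monomial w) - \<sigma> (monomial w)) < \<epsilon>"
    using assms by (auto simp: nbhd_def)
  have "shift_word k w \<in> words n" if "w \<in> words m" for w
    using that le by (force simp: words_def)
  then show ?thesis
    using marginal_states[OF \<sigma> le] c by (auto simp: nbhd_def marginal_monomial)
qed

lemma nbhd_trans:
  assumes "\<sigma> \<in> nbhd n R \<tau> \<epsilon> K" "\<rho> \<in> nbhd n R \<sigma> \<delta> K"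
  shows "\<rho> \<in> nbhd n R \<tau> (\<epsilon> + \<delta>) K"
  using assms unfolding nbhd_def by (fastforce intro: norm_diff_triangle_less)

lemma nbhd_mono: "\<epsilon> \<le> \<epsilon>' \<Longrightarrow> K' \<le> K \<Longrightarrow> nbhd n R \<tau> \<epsilon> K \<subseteq> nbhd n R \<tau> \<epsilon>' K'"
  unfolding nbhd_def by fastforce

text \<open>The difference to be bounded is itself a convex combination of the two given
  differences, so neither \<open>\<epsilon>\<close> nor \<open>K\<close> changes.\<close>

lemma nbhd_convex:
  assumes "\<sigma>' \<in> nbhd n R \<sigma> \<epsilon> K" "\<tau>' \<in> nbhd n R \<tau> \<epsilon> K" and t: "t \<in> {0..1}"
  shows "(\<lambda>P\<in>ncpolys n. of_real t * \<sigma>' P + of_real (1 - t) * \<tau>' P)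
    \<in> nbhd n R (\<lambda>P\<in>ncpolys n. of_real t * \<sigma> P + of_real (1 - t) * \<tau> P) \<epsilon> K"
proof -
  have "cmod (of_real t * \<sigma> P + of_real (1 - t) * \<tau> P - (of_real t * \<sigma>' P + of_real (1 - t) * \<tau>' P)) < \<epsilon>"
    if "cmod (\<sigma> P - \<sigma>' P) < \<epsilon>" "cmod (\<tau> P - \<tau>' P) < \<epsilon>" for P
  proof -
    have eq: "of_real t * \<sigma> P + of_real (1 - t) * \<tau> P - (of_real t * \<sigma>' P + of_real (1 - t) * \<tau>' P)
      = of_real t * (\<sigma> P - \<sigma>' P) + of_real (1 - t) * (\<tau> P - \<tau>' P)" by (simp add: algebra_simps)
    have "cmod (of_real t * (\<sigma> P - \<sigma>' P) + of_real (1 - t) * (\<tau> P - \<tau>' P))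
        \<le> cmod (of_real t * (\<sigma> P - \<sigma>' P)) + cmod (of_real (1 - t) * (\<tau> P - \<tau>' P))"
      by (rule norm_triangle_ineq)
    also have "\<dots> = t * cmod (\<sigma> P - \<sigma>' P) + (1 - t) * cmod (\<tau> P - \<tau>' P)"
      using t unfolding norm_mult norm_of_real by simp
    also have "\<dots> < \<epsilon>"
      using t that convex_bound_lt[of "cmod (\<sigma> P - \<sigma>' P)" \<epsilon> "cmod (\<tau> P - \<tau>' P)" t "1 - t"] by simp
    finally show ?thesis unfolding eq .
  qed
  then show ?thesis
    using assms states_convex[of \<sigma>' n R \<tau>' t] by (auto simp: nbhd_def)
qed

lemma finite_words_bounded: "finite {w \<in> words n. real (length (letters w)) < K}"
proof (rule finite_subset)
  show "{w \<in> words n. real (length (letters w)) < K}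
      \<subseteq> Word ` {xs. set xs \<subseteq> {..<n} \<and> length xs \<le> nat \<lceil>K\<rceil>}"
  proof
    fix w assume w: "w \<in> {w \<in> words n. real (length (letters w)) < K}"
    then have "length (letters w) \<le> nat \<lceil>K\<rceil>" by simp linarith
    with w have "letters w \<in> {xs. set xs \<subseteq> {..<n} \<and> length xs \<le> nat \<lceil>K\<rceil>}"
      by (simp add: words_def)
    then show "w \<in> Word ` {xs. set xs \<subseteq> {..<n} \<and> length xs \<le> nat \<lceil>K\<rceil>}"
      by (metis image_eqI word.collapse)
  qed
  show "finite (Word ` {xs. set xs \<subseteq> {..<n} \<and> length xs \<le> nat \<lceil>K\<rceil>})"
    by (intro finite_imageI finite_lists_length_le) simp
qed

lemma topspace_state_topology: "topspace (state_topology n R) = states n R"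
  using statesD(1) by (auto simp: state_topology_def PiE_def)

text \<open>Only finitely many words in \<open>n\<close> letters are shorter than \<open>K\<close>,
  so finitely many coordinates are constrained.\<close>

lemma openin_nbhd: "openin (state_topology n R) (nbhd n R \<tau> \<epsilon> K)"
proof -
  let ?T = "state_topology n R" and ?W = "{w \<in> words n. real (length (letters w)) < K}"
  have "openin ?T {\<sigma> \<in> topspace ?T. \<sigma> (monomial w) \<in> ball (\<tau> (monomial w)) \<epsilon>}" if "w \<in> ?W" for w
  proof (rule openin_continuous_map_preimage)
    show "continuous_map ?T euclidean (\<lambda>\<sigma>. \<sigma> (monomial w))"
      unfolding state_topology_def
      using that by (intro continuous_map_from_subtopology continuous_map_product_projection) auto
  qed simp
  \<comment> \<open>The whole space is included because the family is empty for
    \<open>K \<le> 0\<close> and its intersection is then \<open>UNIV\<close>.\<close>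
  then have "openin ?T ((\<Inter>w\<in>?W. {\<sigma> \<in> topspace ?T. \<sigma> (monomial w) \<in> ball (\<tau> (monomial w)) \<epsilon>}) \<inter> topspace ?T)"
    by (intro openin_INT finite_words_bounded)
  also have "(\<Inter>w\<in>?W. {\<sigma> \<in> topspace ?T. \<sigma> (monomial w) \<in> ball (\<tau> (monomial w)) \<epsilon>}) \<inter> topspace ?T
      = nbhd n R \<tau> \<epsilon> K"
    unfolding topspace_state_topology by (auto simp: nbhd_def dist_norm)
  finally show ?thesis .
qed

section \<open>Upper semicontinuity\<close>

lemma tilde_chi_gen_usc:
  assumes mono: "\<And>u v :: nat \<Rightarrow> ereal. (\<And>N. u N \<le> v N) \<Longrightarrow> lm u \<le> lm v"
  shows "usc_on_states n R (tilde_chi_gen lm n R)"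
  unfolding usc_on_states_def
proof
  fix a
  let ?A = "\<lambda>\<tau> \<epsilon> K N. ereal (1 / real N ^ 2) *
     (SUP \<mu>\<in>{\<mu> \<in> borel_probs n N R. barycenter n N \<mu> \<in> nbhd n R \<tau> \<epsilon> K}. Ent (leb_ball n N R) \<mu>)
     + ereal (real n / 2 * ln (real N))"
  show "openin (state_topology n R) {\<tau> \<in> states n R. tilde_chi_gen lm n R \<tau> < a}"
  proof (subst openin_subopen, intro ballI)
    fix \<tau> assume "\<tau> \<in> {\<tau> \<in> states n R. tilde_chi_gen lm n R \<tau> < a}"
    then have \<tau>: "\<tau> \<in> states n R" "tilde_chi_gen lm n R \<tau> < a" by auto
    then obtain \<epsilon> K where eK: "0 < \<epsilon>" "0 < K" "lm (?A \<tau> \<epsilon> K) < a"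
      by (auto simp: tilde_chi_gen_def INF_less_iff)
    \<comment> \<open>Half the radius leaves room for the triangle inequality: every measure
      admissible for \<open>\<sigma>\<close> at radius \<open>\<epsilon> / 2\<close> is admissible
      for \<open>\<tau>\<close> at radius \<open>\<epsilon>\<close>.\<close>
    have "tilde_chi_gen lm n R \<sigma> < a" if \<sigma>: "\<sigma> \<in> nbhd n R \<tau> (\<epsilon> / 2) K" for \<sigma>
    proof -
      have sub: "nbhd n R \<sigma> (\<epsilon> / 2) K \<subseteq> nbhd n R \<tau> \<epsilon> K"
        using nbhd_trans[OF \<sigma>, of _ "\<epsilon> / 2"] by auto
      have "tilde_chi_gen lm n R \<sigma> \<le> lm (?A \<sigma> (\<epsilon> / 2) K)"
        unfolding tilde_chi_gen_def using eK by (intro INF_lower2[of "(\<epsilon> / 2, K)"]) auto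
      also have "\<dots> \<le> lm (?A \<tau> \<epsilon> K)"
        using sub by (intro mono add_right_mono ereal_mult_left_mono SUP_subset_mono) auto
      finally show ?thesis using eK by simp
    qed
    moreover have "\<tau> \<in> nbhd n R \<tau> (\<epsilon> / 2) K" using \<tau> eK by (simp add: nbhd_def)
    ultimately show "\<exists>T. openin (state_topology n R) T \<and> \<tau> \<in> T \<and>
        T \<subseteq> {\<tau> \<in> states n R. tilde_chi_gen lm n R \<tau> < a}"
      by (intro exI[of _ "nbhd n R \<tau> (\<epsilon> / 2) K"] conjI openin_nbhd) (auto simp: nbhd_def[of n R \<tau>])
  qed
qed

section \<open>Matricial states\<close>

text \<open>A weighted l1 norm of the coefficients. It is submultiplicative and dominates every
  linear functional whose value on each word is at most \<open>C ^ length\<close> in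
  modulus.\<close>

definition ncpoly_norm :: "real \<Rightarrow> ncpoly \<Rightarrow> real" where
  "ncpoly_norm C = lift_ncpoly (\<lambda>w c. cmod c * C ^ length (letters w))"

lemma ncpoly_norm_single: "ncpoly_norm C (Poly_Mapping.single w c) = cmod c * C ^ length (letters w)"
  by (simp add: ncpoly_norm_def lift_ncpoly_single)

lemma ncpoly_norm_nonneg: "0 \<le> C \<Longrightarrow> 0 \<le> ncpoly_norm C P"
  by (auto simp: ncpoly_norm_def lift_ncpoly_def intro: sum_nonneg)

lemma ncpoly_norm_add:
  assumes "0 \<le> C"
  shows "ncpoly_norm C (P + Q) \<le> ncpoly_norm C P + ncpoly_norm C Q"
proof -
  let ?S = "Poly_Mapping.keys P \<union> Poly_Mapping.keys Q"
  have "ncpoly_norm C (P + Q) = (\<Sum>w\<in>?S. cmod (Poly_Mapping.lookup (P + Q) w) * C ^ length (letters w))"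
    unfolding ncpoly_norm_def by (rule lift_ncpoly_superset) (use keys_add[of P Q] in auto)
  also have "\<dots> \<le> (\<Sum>w\<in>?S. cmod (Poly_Mapping.lookup P w) * C ^ length (letters w)
      + cmod (Poly_Mapping.lookup Q w) * C ^ length (letters w))"
    using assms by (intro sum_mono) (auto simp: lookup_add distrib_right[symmetric]
        intro!: mult_right_mono norm_triangle_ineq)
  also have "\<dots> = ncpoly_norm C P + ncpoly_norm C Q"
    unfolding ncpoly_norm_def by (simp add: lift_ncpoly_superset[of ?S] sum.distrib)
  finally show ?thesis .
qed

lemma ncpoly_norm_sum:
  assumes "0 \<le> C"
  shows "ncpoly_norm C (\<Sum>i\<in>I. P i) \<le> (\<Sum>i\<in>I. ncpoly_norm C (P i))"
proof (induction I rule: infinite_finite_induct)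
  case (insert i I)
  then show ?case using ncpoly_norm_add[OF assms, of "P i" "sum P I"] by simp
qed (simp_all add: ncpoly_norm_def lift_ncpoly_def)

lemma ncpoly_norm_mult:
  assumes "0 \<le> C"
  shows "ncpoly_norm C (P * Q) \<le> ncpoly_norm C P * ncpoly_norm C Q"
proof -
  have "ncpoly_norm C (P * Q) \<le> (\<Sum>v\<in>Poly_Mapping.keys P. \<Sum>w\<in>Poly_Mapping.keys Q.
     ncpoly_norm C (Poly_Mapping.single (v + w) (Poly_Mapping.lookup P v * Poly_Mapping.lookup Q w)))"
    by (subst ncpoly_mult_expand) (intro order_trans[OF ncpoly_norm_sum] sum_mono order_refl assms)
  also have "\<dots> = ncpoly_norm C P * ncpoly_norm C Q"
    unfolding ncpoly_norm_single
    by (simp add: ncpoly_norm_def lift_ncpoly_def sum_product plus_word_def norm_mult power_add mult_ac)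
  finally show ?thesis .
qed

lemma ncpoly_norm_power:
  assumes "0 \<le> C"
  shows "ncpoly_norm C (P ^ k) \<le> ncpoly_norm C P ^ k"
proof (induction k)
  case 0
  then show ?case using ncpoly_norm_single[of C 0 1] by (simp add: zero_word_def flip: single_one)
next
  case (Suc k)
  have "ncpoly_norm C (P ^ Suc k) \<le> ncpoly_norm C P * ncpoly_norm C (P ^ k)"
    using ncpoly_norm_mult[OF assms] by simp
  also have "\<dots> \<le> ncpoly_norm C P * ncpoly_norm C P ^ k"
    using Suc assms by (intro mult_left_mono ncpoly_norm_nonneg)
  finally show ?case by simp
qed

text \<open>
  The uniform bound by \<^const>\<open>ncpoly_norm\<close> is what makes the growth condition, whose constant may
  depend on the state, pass to averages.
\<close>

lemma states_average:
  fixes \<tau> :: "'a \<Rightarrow> ncpoly \<Rightarrow> complex"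
  assumes "prob_space \<mu>" and ae: "AE M in \<mu>. \<tau> M \<in> states n R"
    and int: "\<And>P. P \<in> ncpolys n \<Longrightarrow> integrable \<mu> (\<lambda>M. \<tau> M P)"
    and bound: "\<And>P. P \<in> ncpolys n \<Longrightarrow> AE M in \<mu>. cmod (\<tau> M P) \<le> ncpoly_norm C P" and C: "0 \<le> C"
  shows "(\<lambda>P\<in>ncpolys n. \<integral>M. \<tau> M P \<partial>\<mu>) \<in> states n R" (is "?\<rho> \<in> _")
proof (rule statesI)
  interpret prob_space \<mu> by fact
  have meas: "(\<lambda>M. \<tau> M P) \<in> borel_measurable \<mu>" if "P \<in> ncpolys n" for P
    using int[OF that] by auto
  show "?\<rho> (P + Q) = ?\<rho> P + ?\<rho> Q" if PQ: "P \<in> ncpolys n" "Q \<in> ncpolys n" for P Q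
  proof -
    have "(\<integral>M. \<tau> M (P + Q) \<partial>\<mu>) = (\<integral>M. \<tau> M P + \<tau> M Q \<partial>\<mu>)"
      using ae PQ by (intro integral_cong_AE borel_measurable_add) (auto simp: meas statesD(2) elim!: eventually_mono)
    then show ?thesis using PQ int by simp
  qed
  show "?\<rho> (const c * P) = c * ?\<rho> P" if P: "P \<in> ncpolys n" for P c
  proof -
    have "(\<integral>M. \<tau> M (const c * P) \<partial>\<mu>) = (\<integral>M. c * \<tau> M P \<partial>\<mu>)"
      using ae P by (intro integral_cong_AE borel_measurable_times) (auto simp: meas statesD(3) elim!: eventually_mono)
    then show ?thesis using P by simp
  qed
  show "?\<rho> (star P) = cnj (?\<rho> P)" if P: "P \<in> ncpolys n" for P
  proof -
    have "(\<integral>M. \<tau> M (star P) \<partial>\<mu>) = (\<integral>M. cnj (\<tau> M P) \<partial>\<mu>)"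
      using ae P borel_measurable_integrable[OF integrable_cnj[OF int[OF P]]]
      by (intro integral_cong_AE) (auto simp: meas statesD(4) elim!: eventually_mono)
    then show ?thesis using P by simp
  qed
  show "?\<rho> (star P * P) \<in> \<real>\<^sub>\<ge>\<^sub>0" if P: "P \<in> ncpolys n" for P
  proof -
    \<comment> \<open>Membership in the nonnegative reals is split into a sign condition and a
      vanishing imaginary part, each of which survives integration.\<close>
    have nn: "AE M in \<mu>. 0 \<le> Re (\<tau> M (star P * P)) \<and> Im (\<tau> M (star P * P)) = 0"
      using ae by eventually_elim (use statesD(5)[OF _ P] in \<open>auto simp: complex_nonneg_Reals_iff\<close>)
    have "0 \<le> (\<integral>M. Re (\<tau> M (star P * P)) \<partial>\<mu>)"
      using nn by (intro integral_nonneg_AE) (auto elim: eventually_mono)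
    moreover have "(\<integral>M. Im (\<tau> M (star P * P)) \<partial>\<mu>) = 0"
      using nn by (intro integral_eq_zero_AE) (auto elim: eventually_mono)
    ultimately show ?thesis using P int[of "star P * P"]
      by (simp add: complex_nonneg_Reals_iff)
  qed
  show "?\<rho> (P * Q) = ?\<rho> (Q * P)" if PQ: "P \<in> ncpolys n" "Q \<in> ncpolys n" for P Q
  proof -
    have "(\<integral>M. \<tau> M (P * Q) \<partial>\<mu>) = (\<integral>M. \<tau> M (Q * P) \<partial>\<mu>)"
      using ae by (intro integral_cong_AE) (use PQ in \<open>auto simp: meas statesD(6) elim!: eventually_mono\<close>)
    then show ?thesis using PQ by simp
  qed
  show "?\<rho> 1 = 1"
  proof -
    have "(\<integral>M. \<tau> M 1 \<partial>\<mu>) = (\<integral>M. 1 \<partial>\<mu>)"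
      using ae by (intro integral_cong_AE) (auto simp: meas statesD(7) elim!: eventually_mono)
    then show ?thesis by (simp add: prob_space)
  qed
  have Re_le: "Re (\<integral>M. \<tau> M P \<partial>\<mu>) \<le> c" if P: "P \<in> ncpolys n" and le: "AE M in \<mu>. Re (\<tau> M P) \<le> c" for P c
  proof -
    have "(\<integral>M. Re (\<tau> M P) \<partial>\<mu>) \<le> (\<integral>M. c \<partial>\<mu>)"
      using le int[OF P] by (intro integral_mono_AE) auto
    then show ?thesis using int[OF P] by (simp add: prob_space)
  qed
  show "\<exists>r. \<forall>k. Re (?\<rho> ((star P * P) ^ k)) \<le> r ^ (2 * k)" if P: "P \<in> ncpolys n" for P
  proof (intro exI allI)
    fix k
    let ?Q = "star P * P"
    have "Re (\<integral>M. \<tau> M (?Q ^ k) \<partial>\<mu>) \<le> ncpoly_norm C (?Q ^ k)"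
    proof (rule Re_le)
      show "AE M in \<mu>. Re (\<tau> M (?Q ^ k)) \<le> ncpoly_norm C (?Q ^ k)"
        using bound[of "?Q ^ k"] P by (auto elim!: eventually_mono intro: order_trans[OF complex_Re_le_cmod])
    qed (use P in simp)
    also have "\<dots> \<le> ncpoly_norm C ?Q ^ k" by (rule ncpoly_norm_power[OF C])
    \<comment> \<open>The growth condition has exponent \<open>2 * k\<close>, so its constant is a
      square root of the norm bound, independent of \<open>k\<close>.\<close>
    also have "\<dots> = sqrt (ncpoly_norm C ?Q) ^ (2 * k)"
      by (simp add: power_mult ncpoly_norm_nonneg[OF C])
    finally show "Re (?\<rho> (?Q ^ k)) \<le> sqrt (ncpoly_norm C ?Q) ^ (2 * k)" using P by simp
  qed
  show "Re (?\<rho> (indet i ^ (2 * k))) \<le> R ^ (2 * k)" if i: "i < n" for i k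
  proof -
    have "AE M in \<mu>. Re (\<tau> M (indet i ^ (2 * k))) \<le> R ^ (2 * k)"
      using ae by eventually_elim (rule statesD(9)[OF _ i])
    then show ?thesis using Re_le[of "indet i ^ (2 * k)"] i by simp
  qed
qed simp

lemma nbhd_average:
  fixes \<sigma> :: "'a \<Rightarrow> ncpoly \<Rightarrow> complex"
  assumes "prob_space \<mu>" and ae: "AE M in \<mu>. \<sigma> M \<in> nbhd n R \<tau> \<epsilon> K"
    and int: "\<And>P. P \<in> ncpolys n \<Longrightarrow> integrable \<mu> (\<lambda>M. \<sigma> M P)"
    and bound: "\<And>P. P \<in> ncpolys n \<Longrightarrow> AE M in \<mu>. cmod (\<sigma> M P) \<le> ncpoly_norm C P" and C: "0 \<le> C"
  shows "(\<lambda>P\<in>ncpolys n. \<integral>M. \<sigma> M P \<partial>\<mu>) \<in> nbhd n R \<tau> \<epsilon> K"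
proof -
  interpret prob_space \<mu> by fact
  have "(\<lambda>P\<in>ncpolys n. \<integral>M. \<sigma> M P \<partial>\<mu>) \<in> states n R"
    using assms by (intro states_average[of _ _ n R C]) (auto simp: nbhd_def)
  moreover have "cmod (\<tau> (monomial w) - (\<integral>M. \<sigma> M (monomial w) \<partial>\<mu>)) < \<epsilon>"
    if w: "w \<in> words n" "real (length (letters w)) < K" for w
  proof -
    have i: "integrable \<mu> (\<lambda>M. \<sigma> M (monomial w))" using w by (intro int) simp
    have lt: "AE M in \<mu>. cmod (\<tau> (monomial w) - \<sigma> M (monomial w)) < \<epsilon>"
      using ae by eventually_elim (use w in \<open>auto simp: nbhd_def\<close>)
    have "\<tau> (monomial w) - (\<integral>M. \<sigma> M (monomial w) \<partial>\<mu>) = (\<integral>M. \<tau> (monomial w) - \<sigma> M (monomial w) \<partial>\<mu>)"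
      using i by (simp add: prob_space)
    also have "cmod \<dots> \<le> (\<integral>M. cmod (\<tau> (monomial w) - \<sigma> M (monomial w)) \<partial>\<mu>)"
      by (rule integral_norm_bound)
    \<comment> \<open>An almost sure strict inequality stays strict in the mean under a probability
      measure; the neighbourhoods are defined by strict inequalities.\<close>
    also have "\<dots> < \<epsilon>" using i lt by (intro expectation_less) auto
    finally show ?thesis .
  qed
  ultimately show ?thesis by (auto simp: nbhd_def)
qed

section \<open>Operator norm and entries of Hermitian matrices\<close>

lemma vnorm_nonneg: "0 \<le> vnorm v"
proof -
  have "0 \<le> Re (scalar_prod v (conjugate v))"
    by (auto simp: scalar_prod_def complex_mult_cnj intro!: sum_nonneg add_nonneg_nonneg)
  then show ?thesis by (simp add: vnorm_def)
qed

lemma vnorm_sq: "(vnorm v)\<^sup>2 = (\<Sum>i<dim_vec v. (cmod (vec_index v i))\<^sup>2)"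
proof -
  have eq: "Re (scalar_prod v (conjugate v)) = (\<Sum>i<dim_vec v. (cmod (vec_index v i))\<^sup>2)"
    by (simp add: scalar_prod_def complex_mult_cnj cmod_power2 atLeast0LessThan sum.distrib)
  show ?thesis unfolding vnorm_def eq by (simp add: sum_nonneg)
qed

lemma vnorm_le_iff: "0 \<le> R \<Longrightarrow> vnorm v \<le> R \<longleftrightarrow> (\<Sum>i<dim_vec v. (cmod (vec_index v i))\<^sup>2) \<le> R\<^sup>2"
  using vnorm_nonneg[of v] by (simp add: vnorm_sq[symmetric] abs_le_square_iff[symmetric])

lemma mult_mat_vec_index:
  "A \<in> carrier_mat N N \<Longrightarrow> v \<in> carrier_vec N \<Longrightarrow> i < N \<Longrightarrow>
    vec_index (A *\<^sub>v v) i = (\<Sum>j<N. A $$ (i, j) * vec_index v j)"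
  by (auto simp: scalar_prod_def atLeast0LessThan intro!: sum.cong)

text \<open>A real \<open>Sup\<close> is informative only for bounded sets. A crude bound by row
  sums suffices: vectors of norm at most 1 have entries of modulus at most 1.\<close>

lemma opnorm_bdd:
  assumes A: "A \<in> carrier_mat N N"
  shows "bdd_above {vnorm (A *\<^sub>v v) | v. v \<in> carrier_vec (dim_col A) \<and> vnorm v \<le> 1}"
proof (rule bdd_aboveI)
  let ?B = "sqrt (\<Sum>i<N. (\<Sum>j<N. cmod (A $$ (i, j)))\<^sup>2)"
  fix x assume "x \<in> {vnorm (A *\<^sub>v v) | v. v \<in> carrier_vec (dim_col A) \<and> vnorm v \<le> 1}"
  then obtain v where v: "v \<in> carrier_vec N" "vnorm v \<le> 1" "x = vnorm (A *\<^sub>v v)"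
    using A by auto
  have vj: "cmod (vec_index v j) \<le> 1" if "j < N" for j
  proof -
    have "(cmod (vec_index v j))\<^sup>2 \<le> (\<Sum>i<dim_vec v. (cmod (vec_index v i))\<^sup>2)"
      using that v by (intro member_le_sum) auto
    also have "\<dots> \<le> 1" using v(2) vnorm_le_iff[of 1 v] by simp
    finally show ?thesis by (simp add: abs_square_le_1)
  qed
  have "cmod (vec_index (A *\<^sub>v v) i) \<le> (\<Sum>j<N. cmod (A $$ (i, j)))" if "i < N" for i
  proof -
    have "cmod (vec_index (A *\<^sub>v v) i) \<le> (\<Sum>j<N. cmod (A $$ (i, j) * vec_index v j))"
      unfolding mult_mat_vec_index[OF A v(1) that] by (rule norm_sum)
    also have "\<dots> \<le> (\<Sum>j<N. cmod (A $$ (i, j)))"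
      using vj by (intro sum_mono) (simp add: norm_mult mult_left_le)
    finally show ?thesis .
  qed
  then have "(\<Sum>i<N. (cmod (vec_index (A *\<^sub>v v) i))\<^sup>2) \<le> (\<Sum>i<N. (\<Sum>j<N. cmod (A $$ (i, j)))\<^sup>2)"
    by (intro sum_mono power_mono) auto
  then show "x \<le> ?B" using A v(1)
    unfolding v(3) by (subst vnorm_le_iff) (auto simp: sum_nonneg)
qed

lemma opnorm_le_iff:
  assumes A: "A \<in> carrier_mat N N"
  shows "opnorm A \<le> R \<longleftrightarrow> (\<forall>v\<in>carrier_vec N. vnorm v \<le> 1 \<longrightarrow> vnorm (A *\<^sub>v v) \<le> R)"
proof -
  have "0\<^sub>v (dim_col A) \<in> carrier_vec (dim_col A) \<and> vnorm (0\<^sub>v (dim_col A)) \<le> 1"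
    by (simp add: vnorm_le_iff)
  then have "{vnorm (A *\<^sub>v v) | v. v \<in> carrier_vec (dim_col A) \<and> vnorm v \<le> 1} \<noteq> {}"
    using A by blast
  then show ?thesis
    unfolding opnorm_def using A by (subst cSup_le_iff[OF _ opnorm_bdd[OF A]]) auto
qed

lemma herm_ball_carrier: "A \<in> herm_ball N R \<Longrightarrow> A \<in> carrier_mat N N"
  by (simp add: herm_ball_def herm_def)

text \<open>Unit vectors compete in the supremum and are mapped to the columns. Summed over all
  columns this is the Hilbert-Schmidt bound behind the volume estimate.\<close>

lemma herm_ball_column:
  assumes A: "A \<in> herm_ball N R" and b: "b < N"
  shows "(\<Sum>a<N. (cmod (A $$ (a, b)))\<^sup>2) \<le> R\<^sup>2" and "0 \<le> R"
proof -
  note Ac = herm_ball_carrier[OF A]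
  have "(\<Sum>i<N. (cmod (vec_index (unit_vec N b :: complex Matrix.vec) i))\<^sup>2) = (\<Sum>i<N. if i = b then 1 else 0)"
    using b by (intro sum.cong) auto
  then have "vnorm (unit_vec N b) \<le> 1" using b by (subst vnorm_le_iff) auto
  then have le: "vnorm (A *\<^sub>v unit_vec N b) \<le> R"
    using A b opnorm_le_iff[OF Ac, of R] by (auto simp: herm_ball_def)
  then show "0 \<le> R" using vnorm_nonneg order_trans by blast
  then have "(\<Sum>i<N. (cmod (vec_index (A *\<^sub>v unit_vec N b) i))\<^sup>2) \<le> R\<^sup>2"
    using le Ac by (subst (asm) vnorm_le_iff) auto
  moreover have "vec_index (A *\<^sub>v unit_vec N b) i = A $$ (i, b)" if "i < N" for i
    using that b Ac by simp
  ultimately show "(\<Sum>a<N. (cmod (A $$ (a, b)))\<^sup>2) \<le> R\<^sup>2" by simp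
qed

lemma herm_ball_entry:
  assumes A: "A \<in> herm_ball N R" and a: "a < N" and b: "b < N"
  shows "cmod (A $$ (a, b)) \<le> R"
proof -
  have "(cmod (A $$ (a, b)))\<^sup>2 \<le> (\<Sum>a<N. (cmod (A $$ (a, b)))\<^sup>2)"
    using a by (intro member_le_sum) auto
  also have "\<dots> \<le> R\<^sup>2" by (rule herm_ball_column[OF A b])
  finally show ?thesis using herm_ball_column(2)[OF A b] by (rule power2_le_imp_le)
qed

section \<open>Evaluation of words at tuples of matrices\<close>

lemma word_eval_Nil: "word_eval N M (Word []) = 1\<^sub>m N"
  by (simp add: word_eval_def)

lemma word_eval_Cons: "word_eval N M (Word (i # xs)) = M i * word_eval N M (Word xs)"
  by (simp add: word_eval_def)

lemma word_eval_carrier: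
  assumes "\<And>i. i < n \<Longrightarrow> M i \<in> carrier_mat N N" "set xs \<subseteq> {..<n}"
  shows "word_eval N M (Word xs) \<in> carrier_mat N N"
  using assms(2)
proof (induction xs)
  case (Cons i xs)
  then have "M i \<in> carrier_mat N N" using assms(1) by simp
  then show ?case using Cons by (auto simp: word_eval_Cons)
qed (simp add: word_eval_Nil)

lemma word_eval_Cons_index:
  assumes M: "\<And>i. i < n \<Longrightarrow> M i \<in> carrier_mat N N" and "set (i # xs) \<subseteq> {..<n}" and a: "a < N" and b: "b < N"
  shows "word_eval N M (Word (i # xs)) $$ (a, b) = (\<Sum>c<N. M i $$ (a, c) * word_eval N M (Word xs) $$ (c, b))"
proof -
  have "M i \<in> carrier_mat N N" "word_eval N M (Word xs) \<in> carrier_mat N N"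
    using assms(2) by (auto intro!: M word_eval_carrier[OF M])
  then show ?thesis
    unfolding word_eval_Cons using a b by (auto simp: scalar_prod_def atLeast0LessThan)
qed

text \<open>Expanding products entrywise costs a factor \<open>N\<close> per letter. This is
  harmless, since the bound serves integrability and the growth condition at a fixed
  \<open>N\<close>.\<close>

lemma word_eval_entry:
  assumes M: "\<And>i. i < n \<Longrightarrow> M i \<in> herm_ball N R" and "set xs \<subseteq> {..<n}" and a: "a < N" and b: "b < N"
    and R: "0 \<le> R"
  shows "cmod (word_eval N M (Word xs) $$ (a, b)) \<le> (real N * R) ^ length xs"
  using assms(2) a
proof (induction xs arbitrary: a)
  case Nil
  then show ?case using b by (simp add: word_eval_Nil)
next
  case (Cons i xs)
  have "cmod (word_eval N M (Word (i # xs)) $$ (a, b))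
      \<le> (\<Sum>c<N. cmod (M i $$ (a, c) * word_eval N M (Word xs) $$ (c, b)))"
    using Cons by (subst word_eval_Cons_index[OF herm_ball_carrier[OF M]]) (auto simp: b intro: norm_sum)
  also have "\<dots> \<le> (\<Sum>c<N. R * (real N * R) ^ length xs)"
    unfolding norm_mult using Cons R
    by (intro sum_mono mult_mono Cons.IH herm_ball_entry[OF M]) auto
  finally show ?case by (simp add: mult_ac)
qed

definition word_trace :: "nat \<Rightarrow> (nat \<Rightarrow> complex mat) \<Rightarrow> word \<Rightarrow> complex" where
  "word_trace N M w = (\<Sum>a<N. word_eval N M w $$ (a, a)) / of_nat N"

lemma matrix_state_eq:
  assumes "P \<in> ncpolys n"
  shows "matrix_state n N M P = lift_ncpoly (\<lambda>w c. c * word_trace N M w) P"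
proof -
  have "tr (poly_eval N M P) = (\<Sum>a<N. \<Sum>w\<in>Poly_Mapping.keys P. Poly_Mapping.lookup P w * word_eval N M w $$ (a, a))"
    by (simp add: tr_def poly_eval_def)
  also have "\<dots> = (\<Sum>w\<in>Poly_Mapping.keys P. Poly_Mapping.lookup P w * (\<Sum>a<N. word_eval N M w $$ (a, a)))"
    by (subst sum.swap) (simp add: sum_distrib_left)
  finally show ?thesis
    using assms by (simp add: matrix_state_def lift_ncpoly_def word_trace_def sum_divide_distrib[of _ "Poly_Mapping.keys P"])
qed

lemma word_trace_bound:
  assumes M: "\<And>i. i < n \<Longrightarrow> M i \<in> herm_ball N R" and "w \<in> words n" and N: "N \<ge> 1" and R: "0 \<le> R"
  shows "cmod (word_trace N M w) \<le> (real N * R) ^ length (letters w)"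
proof -
  have "cmod (\<Sum>a<N. word_eval N M w $$ (a, a)) \<le> (\<Sum>a<N. (real N * R) ^ length (letters w))"
    using assms(2) word_eval_entry[OF M, where n = n and xs = "letters w"] R
    by (intro order_trans[OF norm_sum] sum_mono) (auto simp: words_def)
  then show ?thesis using N by (simp add: word_trace_def norm_divide divide_le_eq mult_ac)
qed

lemma matrix_state_bound:
  assumes M: "\<And>i. i < n \<Longrightarrow> M i \<in> herm_ball N R" and P: "P \<in> ncpolys n" and N: "N \<ge> 1" and R: "0 \<le> R"
  shows "cmod (matrix_state n N M P) \<le> ncpoly_norm (real N * R) P"
  unfolding matrix_state_eq[OF P] ncpoly_norm_def lift_ncpoly_def
  using P word_trace_bound[OF M _ N R]
  by (intro order_trans[OF norm_sum] sum_mono) (auto simp: norm_mult ncpolys_def intro!: mult_left_mono)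

lemma word_eval_shift: "word_eval N M (shift_word k w) = word_eval N (\<lambda>i. M (i + k)) w"
  by (simp add: word_eval_def foldr_map comp_def)

lemma word_eval_cong:
  assumes "\<And>i. i < n \<Longrightarrow> M i = M' i" "w \<in> words n"
  shows "word_eval N M w = word_eval N M' w"
  using assms by (auto simp: word_eval_def words_def intro!: foldr_cong)

text \<open>Only the components of \<open>M'\<close> below \<open>m\<close> are prescribed, so that
  a tuple which is \<open>undefined\<close> beyond \<open>m\<close> can be inserted.\<close>

lemma matrix_state_shift:
  assumes P: "P \<in> ncpolys m" and le: "k + m \<le> n" and M': "\<And>i. i < m \<Longrightarrow> M' i = M (i + k)"
  shows "matrix_state n N M (shift k P) = matrix_state m N M' P"
proof -
  have "word_trace N M (shift_word k w) = word_trace N M' w" if "w \<in> words m" for w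
    using word_eval_cong[of m M' "\<lambda>i. M (i + k)" w N] M' that by (simp add: word_trace_def word_eval_shift)
  then show ?thesis
    using P unfolding matrix_state_eq[OF ncpolys_shift[OF P le]] matrix_state_eq[OF P]
    unfolding shift_expand
    by (subst lift_ncpoly_sum) (auto simp: lift_ncpoly_single distrib_right lift_ncpoly_def[of _ P] ncpolys_def
        intro!: sum.cong)
qed

section \<open>Lebesgue measure on balls of Hermitian matrices\<close>

lemma space_herm_borel [simp]: "space (herm_borel N) = herm N"
  by (simp add: herm_borel_def)

lemma measurable_entry [measurable]:
  assumes "i < N" "j < N"
  shows "(\<lambda>A. A $$ (i, j)) \<in> borel_measurable (herm_borel N)"
proof -
  let ?I = "{..<N} \<times> {..<N}"
  let ?e = "\<lambda>A :: complex mat. \<lambda>ij\<in>?I. A $$ ij"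
  have "?e \<in> herm_borel N \<rightarrow>\<^sub>M Pi\<^sub>M ?I (\<lambda>_. borel)"
    unfolding herm_borel_def by (rule measurable_vimage_algebra1) (auto simp: space_PiM)
  then have "(\<lambda>A. ?e A (i, j)) \<in> borel_measurable (herm_borel N)"
    by (rule measurable_compose) (use assms in \<open>auto intro!: measurable_component_singleton\<close>)
  then show ?thesis using assms by simp
qed

lemma mat_adjoint_index:
  assumes "A \<in> carrier_mat N N" "i < N" "j < N"
  shows "mat_adjoint A $$ (i, j) = cnj (A $$ (j, i))"
  using assms by (simp add: mat_adjoint_def mat_of_rows_index)

lemma herm_iff:
  "A \<in> herm N \<longleftrightarrow> A \<in> carrier_mat N N \<and> (\<forall>i<N. \<forall>j<N. A $$ (i, j) = cnj (A $$ (j, i)))"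
proof (cases "A \<in> carrier_mat N N")
  case True
  moreover have "mat_adjoint A \<in> carrier_mat N N"
    using True unfolding mat_adjoint_def by (intro carrier_matI) auto
  ultimately have "mat_adjoint A = A \<longleftrightarrow> (\<forall>i<N. \<forall>j<N. mat_adjoint A $$ (i, j) = A $$ (i, j))"
    using eq_matI[of A "mat_adjoint A"] by auto
  also have "\<dots> \<longleftrightarrow> (\<forall>i<N. \<forall>j<N. A $$ (i, j) = cnj (A $$ (j, i)))"
    using mat_adjoint_index[OF True] by metis
  finally show ?thesis using True by (simp add: herm_def)
qed (simp add: herm_def)

lemma herm_ball_iff:
  assumes A: "A \<in> herm N" and R: "0 \<le> R"
  shows "A \<in> herm_ball N R \<longleftrightarrow> (\<forall>v\<in>carrier_vec N. vnorm v \<le> 1 \<longrightarrow>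
    (\<Sum>i<N. (cmod (\<Sum>j<N. A $$ (i, j) * vec_index v j))\<^sup>2) \<le> R\<^sup>2)"
proof -
  have Ac: "A \<in> carrier_mat N N" using A by (simp add: herm_def)
  have "vnorm (A *\<^sub>v v) \<le> R \<longleftrightarrow> (\<Sum>i<N. (cmod (\<Sum>j<N. A $$ (i, j) * vec_index v j))\<^sup>2) \<le> R\<^sup>2"
    if "v \<in> carrier_vec N" for v
  proof -
    have "dim_vec (A *\<^sub>v v) = N" using Ac by simp
    then show ?thesis
      unfolding vnorm_le_iff[OF R] using mult_mat_vec_index[OF Ac that] by simp
  qed
  then show ?thesis using A by (simp add: herm_ball_def opnorm_le_iff[OF Ac])
qed

text \<open>The operator norm condition is an uncountable intersection over vectors, so
  measurability comes from closedness: each condition is a closed one on the entries.\<close>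

lemma herm_ball_sets [measurable]:
  assumes R: "0 \<le> R"
  shows "herm_ball N R \<in> sets (herm_borel N)"
proof -
  let ?I = "{..<N} \<times> {..<N}"
  \<comment> \<open>Padding by 0 gives a map into all functions on index pairs, the type whose
    product topology makes \<open>F\<close> closed.\<close>
  define \<phi> where "\<phi> A ij = (if ij \<in> ?I then A $$ ij else 0)" for A :: "complex mat" and ij
  define F :: "(nat \<times> nat \<Rightarrow> complex) set" where
    "F = (\<Inter>v\<in>{v \<in> carrier_vec N. vnorm v \<le> 1}. {x. (\<Sum>i<N. (cmod (\<Sum>j<N. x (i, j) * vec_index v j))\<^sup>2) \<le> R\<^sup>2})"
  have "closed F"
    unfolding F_def
    by (intro closed_INT ballI closed_Collect_le continuous_intros continuous_on_product_coordinates)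
  then have F: "F \<in> sets borel" by (rule borel_closed)
  have \<phi>: "\<phi> \<in> borel_measurable (herm_borel N)"
  proof (rule measurable_coordinatewise_then_product)
    fix ij :: "nat \<times> nat"
    show "(\<lambda>A. \<phi> A ij) \<in> borel_measurable (herm_borel N)"
      by (cases ij; cases "ij \<in> ?I") (auto simp: \<phi>_def intro: measurable_entry)
  qed
  have "herm_ball N R = \<phi> -` F \<inter> space (herm_borel N)"
  proof -
    have "A \<in> herm_ball N R \<longleftrightarrow> \<phi> A \<in> F" if "A \<in> herm N" for A
      unfolding herm_ball_iff[OF that R] F_def by (auto simp: \<phi>_def)
    then show ?thesis by (auto simp: herm_ball_def)
  qed
  then show ?thesis using measurable_sets[OF \<phi> F] by simp
qed

abbreviation coord_space :: "nat \<Rightarrow> (nat \<times> nat \<Rightarrow> real) measure" where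
  "coord_space N \<equiv> Pi\<^sub>M ({..<N} \<times> {..<N}) (\<lambda>_. lborel)"

lemma herm_of_coords_index:
  assumes "i < N" "j < N"
  shows "herm_of_coords N x $$ (i, j) = (if i = j then complex_of_real (x (i, i))
     else if i < j then Complex (x (i, j)) (x (j, i)) / complex_of_real (sqrt 2)
     else Complex (x (j, i)) (- x (i, j)) / complex_of_real (sqrt 2))"
  using assms by (simp add: herm_of_coords_def)

lemma herm_of_coords_herm: "herm_of_coords N x \<in> herm N"
proof -
  have "herm_of_coords N x \<in> carrier_mat N N" by (simp add: herm_of_coords_def)
  then show ?thesis
    by (auto simp: herm_iff herm_of_coords_index complex_eq_iff)
qed

lemma measurable_herm_of_coords [measurable]: "herm_of_coords N \<in> coord_space N \<rightarrow>\<^sub>M herm_borel N"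
  unfolding herm_borel_def
proof (rule measurable_vimage_algebra2)
  show "(\<lambda>x. \<lambda>ij\<in>{..<N} \<times> {..<N}. herm_of_coords N x $$ ij)
      \<in> coord_space N \<rightarrow>\<^sub>M Pi\<^sub>M ({..<N} \<times> {..<N}) (\<lambda>_. borel)"
  proof (rule measurable_restrict)
    fix ij assume ij: "ij \<in> {..<N} \<times> {..<N}"
    then obtain i j where [simp]: "ij = (i, j)" "i < N" "j < N" by auto
    have c: "(\<lambda>x. x (a, b)) \<in> borel_measurable (coord_space N)" if "a < N" "b < N" for a b
      using measurable_component_singleton[of "(a, b)" "{..<N} \<times> {..<N}" "\<lambda>_. lborel :: real measure"] that
      by simp
    have "(\<lambda>x. Complex (x (a, b)) (x (b, a))) \<in> borel_measurable (coord_space N)"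
      "(\<lambda>x. Complex (x (a, b)) (- x (b, a))) \<in> borel_measurable (coord_space N)"
      "(\<lambda>x. complex_of_real (x (a, b))) \<in> borel_measurable (coord_space N)" if "a < N" "b < N" for a b
      using that by (auto simp: borel_measurable_complex_iff intro!: c borel_measurable_uminus)
    then show "(\<lambda>x. herm_of_coords N x $$ ij) \<in> borel_measurable (coord_space N)"
      by (cases "i = j"; cases "i < j") (auto simp: herm_of_coords_index intro!: borel_measurable_divide)
  qed
qed (auto intro: herm_of_coords_herm)

lemma sets_herm_leb [simp, measurable_cong]: "sets (herm_leb N) = sets (herm_borel N)"
  by (simp add: herm_leb_def)

lemma space_herm_leb [simp]: "space (herm_leb N) = herm N"
  by (simp add: herm_leb_def)

text \<open>The coordinates are isometric for the Hilbert-Schmidt norm. The entries at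
  \<open>(i, j)\<close> and \<open>(j, i)\<close> both have squared modulus equal to the mean of the
  two squared coordinates, on the diagonal as well, and the mean disappears in the symmetric double
  sum.\<close>

lemma herm_of_coords_norm:
  "(\<Sum>i<N. \<Sum>j<N. (cmod (herm_of_coords N x $$ (i, j)))\<^sup>2) = (\<Sum>ij\<in>{..<N} \<times> {..<N}. (x ij)\<^sup>2)"
proof -
  have e: "(cmod (herm_of_coords N x $$ (i, j)))\<^sup>2 = ((x (i, j))\<^sup>2 + (x (j, i))\<^sup>2) / 2" if "i < N" "j < N" for i j
    using that by (simp add: herm_of_coords_index cmod_power2 norm_divide power_divide)
  have "(\<Sum>i<N. \<Sum>j<N. (cmod (herm_of_coords N x $$ (i, j)))\<^sup>2) = (\<Sum>i<N. \<Sum>j<N. ((x (i, j))\<^sup>2 + (x (j, i))\<^sup>2) / 2)"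
    by (intro sum.cong) (auto simp: e)
  also have "\<dots> = ((\<Sum>i<N. \<Sum>j<N. (x (i, j))\<^sup>2) + (\<Sum>i<N. \<Sum>j<N. (x (j, i))\<^sup>2)) / 2"
    by (simp add: sum.distrib sum_divide_distrib[symmetric])
  also have "(\<Sum>i<N. \<Sum>j<N. (x (j, i))\<^sup>2) = (\<Sum>i<N. \<Sum>j<N. (x (i, j))\<^sup>2)"
    by (rule sum.swap)
  finally show ?thesis by (simp add: sum.cartesian_product split_beta)
qed

text \<open>The integral of \<open>exp (R^2 - N * x^2)\<close> over the real line, the factor that
  one real coordinate contributes.\<close>

definition gauss_bound :: "nat \<Rightarrow> real \<Rightarrow> real" where
  "gauss_bound N R = exp (R\<^sup>2) * sqrt (pi / real N)"

text \<open>
  On the ball \<open>\<Sum>x\<^sub>i\<^sub>j\<^sup>2 \<le> N R\<^sup>2\<close>, so the Gaussian weight \<open>exp (N (N R\<^sup>2 - \<Sum>x\<^sub>i\<^sub>j\<^sup>2))\<close> is at least 1 there.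
  Its variance is chosen so that the volume bound cancels the normalisation \<open>n / 2 ln N\<close>.
\<close>

lemma emeasure_herm_ball:
  assumes N: "N \<ge> 1" and R: "0 \<le> R"
  shows "emeasure (herm_leb N) (herm_ball N R) \<le> ennreal (gauss_bound N R ^ N\<^sup>2)"
proof -
  let ?I = "{..<N} \<times> {..<N}"
  interpret product_sigma_finite "\<lambda>_ :: nat \<times> nat. lborel :: real measure" ..
  define g where "g x = exp (R\<^sup>2 - real N * x\<^sup>2)" for x :: real
  have [measurable]: "g \<in> borel_measurable borel" unfolding g_def by measurable
  have ball: "herm_ball N R \<in> sets (herm_borel N)" using R by measurable
  have "emeasure (herm_leb N) (herm_ball N R)
      = emeasure (coord_space N) (herm_of_coords N -` herm_ball N R \<inter> space (coord_space N))"
    unfolding herm_leb_def by (rule emeasure_distr[OF measurable_herm_of_coords ball])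
  also have "\<dots> = (\<integral>\<^sup>+x. indicator (herm_of_coords N -` herm_ball N R \<inter> space (coord_space N)) x \<partial>coord_space N)"
    by (rule nn_integral_indicator[symmetric]) (rule measurable_sets[OF measurable_herm_of_coords ball])
  also have "\<dots> \<le> (\<integral>\<^sup>+x. (\<Prod>ij\<in>?I. ennreal (g (x ij))) \<partial>coord_space N)"
  proof (intro nn_integral_mono)
    fix x
    have "1 \<le> (\<Prod>ij\<in>?I. g (x ij))" if "herm_of_coords N x \<in> herm_ball N R"
    proof -
      \<comment> \<open>Coordinates are traded for columns, each of which contributes at most the
        square of \<open>R\<close>.\<close>
      have "(\<Sum>ij\<in>?I. (x ij)\<^sup>2) = (\<Sum>j<N. \<Sum>i<N. (cmod (herm_of_coords N x $$ (i, j)))\<^sup>2)"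
        unfolding herm_of_coords_norm[symmetric] by (rule sum.swap)
      also have "\<dots> \<le> (\<Sum>j<N. R\<^sup>2)"
        using that by (intro sum_mono herm_ball_column(1)) auto
      also have "\<dots> = real N * R\<^sup>2" by simp
      finally have "real N * (\<Sum>ij\<in>?I. (x ij)\<^sup>2) \<le> real N * (real N * R\<^sup>2)"
        by (intro mult_left_mono) auto
      \<comment> \<open>There are \<open>N^2\<close> coordinates, so the constant terms of the
        exponents add up to exactly \<open>N * (N * R^2)\<close>.\<close>
      then have "0 \<le> (\<Sum>ij\<in>?I. R\<^sup>2 - real N * (x ij)\<^sup>2)"
        by (simp add: sum_subtractf sum_distrib_left[symmetric] card_cartesian_product mult_ac)
      then show ?thesis unfolding g_def by (subst exp_sum[symmetric]) auto
    qed
    then show "indicator (herm_of_coords N -` herm_ball N R \<inter> space (coord_space N)) x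
        \<le> (\<Prod>ij\<in>?I. ennreal (g (x ij)))"
      by (auto simp: prod_ennreal g_def indicator_def)
  qed
  also have "\<dots> = (\<Prod>ij\<in>?I. \<integral>\<^sup>+x. ennreal (g x) \<partial>lborel)"
    by (rule product_nn_integral_prod) auto
  also have "(\<integral>\<^sup>+x. ennreal (g x) \<partial>lborel) = ennreal (gauss_bound N R)"
  proof -
    \<comment> \<open>The standard deviation for which the normal density is a multiple of
      \<open>exp (- N * x^2)\<close>.\<close>
    define s where "s = 1 / sqrt (2 * real N)"
    have s: "0 < s" "s\<^sup>2 = 1 / (2 * real N)" using N by (auto simp: s_def power_divide)
    have "g x = gauss_bound N R * normal_density 0 s x" for x
    proof -
      have "sqrt (2 * pi * s\<^sup>2) = sqrt (pi / real N)" unfolding s(2) by simp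
      moreover have "sqrt (pi / real N) \<noteq> 0" using N by simp
      moreover have "- (x - 0)\<^sup>2 / (2 * s\<^sup>2) = - real N * x\<^sup>2" unfolding s(2) using N by simp
      ultimately have "normal_density 0 s x = 1 / sqrt (pi / real N) * exp (- real N * x\<^sup>2)"
        unfolding normal_density_def by (simp only:)
      moreover have "g x = exp (R\<^sup>2) * exp (- real N * x\<^sup>2)"
        unfolding g_def by (simp add: exp_diff exp_minus field_simps)
      ultimately show ?thesis
        using \<open>sqrt (pi / real N) \<noteq> 0\<close> unfolding gauss_bound_def by (simp only: mult.assoc) simp
    qed
    then have "(\<integral>\<^sup>+x. ennreal (g x) \<partial>lborel) = (\<integral>\<^sup>+x. ennreal (gauss_bound N R) * ennreal (normal_density 0 s x) \<partial>lborel)"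
      by (simp add: ennreal_mult gauss_bound_def)
    also have "\<dots> = ennreal (gauss_bound N R) * (\<integral>\<^sup>+x. ennreal (normal_density 0 s x) \<partial>lborel)"
      by (rule nn_integral_cmult) measurable
    also have "(\<integral>\<^sup>+x. ennreal (normal_density 0 s x) \<partial>lborel) = 1"
      using s by (subst nn_integral_eq_integral) auto
    finally show ?thesis by simp
  qed
  also have "(\<Prod>ij\<in>?I. ennreal (gauss_bound N R)) = ennreal (gauss_bound N R ^ N\<^sup>2)"
    by (simp add: card_cartesian_product power2_eq_square ennreal_power gauss_bound_def)
  finally show ?thesis .
qed

section \<open>The ball as a finite measure space, and its powers\<close>

definition leb_herm_ball :: "nat \<Rightarrow> real \<Rightarrow> complex mat measure" where
  "leb_herm_ball N R = restrict_space (herm_leb N) (herm_ball N R)"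

lemma space_leb_herm_ball: "0 \<le> R \<Longrightarrow> space (leb_herm_ball N R) = herm_ball N R"
  unfolding leb_herm_ball_def by (auto simp: space_restrict_space herm_ball_def)

lemma emeasure_leb_herm_ball:
  assumes "N \<ge> 1" "0 \<le> R"
  shows "emeasure (leb_herm_ball N R) (space (leb_herm_ball N R)) \<le> ennreal (gauss_bound N R ^ N\<^sup>2)"
  unfolding space_leb_herm_ball[OF assms(2)] leb_herm_ball_def
  using emeasure_herm_ball[OF assms] assms herm_ball_sets[of R N] sets.sets_into_space[OF herm_ball_sets[of R N]]
  by (subst emeasure_restrict_space) (auto simp: Int_absorb2)

lemma finite_measure_leb_herm_ball:
  assumes "N \<ge> 1" "0 \<le> R"
  shows "finite_measure (leb_herm_ball N R)"
  using emeasure_leb_herm_ball[OF assms] by (intro finite_measureI) (auto simp: top_unique)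

lemma sigma_finite_herm_leb:
  assumes N: "N \<ge> 1"
  shows "sigma_finite_measure (herm_leb N)"
proof
  have "\<exists>k. A \<in> herm_ball N (real k)" if "A \<in> herm N" for A
    using that real_arch_simple[of "opnorm A"] by (auto simp: herm_ball_def)
  then have "(\<Union>k. herm_ball N (real k)) = space (herm_leb N)"
    by (auto simp: herm_ball_def)
  moreover have "emeasure (herm_leb N) (herm_ball N (real k)) \<noteq> \<infinity>" for k
    using emeasure_herm_ball[OF N, of "real k"] by (auto simp: top_unique)
  ultimately show "\<exists>A. countable A \<and> A \<subseteq> sets (herm_leb N) \<and> \<Union> A = space (herm_leb N) \<and>
      (\<forall>a\<in>A. emeasure (herm_leb N) a \<noteq> \<infinity>)"
    by (intro exI[of _ "range (\<lambda>k. herm_ball N (real k))"]) (auto intro!: herm_ball_sets)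
qed

text \<open>Restricting the product measure agrees with taking the product of the restrictions. The
  second form gives access to coordinate projections and to the splitting of tuples.\<close>

lemma leb_ball_PiM:
  assumes N: "N \<ge> 1" and R: "0 \<le> R"
  shows "leb_ball n N R = Pi\<^sub>M {..<n} (\<lambda>_. leb_herm_ball N R)"
proof -
  interpret F: finite_measure "leb_herm_ball N R" by (rule finite_measure_leb_herm_ball[OF assms])
  interpret H: sigma_finite_measure "herm_leb N" by (rule sigma_finite_herm_leb[OF N])
  interpret P: product_sigma_finite "\<lambda>_ :: nat. leb_herm_ball N R" ..
  interpret Q: product_sigma_finite "\<lambda>_ :: nat. herm_leb N" ..
  let ?B = "Pi\<^sub>E {..<n} (\<lambda>_. herm_ball N R)"
  let ?X = "leb_ball n N R" and ?Y = "Pi\<^sub>M {..<n} (\<lambda>_. leb_herm_ball N R)"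
  have ball: "herm_ball N R \<in> sets (herm_leb N)" using herm_ball_sets[OF R] by simp
  have B: "?B \<in> sets (Pi\<^sub>M {..<n} (\<lambda>_. herm_leb N))"
    using ball by (intro sets_PiM_I_finite) auto
  have sp: "space ?X = ?B" "space ?Y = ?B"
    using B by (simp_all add: leb_ball_def space_PiM space_leb_herm_ball[OF R])
  \<comment> \<open>The two sigma-algebras are compared by measurability of the identity in both
    directions; afterwards agreement on rectangles is enough.\<close>
  have id1: "(\<lambda>x. x) \<in> ?Y \<rightarrow>\<^sub>M ?X"
    unfolding leb_ball_def
  proof (rule measurable_restrict_space2)
    have "(\<lambda>x. \<lambda>i\<in>{..<n}. x i) \<in> ?Y \<rightarrow>\<^sub>M Pi\<^sub>M {..<n} (\<lambda>_. herm_leb N)"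
    proof (rule measurable_restrict)
      fix i assume "i \<in> {..<n}"
      then have "(\<lambda>x. x i) \<in> ?Y \<rightarrow>\<^sub>M leb_herm_ball N R" by (rule measurable_component_singleton)
      moreover have "(\<lambda>A. A) \<in> leb_herm_ball N R \<rightarrow>\<^sub>M herm_leb N"
        unfolding leb_herm_ball_def by (rule measurable_restrict_space1) simp
      ultimately show "(\<lambda>x. x i) \<in> ?Y \<rightarrow>\<^sub>M herm_leb N" by (rule measurable_compose)
    qed
    then show "(\<lambda>x. x) \<in> ?Y \<rightarrow>\<^sub>M Pi\<^sub>M {..<n} (\<lambda>_. herm_leb N)"
      by (rule measurable_cong[THEN iffD1, rotated]) (auto simp: sp PiE_def)
  qed (auto simp: sp)
  have id2: "(\<lambda>x. x) \<in> ?X \<rightarrow>\<^sub>M ?Y"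
  proof -
    have "(\<lambda>x. \<lambda>i\<in>{..<n}. x i) \<in> ?X \<rightarrow>\<^sub>M ?Y"
    proof (rule measurable_restrict)
      fix i assume i: "i \<in> {..<n}"
      show "(\<lambda>x. x i) \<in> ?X \<rightarrow>\<^sub>M leb_herm_ball N R"
        unfolding leb_herm_ball_def
      proof (rule measurable_restrict_space2)
        show "(\<lambda>x. x i) \<in> ?X \<rightarrow>\<^sub>M herm_leb N"
          unfolding leb_ball_def using i by (intro measurable_restrict_space1 measurable_component_singleton)
      qed (use i in \<open>auto simp: sp\<close>)
    qed
    then show ?thesis
      by (rule measurable_cong[THEN iffD1, rotated]) (auto simp: sp PiE_def)
  qed
  have sets: "sets ?X = sets ?Y"
  proof
    show "sets ?X \<subseteq> sets ?Y"
      using measurable_sets[OF id1] sets.sets_into_space[of _ ?X] by (auto simp: sp Int_absorb2)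
    show "sets ?Y \<subseteq> sets ?X"
      using measurable_sets[OF id2] sets.sets_into_space[of _ ?Y] by (auto simp: sp Int_absorb2)
  qed
  show ?thesis
  proof (rule P.PiM_eqI)
    fix A :: "nat \<Rightarrow> complex mat set"
    assume A: "\<And>i. i \<in> {..<n} \<Longrightarrow> A i \<in> sets (leb_herm_ball N R)"
    then have A': "A i \<subseteq> herm_ball N R" "A i \<in> sets (herm_leb N)" if "i < n" for i
      using that A[of i] sets_restrict_space_iff[of "herm_ball N R" "herm_leb N" "A i"]
      unfolding leb_herm_ball_def sets.Int_space_eq2[OF ball] by (simp_all add: ball[simplified])
    have "emeasure ?X (Pi\<^sub>E {..<n} A) = emeasure (Pi\<^sub>M {..<n} (\<lambda>_. herm_leb N)) (Pi\<^sub>E {..<n} A)"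
      unfolding leb_ball_def
      using B A' by (intro emeasure_restrict_space) (auto simp: sets.Int_space_eq2 intro!: PiE_mono)
    also have "\<dots> = (\<Prod>i<n. emeasure (herm_leb N) (A i))"
      using A' by (intro Q.emeasure_PiM) auto
    also have "\<dots> = (\<Prod>i<n. emeasure (leb_herm_ball N R) (A i))"
      unfolding leb_herm_ball_def
      using A' ball
      by (intro prod.cong emeasure_restrict_space[symmetric]) (simp_all only: sets.Int_space_eq2 lessThan_iff)
    finally show "emeasure ?X (Pi\<^sub>E {..<n} A) = (\<Prod>i<n. emeasure (leb_herm_ball N R) (A i))" .
  qed (simp_all add: sets)
qed

lemma space_leb_ball:
  assumes "N \<ge> 1" "0 \<le> R"
  shows "space (leb_ball n N R) = Pi\<^sub>E {..<n} (\<lambda>_. herm_ball N R)"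
  by (simp add: leb_ball_PiM[OF assms] space_PiM space_leb_herm_ball[OF assms(2)])

lemma emeasure_leb_ball:
  assumes "N \<ge> 1" "0 \<le> R"
  shows "emeasure (leb_ball n N R) (space (leb_ball n N R)) \<le> ennreal ((gauss_bound N R ^ N\<^sup>2) ^ n)"
proof -
  interpret F: finite_measure "leb_herm_ball N R" by (rule finite_measure_leb_herm_ball[OF assms])
  interpret P: product_sigma_finite "\<lambda>_ :: nat. leb_herm_ball N R" ..
  have "emeasure (leb_ball n N R) (space (leb_ball n N R))
      = (\<Prod>i<n. emeasure (leb_herm_ball N R) (space (leb_herm_ball N R)))"
    unfolding leb_ball_PiM[OF assms] space_PiM by (rule P.emeasure_PiM) auto
  also have "\<dots> \<le> (\<Prod>i<n. ennreal (gauss_bound N R ^ N\<^sup>2))"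
    by (intro prod_mono_ennreal emeasure_leb_herm_ball[OF assms])
  also have "\<dots> = ennreal ((gauss_bound N R ^ N\<^sup>2) ^ n)"
    by (simp add: ennreal_power gauss_bound_def)
  finally show ?thesis .
qed

lemma finite_measure_leb_ball:
  assumes "N \<ge> 1" "0 \<le> R"
  shows "finite_measure (leb_ball n N R)"
  using emeasure_leb_ball[OF assms, of n] by (intro finite_measureI) (auto simp: top_unique)

section \<open>Splitting a tuple of length \<open>m + l\<close>\<close>

definition join_seq :: "nat \<Rightarrow> nat \<Rightarrow> (nat \<Rightarrow> 'a) \<times> (nat \<Rightarrow> 'a) \<Rightarrow> nat \<Rightarrow> 'a" where
  "join_seq m l = (\<lambda>(x, y). \<lambda>i\<in>{..<m + l}. if i < m then x i else y (i - m))"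

definition take_seq :: "nat \<Rightarrow> nat \<Rightarrow> (nat \<Rightarrow> 'a) \<Rightarrow> nat \<Rightarrow> 'a" where
  "take_seq k m M = (\<lambda>i\<in>{..<m}. M (i + k))"

lemma prod_lessThan_add:
  fixes f :: "nat \<Rightarrow> 'a :: comm_monoid_mult"
  shows "(\<Prod>i<m + l. f i) = (\<Prod>i<m. f i) * (\<Prod>i<l. f (i + m))"
  by (induction l) (simp_all add: mult.assoc add.commute)

lemma measurable_join_seq:
  "join_seq m l \<in> Pi\<^sub>M {..<m} (\<lambda>_. M) \<Otimes>\<^sub>M Pi\<^sub>M {..<l} (\<lambda>_. M) \<rightarrow>\<^sub>M Pi\<^sub>M {..<m + l} (\<lambda>_. M)"
  unfolding join_seq_def split_beta
proof (rule measurable_restrict)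
  fix i assume "i \<in> {..<m + l}"
  then show "(\<lambda>x. if i < m then fst x i else snd x (i - m)) \<in> Pi\<^sub>M {..<m} (\<lambda>_. M) \<Otimes>\<^sub>M Pi\<^sub>M {..<l} (\<lambda>_. M) \<rightarrow>\<^sub>M M"
    by (cases "i < m")
      (auto intro!: measurable_compose[OF measurable_fst] measurable_compose[OF measurable_snd]
        measurable_component_singleton)
qed

lemma measurable_take_seq:
  "k + m \<le> n \<Longrightarrow> take_seq k m \<in> Pi\<^sub>M {..<n} (\<lambda>_. M) \<rightarrow>\<^sub>M Pi\<^sub>M {..<m} (\<lambda>_. M)"
  unfolding take_seq_def by (intro measurable_restrict measurable_component_singleton) auto

lemma take_seq_join_seq:
  assumes "x \<in> extensional {..<m}" "y \<in> extensional {..<l}"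
  shows "take_seq 0 m (join_seq m l (x, y)) = x" "take_seq m l (join_seq m l (x, y)) = y"
  using assms by (auto simp: take_seq_def join_seq_def fun_eq_iff extensional_def)

text \<open>Rectangles determine the product measure, and \<open>join_seq\<close> pulls a rectangle
  back to the product of two rectangles, the second one reindexed by \<open>m\<close>.\<close>

lemma PiM_join_seq:
  fixes M :: "'a measure"
  assumes "sigma_finite_measure M"
  shows "Pi\<^sub>M {..<m + l} (\<lambda>_. M) = distr (Pi\<^sub>M {..<m} (\<lambda>_. M) \<Otimes>\<^sub>M Pi\<^sub>M {..<l} (\<lambda>_. M)) (Pi\<^sub>M {..<m + l} (\<lambda>_. M)) (join_seq m l)"
proof -
  interpret M: sigma_finite_measure M by fact
  interpret P: product_sigma_finite "\<lambda>_ :: nat. M" ..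
  interpret L: sigma_finite_measure "Pi\<^sub>M {..<l} (\<lambda>_. M)" by (rule P.sigma_finite) simp
  let ?D = "distr (Pi\<^sub>M {..<m} (\<lambda>_. M) \<Otimes>\<^sub>M Pi\<^sub>M {..<l} (\<lambda>_. M)) (Pi\<^sub>M {..<m + l} (\<lambda>_. M)) (join_seq m l)"
  have "?D = Pi\<^sub>M {..<m + l} (\<lambda>_. M)"
  proof (rule P.PiM_eqI)
    fix A :: "nat \<Rightarrow> 'a set" assume A: "\<And>i. i \<in> {..<m + l} \<Longrightarrow> A i \<in> sets M"
    have sub: "A i \<subseteq> space M" if "i < m + l" for i using A[of i] that sets.sets_into_space by auto
    have eq: "join_seq m l -` (Pi\<^sub>E {..<m + l} A) \<inter> space (Pi\<^sub>M {..<m} (\<lambda>_. M) \<Otimes>\<^sub>M Pi\<^sub>M {..<l} (\<lambda>_. M))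
        = Pi\<^sub>E {..<m} A \<times> Pi\<^sub>E {..<l} (\<lambda>i. A (i + m))" (is "?lhs = ?rhs")
    proof (rule equalityI; rule subsetI)
      fix z assume "z \<in> ?lhs"
      then obtain x y where z: "z = (x, y)" "x \<in> extensional {..<m}" "y \<in> extensional {..<l}"
          and j: "\<And>i. i < m + l \<Longrightarrow> (if i < m then x i else y (i - m)) \<in> A i"
        by (auto simp: space_pair_measure space_PiM join_seq_def PiE_iff)
      have "x i \<in> A i" if "i < m" for i using j[of i] that by simp
      moreover have "y i \<in> A (i + m)" if "i < l" for i using j[of "i + m"] that by simp
      ultimately show "z \<in> ?rhs" using z by (auto simp: PiE_iff)
    next
      fix z assume "z \<in> ?rhs"
      then obtain x y where z: "z = (x, y)" "x \<in> Pi\<^sub>E {..<m} A" "y \<in> Pi\<^sub>E {..<l} (\<lambda>i. A (i + m))"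
        by auto
      have "(if i < m then x i else y (i - m)) \<in> A i" if "i < m + l" for i
        using z(2,3) that by (auto simp: PiE_iff dest: bspec[of _ _ "i - m"])
      moreover have "x i \<in> space M" if "i < m" for i
        using z(2) sub[of i] that by (auto simp: PiE_iff)
      moreover have "y i \<in> space M" if "i < l" for i
        using z(3) sub[of "i + m"] that by (auto simp: PiE_iff)
      ultimately show "z \<in> ?lhs"
        using z by (auto simp: space_pair_measure space_PiM join_seq_def PiE_iff)
    qed
    have "emeasure ?D (Pi\<^sub>E {..<m + l} A)
        = emeasure (Pi\<^sub>M {..<m} (\<lambda>_. M) \<Otimes>\<^sub>M Pi\<^sub>M {..<l} (\<lambda>_. M)) (Pi\<^sub>E {..<m} A \<times> Pi\<^sub>E {..<l} (\<lambda>i. A (i + m)))"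
      unfolding eq[symmetric] using A
      by (intro emeasure_distr measurable_join_seq sets_PiM_I_finite) auto
    also have "\<dots> = emeasure (Pi\<^sub>M {..<m} (\<lambda>_. M)) (Pi\<^sub>E {..<m} A) * emeasure (Pi\<^sub>M {..<l} (\<lambda>_. M)) (Pi\<^sub>E {..<l} (\<lambda>i. A (i + m)))"
      using A by (intro L.emeasure_pair_measure_Times sets_PiM_I_finite) auto
    also have "\<dots> = (\<Prod>i<m. emeasure M (A i)) * (\<Prod>i<l. emeasure M (A (i + m)))"
      using A P.emeasure_PiM[of "{..<m}" A] P.emeasure_PiM[of "{..<l}" "\<lambda>i. A (i + m)"] by simp
    also have "\<dots> = (\<Prod>i<m + l. emeasure M (A i))" by (rule prod_lessThan_add[symmetric])
    finally show "emeasure ?D (Pi\<^sub>E {..<m + l} A) = (\<Prod>i<m + l. emeasure M (A i))" .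
  qed simp_all
  then show ?thesis by simp
qed

text \<open>Entries of a word are polynomials in the entries of the matrices. The recursion holds
  only for matrices of the right size, so measurability is transferred on the space of the
  measure.\<close>

lemma measurable_word_eval:
  assumes NR: "N \<ge> 1" "0 \<le> R" and "set xs \<subseteq> {..<n}" and a: "a < N" and b: "b < N"
  shows "(\<lambda>M. word_eval N M (Word xs) $$ (a, b)) \<in> borel_measurable (leb_ball n N R)"
  using assms(3) a
proof (induction xs arbitrary: a)
  case Nil
  then show ?case by (simp add: word_eval_Nil)
next
  case (Cons i xs)
  have "(\<lambda>M. M i $$ (a, c)) \<in> borel_measurable (leb_ball n N R)" if "c < N" for c
  proof (rule measurable_compose[where f = "\<lambda>M. M i" and g = "\<lambda>A. A $$ (a, c)"])
    show "(\<lambda>M. M i) \<in> leb_ball n N R \<rightarrow>\<^sub>M leb_herm_ball N R"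
      unfolding leb_ball_PiM[OF NR] using Cons by (intro measurable_component_singleton) auto
    have "(\<lambda>A. A $$ (a, c)) \<in> borel_measurable (herm_leb N)" using Cons that by measurable
    then show "(\<lambda>A. A $$ (a, c)) \<in> borel_measurable (leb_herm_ball N R)"
      unfolding leb_herm_ball_def by (rule measurable_restrict_space1)
  qed
  then have "(\<lambda>M. \<Sum>c<N. M i $$ (a, c) * word_eval N M (Word xs) $$ (c, b)) \<in> borel_measurable (leb_ball n N R)"
    using Cons by (intro borel_measurable_sum borel_measurable_times Cons.IH) auto
  moreover have "word_eval N M (Word (i # xs)) $$ (a, b) = (\<Sum>c<N. M i $$ (a, c) * word_eval N M (Word xs) $$ (c, b))"
    if "M \<in> space (leb_ball n N R)" for M
  proof (rule word_eval_Cons_index[of n])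
    show "M j \<in> carrier_mat N N" if "j < n" for j
      using \<open>M \<in> space (leb_ball n N R)\<close> that
      by (intro herm_ball_carrier[of _ _ R]) (auto simp: space_leb_ball[OF NR])
  qed (use Cons b in auto)
  ultimately show ?case by (simp cong: measurable_cong)
qed

lemma measurable_matrix_state:
  assumes NR: "N \<ge> 1" "0 \<le> R" and P: "P \<in> ncpolys n"
  shows "(\<lambda>M. matrix_state n N M P) \<in> borel_measurable (leb_ball n N R)"
proof -
  have "(\<lambda>M. word_trace N M w) \<in> borel_measurable (leb_ball n N R)" if "w \<in> words n" for w
    using measurable_word_eval[OF NR, of "letters w" n] that
    unfolding word_trace_def by (intro borel_measurable_divide borel_measurable_sum) (auto simp: words_def)
  then show ?thesis
    using P unfolding matrix_state_eq[OF P] lift_ncpoly_def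
    by (intro borel_measurable_sum borel_measurable_times) (auto simp: ncpolys_def)
qed

lemma matrix_state_bound_space:
  assumes NR: "N \<ge> 1" "0 \<le> R" and "P \<in> ncpolys n" "M \<in> space (leb_ball n N R)"
  shows "cmod (matrix_state n N M P) \<le> ncpoly_norm (real N * R) P"
  using assms by (intro matrix_state_bound) (auto simp: space_leb_ball[OF NR])

lemma integrable_matrix_state:
  assumes NR: "N \<ge> 1" "0 \<le> R" and P: "P \<in> ncpolys n" and \<mu>: "\<mu> \<in> borel_probs n N R"
  shows "integrable \<mu> (\<lambda>M. matrix_state n N M P)"
proof -
  interpret prob_space \<mu> using \<mu> by (simp add: borel_probs_def)
  have sets: "sets \<mu> = sets (leb_ball n N R)" using \<mu> by (simp add: borel_probs_def)
  show ?thesis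
  proof (rule integrable_const_bound)
    show "AE M in \<mu>. cmod (matrix_state n N M P) \<le> ncpoly_norm (real N * R) P"
      using matrix_state_bound_space[OF NR P] sets_eq_imp_space_eq[OF sets] by (intro AE_I2) auto
    show "(\<lambda>M. matrix_state n N M P) \<in> borel_measurable \<mu>"
      using measurable_matrix_state[OF NR P] measurable_cong_sets[OF sets refl] by auto
  qed
qed

section \<open>Free entropy\<close>

text \<open>Positivity of \<open>t\<close> keeps this true for an empty index set, where both sides
  are \<open>-\<infinity>\<close>.\<close>

lemma ereal_mult_SUP_le:
  fixes f :: "'a \<Rightarrow> ereal"
  assumes "0 < t"
  shows "ereal t * (SUP a\<in>A. f a) \<le> (SUP a\<in>A. ereal t * f a)"
proof -
  have "f a \<le> (SUP a\<in>A. ereal t * f a) / ereal t" if "a \<in> A" for a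
    using assms that by (subst ereal_le_divide_pos) (auto intro: SUP_upper)
  then have "(SUP a\<in>A. f a) \<le> (SUP a\<in>A. ereal t * f a) / ereal t"
    by (rule SUP_least)
  then show ?thesis using assms by (subst (asm) ereal_le_divide_pos) auto
qed

definition Ent_sup :: "nat \<Rightarrow> real \<Rightarrow> (ncpoly \<Rightarrow> complex) \<Rightarrow> real \<Rightarrow> real \<Rightarrow> nat \<Rightarrow> ereal" where
  "Ent_sup n R \<tau> \<epsilon> K N =
     (SUP \<mu>\<in>{\<mu> \<in> borel_probs n N R. barycenter n N \<mu> \<in> nbhd n R \<tau> \<epsilon> K}. Ent (leb_ball n N R) \<mu>)"

text \<open>An increasing affine function of \<open>x\<close> whose additive term is linear in
  \<open>n\<close>: compatible with order, with convex combinations and with a splitting of the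
  variables.\<close>

definition rescaled :: "nat \<Rightarrow> nat \<Rightarrow> ereal \<Rightarrow> ereal" where
  "rescaled n N x = ereal (1 / real N ^ 2) * x + ereal (real n / 2 * ln (real N))"

lemma tilde_chi_gen_eq:
  "tilde_chi_gen lm n R \<tau> = (INF (\<epsilon>, K)\<in>{0<..} \<times> {0<..}. lm (\<lambda>N. rescaled n N (Ent_sup n R \<tau> \<epsilon> K N)))"
  by (simp add: tilde_chi_gen_def Ent_sup_def rescaled_def)

lemma chi_gen_eq:
  "chi_gen lm n R \<tau> = (INF (\<epsilon>, K)\<in>{0<..} \<times> {0<..}.
     lm (\<lambda>N. rescaled n N (ln_ennreal (emeasure (leb_ball n N R) (microstates n R \<tau> \<epsilon> K N)))))"
  by (simp add: chi_gen_def rescaled_def)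

lemma rescaled_mono: "x \<le> y \<Longrightarrow> rescaled n N x \<le> rescaled n N y"
  unfolding rescaled_def by (intro add_right_mono ereal_mult_left_mono) auto

text \<open>For \<open>N \<ge> 1\<close> the factor is positive and infinite values are preserved;
  at \<open>N = 0\<close> it would be 0 and turn \<open>-\<infinity>\<close> into 0.\<close>

lemma rescaled_convex:
  assumes "N \<ge> 1" "0 < t" "t < 1" "x \<noteq> \<infinity>" "y \<noteq> \<infinity>" and le: "ereal t * x + ereal (1 - t) * y \<le> z"
  shows "ereal t * rescaled n N x + ereal (1 - t) * rescaled n N y \<le> rescaled n N z"
proof (cases "x = -\<infinity> \<or> y = -\<infinity> \<or> z = \<infinity>")
  case True
  have "rescaled n N x \<noteq> \<infinity>" "rescaled n N y \<noteq> \<infinity>"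
    using assms by (cases x; cases y; simp add: rescaled_def)+
  moreover have "rescaled n N (-\<infinity>) = -\<infinity>" "rescaled n N \<infinity> = \<infinity>"
    using assms(1) by (simp_all add: rescaled_def)
  ultimately show ?thesis
    using True assms(2,3) by (cases "rescaled n N x"; cases "rescaled n N y") auto
next
  case False
  define k d where "k = 1 / real N ^ 2" and "d = real n / 2 * ln (real N)"
  obtain a b where ab: "x = ereal a" "y = ereal b"
    using False assms by (cases x; cases y) auto
  then obtain c where c: "z = ereal c" using False le by (cases z) auto
  have "t * a + (1 - t) * b \<le> c" using le ab c by simp
  then have "k * (t * a + (1 - t) * b) \<le> k * c" by (intro mult_left_mono) (auto simp: k_def)
  \<comment> \<open>The weights add up to 1, so the additive term \<open>d\<close> appears once on
    each side.\<close>
  then have "t * (k * a + d) + (1 - t) * (k * b + d) \<le> k * c + d" by (simp add: algebra_simps)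
  moreover have "rescaled n N (ereal r) = ereal (k * r + d)" for r
    by (simp add: rescaled_def k_def d_def)
  ultimately show ?thesis by (simp add: ab c)
qed

lemma rescaled_add:
  assumes "N \<ge> 1" "x \<noteq> \<infinity>" "y \<noteq> \<infinity>"
  shows "rescaled (m + l) N (x + y) = rescaled m N x + rescaled l N y"
  using assms by (cases x; cases y) (auto simp: rescaled_def algebra_simps add_divide_distrib)

context
  fixes N :: nat and R :: real
  assumes N: "N \<ge> 1" and R: "0 \<le> R"
begin

lemma Ent_borel_probs_le:
  assumes "\<mu> \<in> borel_probs n N R"
  shows "Ent (leb_ball n N R) \<mu> \<le> ereal (real n * (real N ^ 2 * (R\<^sup>2 + ln (pi / real N) / 2)))"
proof -
  have pos: "0 < gauss_bound N R" using N by (simp add: gauss_bound_def)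
  have "Ent (leb_ball n N R) \<mu> \<le> ereal (ln ((gauss_bound N R ^ N\<^sup>2) ^ n))"
    using assms pos emeasure_leb_ball[OF N R, of n]
    by (intro Ent_le_ln finite_measure_leb_ball[OF N R]) (auto simp: borel_probs_def)
  also have "ln ((gauss_bound N R ^ N\<^sup>2) ^ n) = real n * (real N ^ 2 * ln (gauss_bound N R))"
    using pos by (simp add: ln_realpow)
  also have "ln (gauss_bound N R) = R\<^sup>2 + ln (pi / real N) / 2"
    using N unfolding gauss_bound_def by (subst ln_mult) (auto simp: ln_sqrt)
  finally show ?thesis .
qed

lemma Ent_sup_le: "Ent_sup n R \<tau> \<epsilon> K N \<le> ereal (real n * (real N ^ 2 * (R\<^sup>2 + ln (pi / real N) / 2)))"
  unfolding Ent_sup_def by (rule SUP_least) (auto intro: Ent_borel_probs_le)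

lemma Ent_sup_not_PInfty: "Ent_sup n R \<tau> \<epsilon> K N \<noteq> \<infinity>"
  using Ent_sup_le[of n \<tau> \<epsilon> K] by auto

lemma rescaled_Ent_sup_le: "rescaled n N (Ent_sup n R \<tau> \<epsilon> K N) \<le> ereal (real n * (R\<^sup>2 + ln pi / 2))"
proof -
  have "rescaled n N (Ent_sup n R \<tau> \<epsilon> K N)
      \<le> rescaled n N (ereal (real n * (real N ^ 2 * (R\<^sup>2 + ln (pi / real N) / 2))))"
    by (rule rescaled_mono[OF Ent_sup_le])
  also have "\<dots> = ereal (real n * (R\<^sup>2 + ln pi / 2))"
    using N by (simp add: rescaled_def ln_div field_simps)
  finally show ?thesis .
qed

lemma Ent_sup_concave:
  assumes t: "0 < t" "t < 1"
  shows "ereal t * Ent_sup n R \<sigma> \<epsilon> K N + ereal (1 - t) * Ent_sup n R \<tau> \<epsilon> K N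
    \<le> Ent_sup n R (\<lambda>P\<in>ncpolys n. of_real t * \<sigma> P + of_real (1 - t) * \<tau> P) \<epsilon> K N" (is "_ \<le> ?S")
proof -
  let ?M = "\<lambda>\<tau>. {\<mu> \<in> borel_probs n N R. barycenter n N \<mu> \<in> nbhd n R \<tau> \<epsilon> K}"
  let ?L = "leb_ball n N R"
  interpret finite_measure ?L by (rule finite_measure_leb_ball[OF N R])
  have fin: "Ent ?L \<mu> \<noteq> \<infinity>" if "\<mu> \<in> borel_probs n N R" for \<mu>
    using Ent_borel_probs_le[OF that] by auto
  have bd: "(SUP \<mu>\<in>?M \<tau>. ereal s * Ent ?L \<mu>) \<noteq> \<infinity>" if "0 < s" for s \<tau>
  proof -
    have "(SUP \<mu>\<in>?M \<tau>. ereal s * Ent ?L \<mu>)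
        \<le> ereal s * ereal (real n * (real N ^ 2 * (R\<^sup>2 + ln (pi / real N) / 2)))"
      using that by (intro SUP_least ereal_mult_left_mono Ent_borel_probs_le) auto
    then show ?thesis by auto
  qed
  have le: "ereal t * Ent ?L \<mu> + ereal (1 - t) * Ent ?L \<nu> \<le> ?S"
    if \<mu>: "\<mu> \<in> ?M \<sigma>" and \<nu>: "\<nu> \<in> ?M \<tau>" for \<mu> \<nu>
  proof (cases "Ent ?L \<mu> = -\<infinity> \<or> Ent ?L \<nu> = -\<infinity>")
    \<comment> \<open>No entropy is \<open>\<infinity>\<close>, so the left side is
      \<open>-\<infinity>\<close>. Only pairs of finite entropies require a mixture.\<close>
    case True
    then show ?thesis
      using fin[of \<mu>] fin[of \<nu>] \<mu> \<nu> t by (cases "Ent ?L \<mu>"; cases "Ent ?L \<nu>") auto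
  next
    case False
    have pr: "prob_space \<mu>" "prob_space \<nu>" using \<mu> \<nu> by (auto simp: borel_probs_def)
    obtain \<rho> where \<rho>: "prob_space \<rho>" "sets \<rho> = sets ?L"
      "\<And>\<phi> :: _ \<Rightarrow> complex. integrable \<mu> \<phi> \<Longrightarrow> integrable \<nu> \<phi> \<Longrightarrow>
         (\<integral>x. \<phi> x \<partial>\<rho>) = of_real t * (\<integral>x. \<phi> x \<partial>\<mu>) + of_real (1 - t) * (\<integral>x. \<phi> x \<partial>\<nu>)"
      "ereal t * Ent ?L \<mu> + ereal (1 - t) * Ent ?L \<nu> \<le> Ent ?L \<rho>"
      using Ent_concave[OF finite_measure_axioms pr t] False by metis
    have bary: "barycenter n N \<rho> = (\<lambda>P\<in>ncpolys n. of_real t * barycenter n N \<mu> P + of_real (1 - t) * barycenter n N \<nu> P)"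
      using \<mu> \<nu> \<rho>(3) by (auto simp: barycenter_def fun_eq_iff integrable_matrix_state[OF N R])
    have "barycenter n N \<rho> \<in> nbhd n R (\<lambda>P\<in>ncpolys n. of_real t * \<sigma> P + of_real (1 - t) * \<tau> P) \<epsilon> K"
      unfolding bary using \<mu> \<nu> t by (intro nbhd_convex) auto
    then have "Ent ?L \<rho> \<le> ?S"
      unfolding Ent_sup_def using \<rho>(1,2) by (intro SUP_upper) (auto simp: borel_probs_def)
    with \<rho>(4) show ?thesis by (rule order_trans)
  qed
  have "ereal t * Ent_sup n R \<sigma> \<epsilon> K N + ereal (1 - t) * Ent_sup n R \<tau> \<epsilon> K N
      \<le> (SUP \<mu>\<in>?M \<sigma>. ereal t * Ent ?L \<mu>) + (SUP \<nu>\<in>?M \<tau>. ereal (1 - t) * Ent ?L \<nu>)"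
    unfolding Ent_sup_def using t by (intro add_mono ereal_mult_SUP_le) auto
  also have "\<dots> \<le> ?S" using t by (intro SUP_add_le_ereal le bd) auto
  finally show ?thesis .
qed

lemma ln_microstates_le:
  "ln_ennreal (emeasure (leb_ball n N R) (microstates n R \<tau> \<epsilon> K N)) \<le> Ent_sup n R \<tau> \<epsilon> K N"
proof (cases "emeasure (leb_ball n N R) (microstates n R \<tau> \<epsilon> K N) = 0")
  case True
  then show ?thesis by (simp add: ln_ennreal_def)
next
  case False
  let ?L = "leb_ball n N R" and ?G = "microstates n R \<tau> \<epsilon> K N"
  interpret finite_measure ?L by (rule finite_measure_leb_ball[OF N R])
  \<comment> \<open>Measurability of the microstates comes for free: a set outside the sigma-algebra
    has \<open>emeasure\<close> 0 and belongs to the other case.\<close>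
  have G: "?G \<in> sets ?L" using False emeasure_neq_0_sets by blast
  define \<mu> where "\<mu> = uniform_measure ?L ?G"
  have pr: "prob_space \<mu>"
    unfolding \<mu>_def by (rule prob_space_uniform_measure[OF False]) (simp add: emeasure_eq_measure)
  have \<mu>: "\<mu> \<in> borel_probs n N R" using pr by (simp add: borel_probs_def \<mu>_def)
  have "(\<lambda>P\<in>ncpolys n. \<integral>M. matrix_state n N M P \<partial>\<mu>) \<in> nbhd n R \<tau> \<epsilon> K"
  proof (rule nbhd_average[OF pr])
    show "AE M in \<mu>. matrix_state n N M \<in> nbhd n R \<tau> \<epsilon> K"
      unfolding \<mu>_def using G by (intro AE_uniform_measureI) (auto simp: microstates_def)
    show "AE M in \<mu>. cmod (matrix_state n N M P) \<le> ncpoly_norm (real N * R) P" if "P \<in> ncpolys n" for P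
      using matrix_state_bound_space[OF N R that] by (intro AE_I2) (auto simp: \<mu>_def)
  qed (use R \<mu> in \<open>auto intro: integrable_matrix_state[OF N R]\<close>)
  then have "barycenter n N \<mu> \<in> nbhd n R \<tau> \<epsilon> K" by (simp add: barycenter_def)
  then have "Ent ?L \<mu> \<le> Ent_sup n R \<tau> \<epsilon> K N"
    unfolding Ent_sup_def using \<mu> by (intro SUP_upper) auto
  then show ?thesis using Ent_uniform_measure[OF finite_measure_axioms G False] by (simp add: \<mu>_def)
qed

text \<open>Evaluating \<open>P\<close> at the selected matrices is evaluating
  \<open>shift k P\<close> at the full tuple, so a change of variables turns the barycenter of the
  image into a marginal.\<close>

lemma barycenter_take_seq:
  assumes \<mu>: "\<mu> \<in> borel_probs n N R" and le: "k + m \<le> n"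
  shows "distr \<mu> (leb_ball m N R) (take_seq k m) \<in> borel_probs m N R"
    and "barycenter m N (distr \<mu> (leb_ball m N R) (take_seq k m)) = marginal k m (barycenter n N \<mu>)"
proof -
  have sets: "sets \<mu> = sets (leb_ball n N R)" and "prob_space \<mu>" using \<mu> by (auto simp: borel_probs_def)
  interpret prob_space \<mu> by fact
  have meas: "take_seq k m \<in> \<mu> \<rightarrow>\<^sub>M leb_ball m N R"
    using measurable_take_seq[OF le, of "leb_herm_ball N R"]
    by (simp add: leb_ball_PiM[OF N R, symmetric] measurable_cong_sets[OF sets refl])
  show "distr \<mu> (leb_ball m N R) (take_seq k m) \<in> borel_probs m N R"
    using prob_space_distr[OF meas] by (simp add: borel_probs_def)
  have "(\<integral>M. matrix_state m N M P \<partial>distr \<mu> (leb_ball m N R) (take_seq k m))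
      = (\<integral>M. matrix_state n N M (shift k P) \<partial>\<mu>)" if P: "P \<in> ncpolys m" for P
  proof -
    have "matrix_state m N (take_seq k m M) P = matrix_state n N M (shift k P)" for M
      by (rule matrix_state_shift[OF P le, symmetric]) (simp add: take_seq_def)
    then show ?thesis by (simp add: integral_distr[OF meas measurable_matrix_state[OF N R P]])
  qed
  then show "barycenter m N (distr \<mu> (leb_ball m N R) (take_seq k m)) = marginal k m (barycenter n N \<mu>)"
    using ncpolys_shift[OF _ le] by (auto simp: barycenter_def marginal_def fun_eq_iff)
qed

text \<open>Projections of a measure admissible for \<open>\<tau>\<close> are admissible for the two
  marginal states with the same \<open>\<epsilon>\<close> and \<open>K\<close>, so its entropy is
  bounded by the sum of the two suprema.\<close>

lemma Ent_sup_subadditive: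
  "Ent_sup (m + l) R \<tau> \<epsilon> K N \<le> Ent_sup m R (marginal 0 m \<tau>) \<epsilon> K N + Ent_sup l R (marginal m l \<tau>) \<epsilon> K N"
  unfolding Ent_sup_def[of "m + l"]
proof (rule SUP_least)
  fix \<mu> assume "\<mu> \<in> {\<mu> \<in> borel_probs (m + l) N R. barycenter (m + l) N \<mu> \<in> nbhd (m + l) R \<tau> \<epsilon> K}"
  then have \<mu>: "\<mu> \<in> borel_probs (m + l) N R" and b: "barycenter (m + l) N \<mu> \<in> nbhd (m + l) R \<tau> \<epsilon> K" by auto
  let ?L = "\<lambda>n. leb_ball n N R"
  let ?\<mu>1 = "distr \<mu> (?L m) (take_seq 0 m)" and ?\<mu>2 = "distr \<mu> (?L l) (take_seq m l)"
  have "Ent (?L (m + l)) \<mu> \<le> Ent (?L m) ?\<mu>1 + Ent (?L l) ?\<mu>2"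
  proof (rule Ent_subadditive)
    interpret F: finite_measure "leb_herm_ball N R" by (rule finite_measure_leb_herm_ball[OF N R])
    note PiM = leb_ball_PiM[OF N R]
    show "join_seq m l \<in> ?L m \<Otimes>\<^sub>M ?L l \<rightarrow>\<^sub>M ?L (m + l)"
      unfolding PiM by (rule measurable_join_seq)
    show "?L (m + l) = distr (?L m \<Otimes>\<^sub>M ?L l) (?L (m + l)) (join_seq m l)"
      unfolding PiM by (rule PiM_join_seq) (rule F.sigma_finite_measure_axioms)
    show "take_seq 0 m \<in> ?L (m + l) \<rightarrow>\<^sub>M ?L m" "take_seq m l \<in> ?L (m + l) \<rightarrow>\<^sub>M ?L l"
      unfolding PiM by (intro measurable_take_seq; simp)+
    show "take_seq 0 m (join_seq m l (x, y)) = x" "take_seq m l (join_seq m l (x, y)) = y"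
      if "x \<in> space (?L m)" "y \<in> space (?L l)" for x y
      using that by (auto simp: space_leb_ball[OF N R] PiE_def take_seq_join_seq)
  qed (use \<mu> in \<open>auto simp: borel_probs_def intro: finite_measure_leb_ball[OF N R]\<close>)
  also have "\<dots> \<le> Ent_sup m R (marginal 0 m \<tau>) \<epsilon> K N + Ent_sup l R (marginal m l \<tau>) \<epsilon> K N"
    unfolding Ent_sup_def
    using barycenter_take_seq[OF \<mu>, of 0 m] barycenter_take_seq[OF \<mu>, of m l]
      marginal_nbhd[OF b, of 0 m] marginal_nbhd[OF b, of m l]
    by (intro add_mono SUP_upper) auto
  finally show "Ent (?L (m + l)) \<mu> \<le> Ent_sup m R (marginal 0 m \<tau>) \<epsilon> K N + Ent_sup l R (marginal m l \<tau>) \<epsilon> K N" .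
qed

end

lemma Ent_sup_mono:
  "\<epsilon> \<le> \<epsilon>' \<Longrightarrow> K' \<le> K \<Longrightarrow> Ent_sup n R \<tau> \<epsilon> K N \<le> Ent_sup n R \<tau> \<epsilon>' K' N"
  unfolding Ent_sup_def using nbhd_mono[of \<epsilon> \<epsilon>' K' K n R \<tau>] by (intro SUP_subset_mono) auto

section \<open>Limits over the matrix size\<close>

lemma tilde_chi_gen_Liminf_concave:
  assumes F: "F \<noteq> bot" "eventually (\<lambda>N. N \<ge> 1) F" and R: "0 \<le> R"
  shows "concave_on_states n R (tilde_chi_gen (Liminf F) n R)"
  unfolding concave_on_states_def
proof (intro ballI)
  fix \<sigma> \<tau> :: "ncpoly \<Rightarrow> complex" and t :: real
  assume \<sigma>: "\<sigma> \<in> states n R" and \<tau>: "\<tau> \<in> states n R" and t: "t \<in> {0..1}"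
  let ?\<rho> = "\<lambda>P\<in>ncpolys n. of_real t * \<sigma> P + of_real (1 - t) * \<tau> P"
  let ?F = "tilde_chi_gen (Liminf F) n R" and ?A = "\<lambda>\<tau> \<epsilon> K N. rescaled n N (Ent_sup n R \<tau> \<epsilon> K N)"
  \<comment> \<open>At the endpoints the combination is one of the two states itself, by
    extensionality, and \<open>0 * x = 0\<close> in \<open>ereal\<close> even for infinite
    \<open>x\<close>. The mixture argument covers the open interval.\<close>
  consider "t = 0" | "t = 1" | "0 < t" "t < 1" using t by fastforce
  then show "ereal t * ?F \<sigma> + ereal (1 - t) * ?F \<tau> \<le> ?F ?\<rho>"
  proof cases
    case 1
    then have "?\<rho> = \<tau>" using statesD(1)[OF \<tau>] by (auto simp: fun_eq_iff extensional_def)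
    then show ?thesis using 1 by (simp add: zero_ereal_def[symmetric] one_ereal_def[symmetric])
  next
    case 2
    then have "?\<rho> = \<sigma>" using statesD(1)[OF \<sigma>] by (auto simp: fun_eq_iff extensional_def)
    then show ?thesis using 2 by (simp add: zero_ereal_def[symmetric] one_ereal_def[symmetric])
  next
    case 3
    show ?thesis
      unfolding tilde_chi_gen_eq[of _ n R ?\<rho>]
    proof (rule INF_greatest)
      fix p :: "real \<times> real" assume "p \<in> {0<..} \<times> {0<..}"
      then obtain \<epsilon> K where p: "p = (\<epsilon>, K)" and eK: "\<epsilon> \<in> {0<..}" "K \<in> {0<..}" by auto
      \<comment> \<open>On the left each infimum may be replaced by its value at the pair under
        consideration, the same pair for both states.\<close>
      have F_le: "?F \<tau> \<le> Liminf F (?A \<tau> \<epsilon> K)" for \<tau>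
        unfolding tilde_chi_gen_eq using eK by (intro INF_lower2[of "(\<epsilon>, K)"]) auto
      have fin: "Liminf F (\<lambda>N. ereal s * ?A \<tau> \<epsilon> K N) \<noteq> \<infinity>" if "0 < s" for s \<tau>
      proof (rule Liminf_le_bound[OF F(1)])
        show "eventually (\<lambda>N. ereal s * ?A \<tau> \<epsilon> K N \<le> ereal (s * (real n * (R\<^sup>2 + ln pi / 2)))) F"
          using F(2)
        proof eventually_elim
          case (elim N)
          show ?case
            using ereal_mult_left_mono[OF rescaled_Ent_sup_le[OF elim R, of n \<tau> \<epsilon> K], of "ereal s"] that by simp
        qed
      qed
      have "ereal t * ?F \<sigma> + ereal (1 - t) * ?F \<tau>
          \<le> ereal t * Liminf F (?A \<sigma> \<epsilon> K) + ereal (1 - t) * Liminf F (?A \<tau> \<epsilon> K)"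
        using 3 by (intro add_mono ereal_mult_left_mono F_le) auto
      also have "\<dots> = Liminf F (\<lambda>N. ereal t * ?A \<sigma> \<epsilon> K N) + Liminf F (\<lambda>N. ereal (1 - t) * ?A \<tau> \<epsilon> K N)"
        using 3 by (simp add: Liminf_ereal_mult_left[OF F(1)])
      also have "\<dots> \<le> Liminf F (\<lambda>N. ereal t * ?A \<sigma> \<epsilon> K N + ereal (1 - t) * ?A \<tau> \<epsilon> K N)"
        using 3 by (intro Liminf_add_ge fin) auto
      also have "\<dots> \<le> Liminf F (?A ?\<rho> \<epsilon> K)"
      proof (rule Liminf_mono)
        show "eventually (\<lambda>N. ereal t * ?A \<sigma> \<epsilon> K N + ereal (1 - t) * ?A \<tau> \<epsilon> K N \<le> ?A ?\<rho> \<epsilon> K N) F"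
          using F(2)
          by eventually_elim (use R 3 in \<open>intro rescaled_convex Ent_sup_concave Ent_sup_not_PInfty\<close>)
      qed
      finally show "ereal t * ?F \<sigma> + ereal (1 - t) * ?F \<tau>
          \<le> (case p of (\<epsilon>, K) \<Rightarrow> Liminf F (?A ?\<rho> \<epsilon> K))" by (simp add: p)
    qed
  qed
qed

lemma chi_gen_le_tilde_chi_gen:
  assumes "eventually (\<lambda>N. N \<ge> 1) F" and R: "0 \<le> R"
    and mono: "\<And>u v. eventually (\<lambda>N. u N \<le> v N) F \<Longrightarrow> lm u \<le> lm v"
  shows "chi_gen lm n R \<tau> \<le> tilde_chi_gen lm n R \<tau>"
  unfolding chi_gen_eq tilde_chi_gen_eq
proof (rule INF_mono', clarify)
  fix \<epsilon> K :: real
  show "lm (\<lambda>N. rescaled n N (ln_ennreal (emeasure (leb_ball n N R) (microstates n R \<tau> \<epsilon> K N))))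
      \<le> lm (\<lambda>N. rescaled n N (Ent_sup n R \<tau> \<epsilon> K N))"
    using assms(1)
    by (intro mono) (auto elim!: eventually_mono intro!: rescaled_mono ln_microstates_le[OF _ R])
qed

lemma tilde_chi_gen_Limsup_subadditive:
  assumes F: "F \<noteq> bot" "eventually (\<lambda>N. N \<ge> 1) F" and R: "0 \<le> R"
  shows "tilde_chi_gen (Limsup F) (m + l) R \<tau>
    \<le> tilde_chi_gen (Limsup F) m R (marginal 0 m \<tau>) + tilde_chi_gen (Limsup F) l R (marginal m l \<tau>)"
proof -
  let ?A = "\<lambda>n \<tau> (\<epsilon>, K). Limsup F (\<lambda>N. rescaled n N (Ent_sup n R \<tau> \<epsilon> K N))"
  have fin: "?A n \<tau> p \<noteq> \<infinity>" for n \<tau> p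
  proof (cases p)
    case (Pair \<epsilon> K)
    have "Limsup F (\<lambda>N. rescaled n N (Ent_sup n R \<tau> \<epsilon> K N)) \<noteq> \<infinity>"
    proof (rule Liminf_le_bound[OF F(1)])
      show "eventually (\<lambda>N. rescaled n N (Ent_sup n R \<tau> \<epsilon> K N) \<le> ereal (real n * (R\<^sup>2 + ln pi / 2))) F"
        using F(2) by eventually_elim (rule rescaled_Ent_sup_le[OF _ R])
    qed
    then show ?thesis using Pair by simp
  qed
  have le: "tilde_chi_gen (Limsup F) (m + l) R \<tau> \<le> ?A m (marginal 0 m \<tau>) p + ?A l (marginal m l \<tau>) q"
    if "p \<in> {0<..} \<times> {0<..}" "q \<in> {0<..} \<times> {0<..}" for p q
  proof -
    obtain \<epsilon>1 K1 \<epsilon>2 K2 where pq: "p = (\<epsilon>1, K1)" "q = (\<epsilon>2, K2)" by (metis prod.exhaust)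
    \<comment> \<open>The right side has two independent infima and the left only one. The smaller
      radius and the larger degree bound give a neighbourhood that refines both choices.\<close>
    define \<epsilon> K where "\<epsilon> = min \<epsilon>1 \<epsilon>2" and "K = max K1 K2"
    have "tilde_chi_gen (Limsup F) (m + l) R \<tau> \<le> ?A (m + l) \<tau> (\<epsilon>, K)"
      unfolding tilde_chi_gen_eq using that by (intro INF_lower) (auto simp: pq \<epsilon>_def K_def)
    also have "\<dots> \<le> Limsup F (\<lambda>N. rescaled m N (Ent_sup m R (marginal 0 m \<tau>) \<epsilon>1 K1 N)
        + rescaled l N (Ent_sup l R (marginal m l \<tau>) \<epsilon>2 K2 N))"
      unfolding prod.case
    proof (rule Limsup_mono)
      show "eventually (\<lambda>N. rescaled (m + l) N (Ent_sup (m + l) R \<tau> \<epsilon> K N)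
          \<le> rescaled m N (Ent_sup m R (marginal 0 m \<tau>) \<epsilon>1 K1 N)
            + rescaled l N (Ent_sup l R (marginal m l \<tau>) \<epsilon>2 K2 N)) F"
        using F(2)
      proof eventually_elim
        case (elim N)
        have "Ent_sup (m + l) R \<tau> \<epsilon> K N
            \<le> Ent_sup m R (marginal 0 m \<tau>) \<epsilon> K N + Ent_sup l R (marginal m l \<tau>) \<epsilon> K N"
          by (rule Ent_sup_subadditive[OF elim R])
        also have "\<dots> \<le> Ent_sup m R (marginal 0 m \<tau>) \<epsilon>1 K1 N + Ent_sup l R (marginal m l \<tau>) \<epsilon>2 K2 N"
          by (intro add_mono Ent_sup_mono) (auto simp: \<epsilon>_def K_def)
        finally show ?case
          using rescaled_mono rescaled_add[OF elim Ent_sup_not_PInfty[OF elim R] Ent_sup_not_PInfty[OF elim R]]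
          by metis
      qed
    qed
    also have "\<dots> \<le> ?A m (marginal 0 m \<tau>) p + ?A l (marginal m l \<tau>) q"
      unfolding pq prod.case by (rule Limsup_add_le)
    finally show ?thesis .
  qed
  have ne: "{0::real<..} \<times> {0::real<..} \<noteq> {}" by (auto intro: exI[of _ 1])
  show ?thesis
    unfolding tilde_chi_gen_eq[of _ m] tilde_chi_gen_eq[of _ l]
    by (rule INF_add_ge_ereal[OF le fin fin ne ne])
qed

theorem proposition4p3:
  fixes n :: nat and R :: real and \<omega> :: "nat filter"
  assumes "n \<ge> 1" and "R > 0" and "nontrivial_ultrafilter \<omega>"
  shows
    "concave_on_states n R (lower_tilde_chi n R) \<and>
     usc_on_states n R (lower_tilde_chi n R) \<and>
     concave_on_states n R (ultra_tilde_chi \<omega> n R) \<and>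
     usc_on_states n R (ultra_tilde_chi \<omega> n R) \<and>
     (\<forall>\<tau>\<in>states n R.
        lower_tilde_chi n R \<tau> \<ge> lower_chi n R \<tau> \<and>
        tilde_chi n R \<tau> \<ge> chi n R \<tau> \<and>
        ultra_tilde_chi \<omega> n R \<tau> \<ge> ultra_chi \<omega> n R \<tau>) \<and>
     (\<forall>m. 1 \<le> m \<and> m < n \<longrightarrow> (\<forall>\<tau>\<in>states n R.
        tilde_chi n R \<tau>
          \<le> tilde_chi m R (marginal 0 m \<tau>) + tilde_chi (n - m) R (marginal m (n - m) \<tau>) \<and>
        ultra_tilde_chi \<omega> n R \<tau>
          \<le> ultra_tilde_chi \<omega> m R (marginal 0 m \<tau>)
             + ultra_tilde_chi \<omega> (n - m) R (marginal m (n - m) \<tau>)))"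
proof -
  have R: "0 \<le> R" using assms by simp
  have \<omega>: "\<omega> \<noteq> bot" "eventually (\<lambda>N. N \<ge> 1) \<omega>"
    using assms(3) nontrivial_ultrafilter_eventually_ge_1 by (auto simp: nontrivial_ultrafilter_def)
  have sq: "sequentially \<noteq> bot" "eventually (\<lambda>N. N \<ge> 1) sequentially"
    by (auto simp: eventually_ge_at_top)
  \<comment> \<open>The lower limit serves concavity, semicontinuity and the comparison; the upper
    limit serves subadditivity.\<close>
  have Lim: "(Lim \<omega> :: (nat \<Rightarrow> ereal) \<Rightarrow> ereal) = Liminf \<omega>" "(Lim \<omega> :: (nat \<Rightarrow> ereal) \<Rightarrow> ereal) = Limsup \<omega>"
    using ultrafilter_Lim_ereal[OF assms(3)] by auto
  have "usc_on_states n R (lower_tilde_chi n R)" "usc_on_states n R (ultra_tilde_chi \<omega> n R)"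
    unfolding Lim(1) by (intro tilde_chi_gen_usc Liminf_mono always_eventually; simp)+
  moreover have "concave_on_states n R (lower_tilde_chi n R)" "concave_on_states n R (ultra_tilde_chi \<omega> n R)"
    unfolding Lim(1) using \<omega> sq R by (auto intro: tilde_chi_gen_Liminf_concave)
  moreover have "lower_chi n R \<tau> \<le> lower_tilde_chi n R \<tau>" "chi n R \<tau> \<le> tilde_chi n R \<tau>"
      "ultra_chi \<omega> n R \<tau> \<le> ultra_tilde_chi \<omega> n R \<tau>" for \<tau>
    unfolding Lim(1)
    by (rule chi_gen_le_tilde_chi_gen[OF sq(2) R], erule Liminf_mono,
        rule chi_gen_le_tilde_chi_gen[OF sq(2) R], erule Limsup_mono,
        rule chi_gen_le_tilde_chi_gen[OF \<omega>(2) R], erule Liminf_mono)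
  moreover have "tilde_chi n R \<tau> \<le> tilde_chi m R (marginal 0 m \<tau>) + tilde_chi (n - m) R (marginal m (n - m) \<tau>)"
      "ultra_tilde_chi \<omega> n R \<tau> \<le> ultra_tilde_chi \<omega> m R (marginal 0 m \<tau>)
             + ultra_tilde_chi \<omega> (n - m) R (marginal m (n - m) \<tau>)" if "m < n" for m \<tau>
    unfolding Lim(2)
    using that tilde_chi_gen_Limsup_subadditive[OF sq R, of m "n - m" \<tau>]
      tilde_chi_gen_Limsup_subadditive[OF \<omega> R, of m "n - m" \<tau>] by simp_all
  ultimately show ?thesis by blast
qed

end
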